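(* Let $G$ be a minimal non-$4$-choosable planar graph, embedded in the plane, and let $v$ be a vertex of degree $5$ in $G$. Then at least three of the faces incident to $v$ are each incident to at least two vertices of degree at least $5$.
   Context: All graphs are finite, simple and undirected. A graph is $4$-choosable if for every assignment of lists of size $4$ to its vertices there is a proper coloring choosing each vertex's color from its list. A minimal non-$4$-choosable planar graph is a planar graph that is not $4$-choosable and has the minimum number of vertices among such graphs. A face is incident to a vertex if the vertex lies on its boundary. *)

theory Defs
  imports "HOL-Analysis.Analysis"
begin

definition simple_graph :: "'a set \<Rightarrow> 'a set set \<Rightarrow> bool" where
  "simple_graph V E \<longleftrightarrow> finite V \<and> (\<forall>e\<in>E. e \<subseteq> V \<and> card e = 2)"

definition vertex_degree :: "'a set set \<Rightarrow> 'a \<Rightarrow> nat" where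
  "vertex_degree E v = card {e \<in> E. v \<in> e}"

text \<open>Colours are natural numbers: on a finite graph only finitely many colours occur in
  the lists, so this is no restriction.\<close>

definition choosable :: "nat \<Rightarrow> 'a set \<Rightarrow> 'a set set \<Rightarrow> bool" where
  "choosable k V E \<longleftrightarrow>
     (\<forall>L :: 'a \<Rightarrow> nat set. (\<forall>v\<in>V. finite (L v) \<and> card (L v) = k) \<longrightarrow>
        (\<exists>c. (\<forall>v\<in>V. c v \<in> L v) \<and> (\<forall>u v. {u, v} \<in> E \<longrightarrow> c u \<noteq> c v)))"

text \<open>A vertex \<open>v\<close> is drawn as the point \<open>p v\<close> and an edge \<open>e\<close> as the arc \<open>\<gamma> e\<close> joining the
  points of its two ends; the interior of an edge contains no vertex and no point of
  another edge.\<close>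

definition plane_embedding ::
  "'a set \<Rightarrow> 'a set set \<Rightarrow> ('a \<Rightarrow> complex) \<Rightarrow> ('a set \<Rightarrow> real \<Rightarrow> complex) \<Rightarrow> bool" where
  "plane_embedding V E p \<gamma> \<longleftrightarrow>
     inj_on p V \<and>
     (\<forall>e\<in>E. arc (\<gamma> e) \<and> {pathstart (\<gamma> e), pathfinish (\<gamma> e)} = p ` e) \<and>
     (\<forall>e\<in>E. (path_image (\<gamma> e) - p ` e) \<inter>
        (p ` V \<union> (\<Union>f\<in>E - {e}. path_image (\<gamma> f))) = {})"

definition planar :: "'a set \<Rightarrow> 'a set set \<Rightarrow> bool" where
  "planar V E \<longleftrightarrow> (\<exists>p \<gamma>. plane_embedding V E p \<gamma>)"

definition faces ::
  "'a set \<Rightarrow> 'a set set \<Rightarrow> ('a \<Rightarrow> complex) \<Rightarrow> ('a set \<Rightarrow> real \<Rightarrow> complex) \<Rightarrow> complex set set" where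
  "faces V E p \<gamma> = components (- (p ` V \<union> (\<Union>e\<in>E. path_image (\<gamma> e))))"

definition incident :: "('a \<Rightarrow> complex) \<Rightarrow> complex set \<Rightarrow> 'a \<Rightarrow> bool" where
  "incident p F v \<longleftrightarrow> p v \<in> frontier F"

text \<open>The competitors \<open>(V', E')\<close> have the same vertex type as \<open>(V, E)\<close>. This loses nothing:
  a graph with fewer vertices than \<open>(V, E)\<close> has an isomorphic copy on a subset of \<open>V\<close>.\<close>

definition minimal_non_4_choosable_planar :: "'a set \<Rightarrow> 'a set set \<Rightarrow> bool" where
  "minimal_non_4_choosable_planar V E \<longleftrightarrow>
     simple_graph V E \<and> planar V E \<and> \<not> choosable 4 V E \<and>
     (\<forall>(V' :: 'a set) E'. simple_graph V' E' \<and> planar V' E' \<and> \<not> choosable 4 V' E'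
        \<longrightarrow> card V \<le> card V')"

end

theory Submission
  imports Defs "HOL-Complex_Analysis.Riemann_Mapping"
begin

text \<open>
  Fix lists \<open>L\<close> of size four without a colouring. Contracting an edge keeps a graph planar: the
  complement of an arc in the sphere is homeomorphic to the plane by the Riemann mapping theorem, so
  the arc can be collapsed to a point. Hence two parts of the graph may be glued at a vertex after
  the colours of one part have been permuted, and minimality yields the following reduction: a
  connected set \<open>D\<close> of vertices of degree at most four contains no vertex having neighbours in two
  different parts \<open>I\<close>, \<open>W\<close> of the rest of the graph. Indeed, colourings of \<open>I\<close> and \<open>W\<close> extend
  greedily to \<open>D\<close> unless the colours of these two neighbours are always different elements of one
  list of size four, and then the two neighbours can be identified.

  Call a face at \<open>v\<close> bad if \<open>v\<close> is its only vertex of degree at least five. Suppose that two bad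
  faces share an edge \<open>uv\<close>. By Janiszewski's theorem the boundary of each contains a path of
  vertices of degree four from \<open>u\<close> to a further neighbour of \<open>v\<close>. If the two paths meet or are joined
  by an edge, the Jordan curve theorem shows that they separate \<open>v\<close> from the fourth neighbour of \<open>u\<close>,
  contradicting the reduction. Otherwise they span with \<open>v\<close> a theta graph, which is colourable from
  the remaining lists. So every edge at \<open>v\<close> lies on a face that is not bad. If \<open>v\<close> is not a cut
  vertex, every face has at most two edges at \<open>v\<close>, and five edges give three such faces. If \<open>v\<close> is a
  cut vertex, the edges at \<open>v\<close> split into two and three; the three give two such faces, and the
  reduction shows that the face enclosed by the other two is not bad either.
\<close>

section \<open>Collapsing an arc\<close>

text \<open>Faces are bare components of an open set, without any cyclic order of the edges at a
  vertex. Most of what is needed about them rests on one local fact, a consequence of Janiszewski's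
  theorem: near an inner point of an edge, all points on the same side of a cycle through that edge
  lie in one face. Planarity is topological as well, so minimality applies to a contracted graph
  only after it has been drawn again with arcs; hence an arc is collapsed by an actual map of the
  plane. The list size four acts in several ways. A vertex of degree at most four keeps at least as
  many colours as it has uncoloured neighbours. Two disjoint sets of attainable colours inside one
  list have together at most four elements, which is what allows a permutation of colours to make an
  identified vertex uncolourable. And \<open>v\<close>, of degree five, keeps two colours in the
  theta graph, enough to play the two legs against each other. At a cut vertex the five edges can
  only split into two and three because a minimal graph has no bridge: each component of the graph
  without \<open>v\<close> contains at least two neighbours of \<open>v\<close>.\<close>

lemma arc_collapse:
  fixes g :: "real \<Rightarrow> complex"
  assumes "arc g"
  obtains q :: "complex \<Rightarrow> complex" where "continuous_on UNIV q" "inj_on q (- path_image g)"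
    "\<And>z. q z = 0 \<longleftrightarrow> z \<in> path_image g"
proof -
  define A where "A = path_image g"
  define a where "a = pathstart g"
  \<comment> \<open>Inversion at an end of the arc sends that end to infinity. The rest of the arc
    becomes an unbounded connected closed set \<open>B\<close>, so that its complement
    \<open>S\<close>, which contains the image 0 of infinity, is simply connected.\<close>
  define \<iota> where "\<iota> = (\<lambda>z::complex. inverse (z - a))"
  define B where "B = \<iota> ` (A - {a})"
  define S where "S = - B"
  have compA: "compact A" and conA: "connected (- A)" and clA: "closed A"
    using assms connected_arc_complement[OF assms] compact_arc_image closed_arc_image
    by (auto simp: A_def)
  have aA: "a \<in> A" unfolding A_def a_def by (rule pathstart_in_path_image)
  have iota_iff: "\<iota> z = w \<longleftrightarrow> z = a + inverse w" if "w \<noteq> 0" for z w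
    using that unfolding \<iota>_def
    by (metis add.commute add_diff_cancel diff_add_cancel inverse_inverse_eq)
  have Bmem: "w \<in> B \<longleftrightarrow> w \<noteq> 0 \<and> a + inverse w \<in> A" for w
  proof
    assume "w \<in> B"
    then obtain z where z: "z \<in> A" "z \<noteq> a" "w = \<iota> z" by (auto simp: B_def)
    then have "w \<noteq> 0" by (simp add: \<iota>_def)
    then show "w \<noteq> 0 \<and> a + inverse w \<in> A" using z iota_iff by metis
  next
    assume *: "w \<noteq> 0 \<and> a + inverse w \<in> A"
    then have "w = \<iota> (a + inverse w)" by (simp add: \<iota>_def)
    moreover have "a + inverse w \<noteq> a" using * by simp
    ultimately show "w \<in> B" using * unfolding B_def by blast
  qed
  \<comment> \<open>A bound for the arc keeps \<open>B\<close> away from 0. The point 0 needs this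
    separate argument in the proof that \<open>S\<close> is open, since
    \<open>w \<mapsto> a + inverse w\<close> is not continuous there.\<close>
  obtain r where r: "r > 0" "\<And>z. z \<in> A \<Longrightarrow> norm (z - a) < r"
  proof -
    have "bounded A" using compA compact_imp_bounded by blast
    then obtain e where "A \<subseteq> ball a e" "e > 0"
      using bounded_subset_ballD by metis
    then show ?thesis using that[of e] by (fastforce simp: dist_norm norm_minus_commute)
  qed
  have ball_S: "ball 0 (1/r) \<inter> B = {}"
  proof -
    have False if "w \<in> B" "norm w < 1/r" for w
    proof -
      have w: "w \<noteq> 0" "a + inverse w \<in> A" using that(1) unfolding Bmem by blast+
      have "norm (inverse w) < r" using r(2)[OF w(2)] by simp
      then have "inverse r < norm w" using w(1) r(1)
        by (metis inverse_inverse_eq inverse_less_imp_less norm_inverse zero_less_norm_iff)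
      then show False using that(2) by (simp add: inverse_eq_divide)
    qed
    then show ?thesis by auto
  qed
  have opS: "open S"
  proof -
    have 1: "open (- {0::complex})" by auto
    have "continuous_on (- {0}) (\<lambda>w. a + inverse w)"
      by (intro continuous_intros) auto
    then have "open ((\<lambda>w. a + inverse w) -` (- A) \<inter> - {0})"
      using continuous_on_open_vimage[OF 1] clA by (metis open_Compl)
    moreover have "S = ((\<lambda>w. a + inverse w) -` (- A) \<inter> - {0}) \<union> ball 0 (1/r)"
      using ball_S r(1) unfolding S_def by (auto simp: Bmem)
    ultimately show ?thesis by auto
  qed
  have S0: "0 \<in> S" unfolding S_def by (simp add: Bmem)
  have Sim: "S - {0} = \<iota> ` (- A)"
  proof
    show "S - {0} \<subseteq> \<iota> ` (- A)"
    proof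
      fix w assume w: "w \<in> S - {0}"
      then have "a + inverse w \<in> - A" unfolding S_def by (auto simp: Bmem)
      moreover have "w = \<iota> (a + inverse w)" using w by (simp add: \<iota>_def)
      ultimately show "w \<in> \<iota> ` (- A)" by blast
    qed
    show "\<iota> ` (- A) \<subseteq> S - {0}"
    proof
      fix w assume "w \<in> \<iota> ` (- A)"
      then obtain z where z: "z \<notin> A" "w = \<iota> z" by blast
      then have "w \<noteq> 0" using aA by (auto simp: \<iota>_def)
      moreover from this have "z = a + inverse w" using iota_iff z by metis
      ultimately show "w \<in> S - {0}" unfolding S_def using z(1) by (simp add: Bmem)
    qed
  qed
  have contI: "continuous_on (- A) \<iota>"
    unfolding \<iota>_def using aA by (intro continuous_intros) auto
  have conS: "connected S"
  proof -
    have c: "connected (S - {0})"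
      unfolding Sim by (rule connected_continuous_image[OF contI conA])
    have "0 \<in> closure (S - {0})"
    proof -
      have "0 islimpt S" using opS S0 by (simp add: open_imp_islimpt interior_limit_point interior_open)
      then show ?thesis by (simp add: islimpt_in_closure)
    qed
    then have "S \<subseteq> closure (S - {0})" using closure_subset[of "S - {0}"] by blast
    then show ?thesis using connected_intermediate_closure[OF c, of S] by blast
  qed
  have conB: "connected B"
  proof -
    have "connected (g ` {0<..1})"
    proof (rule connected_continuous_image)
      show "continuous_on {0<..1} g"
        using assms unfolding arc_def path_def
        by (meson continuous_on_subset greaterThanAtMost_subseteq_atLeastAtMost_iff order_refl)
    qed auto
    moreover have "A - {a} = g ` {0<..1}"
    proof -
      have "{0..1::real} = insert 0 {0<..1}" by auto
      moreover have "g 0 \<notin> g ` {0<..1}" using assms unfolding arc_def inj_on_def by fastforce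
      ultimately show ?thesis unfolding A_def a_def path_image_def pathstart_def by auto
    qed
    moreover have "continuous_on (A - {a}) \<iota>"
      unfolding \<iota>_def by (intro continuous_intros) auto
    ultimately show ?thesis unfolding B_def using connected_continuous_image by metis
  qed
  have unbB: "\<not> bounded B"
  proof
    assume "bounded B"
    then obtain b where b: "b > 0" "\<And>w. w \<in> B \<Longrightarrow> norm w \<le> b"
      using bounded_pos by metis
    have "continuous_on {0..1} g" using assms by (simp add: arc_def path_def)
    then have "\<forall>e>0. \<exists>d>0. \<forall>x'\<in>{0..1}. dist x' 0 < d \<longrightarrow> dist (g x') (g 0) < e"
      unfolding continuous_on_iff by force
    then obtain d where d: "d > 0" "\<And>x. x \<in> {0..1} \<Longrightarrow> dist x 0 < d \<Longrightarrow> dist (g x) (g 0) < 1/b"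
      using b by (metis zero_less_divide_1_iff)
    define x where "x = min 1 (d/2)"
    have x: "0 < x" "x \<le> 1" "dist x 0 < d" using d by (auto simp: x_def)
    then have dx: "dist (g x) a < 1/b" using d(2)[of x] by (simp add: a_def pathstart_def)
    have gx: "g x \<in> A" "g x \<noteq> a"
      using x assms unfolding A_def a_def path_image_def pathstart_def arc_def inj_on_def by force+
    then have "\<iota> (g x) \<in> B" by (auto simp: B_def)
    then have "norm (\<iota> (g x)) \<le> b" using b by auto
    moreover have n: "norm (g x - a) < 1/b" "norm (g x - a) > 0" using dx gx by (auto simp: dist_norm)
    then have "inverse (1/b) < inverse (norm (g x - a))" by (intro less_imp_inverse_less)
    ultimately show False by (simp add: \<iota>_def norm_inverse)
  qed
  have "simply_connected S"
    unfolding simply_connected_eq_unbounded_complement_components[OF opS]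
  proof (intro conjI ballI conS)
    fix C assume "C \<in> components (- S)"
    moreover have "- S = B" by (simp add: S_def)
    moreover have "B \<noteq> {}" using unbB by auto
    ultimately have "C = B" using conB by (simp add: components_eq_sing_iff[THEN iffD2])
    then show "\<not> bounded C" using unbB by simp
  qed
  then have "S homeomorphic ball (0::complex) 1"
    using simply_connected_eq_homeomorphic_to_disc[OF opS] S0 by auto
  moreover have "ball (0::complex) 1 homeomorphic (UNIV :: complex set)"
    using homeomorphic_ball_UNIV[of 1 "0::complex"] by simp
  ultimately have "S homeomorphic (UNIV::complex set)" using homeomorphic_trans by blast
  then obtain h k where hk: "homeomorphism S (UNIV::complex set) h k"
    unfolding homeomorphic_def by blast
  \<comment> \<open>The point 0 of \<open>S\<close> stands for infinity, so
    \<open>h (\<iota> z)\<close> differs from \<open>h 0\<close> for every \<open>z\<close> off the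
    arc and the inverse makes sense. Near the arc, \<open>h (\<iota> z)\<close> leaves every compact
    set, which forces \<open>q\<close> to tend to 0.\<close>
  define q where "q = (\<lambda>z. if z \<in> A then 0 else inverse (h (\<iota> z) - h 0))"
  have iS: "\<iota> z \<in> S" "\<iota> z \<noteq> 0" if "z \<notin> A" for z using Sim that by auto
  have kh: "k (h w) = w" if "w \<in> S" for w using hk that unfolding homeomorphism_def by blast
  have hne: "h (\<iota> z) \<noteq> h 0" if "z \<notin> A" for z
    using iS[OF that] kh S0 by metis
  have q0: "q z = 0 \<longleftrightarrow> z \<in> A" for z
    using hne by (auto simp: q_def)
  have inj: "inj_on q (- A)"
  proof (rule inj_onI)
    fix x y assume xy: "x \<in> - A" "y \<in> - A" "q x = q y"
    then have "h (\<iota> x) = h (\<iota> y)" by (auto simp: q_def)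
    then have "\<iota> x = \<iota> y" using kh iS xy by (metis ComplD)
    then show "x = y" by (simp add: \<iota>_def)
  qed
  have contq1: "continuous_on (- A) q"
  proof -
    have "continuous_on S h" using hk unfolding homeomorphism_def by blast
    then have "continuous_on (- A) (\<lambda>z. h (\<iota> z))"
      using continuous_on_compose2[OF _ contI] Sim by (metis Diff_subset)
    then have "continuous_on (- A) (\<lambda>z. inverse (h (\<iota> z) - h 0))"
      using hne by (intro continuous_intros) auto
    then show ?thesis by (rule continuous_on_eq) (auto simp: q_def)
  qed
  have "isCont q z" for z
  proof (cases "z \<in> A")
    case False
    moreover have "open (- A)" using clA by (simp add: open_Compl)
    ultimately show ?thesis using contq1 by (simp add: continuous_on_eq_continuous_at)
  next
    case True
    have "\<exists>d>0. \<forall>y. dist y z < d \<longrightarrow> dist (q y) (q z) < e" if e: "e > 0" for e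
    proof -
      \<comment> \<open>Off the arc, \<open>q y\<close> has modulus at least \<open>e\<close>
        exactly when \<open>h (\<iota> y)\<close> lies in this closed ball. Thus \<open>T\<close>
        collects the points where \<open>q\<close> is not small, and it has to be kept away from
        \<open>z\<close>: at the end \<open>a\<close> by boundedness of \<open>K\<close>, at other
        points of the arc because \<open>K\<close> lies in \<open>S\<close>.\<close>
      define K where "K = k ` (cball (h 0) (1/e))"
      have contk: "continuous_on UNIV k" using hk unfolding homeomorphism_def by blast
      have "compact K" unfolding K_def
        by (rule compact_continuous_image[OF continuous_on_subset[OF contk]]) simp_all
      have "range k = S" using hk unfolding homeomorphism_def by blast
      then have KS: "K \<subseteq> S" unfolding K_def by blast
      define T where "T = {y. y \<noteq> a \<and> \<iota> y \<in> K}"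
      have Tnear: "\<exists>d>0. \<forall>y. dist y z < d \<longrightarrow> y \<notin> T"
      proof (cases "z = a")
        case True
        obtain b where b: "b > 0" "\<And>w. w \<in> K \<Longrightarrow> norm w \<le> b"
          using compact_imp_bounded[OF \<open>compact K\<close>] bounded_pos by metis
        have "y \<notin> T" if "dist y z < 1/b" for y
        proof
          assume y: "y \<in> T"
          then have "norm (inverse (y - a)) \<le> b" "y \<noteq> a" using b(2)[of "\<iota> y"] by (auto simp: T_def \<iota>_def)
          moreover from this have "norm (y - a) > 0" by simp
          ultimately have "1 \<le> b * norm (y - a)" unfolding norm_inverse
            by (simp add: inverse_eq_divide pos_divide_le_eq)
          moreover have "norm (y - a) < 1/b" using that True by (simp add: dist_norm)
          then have "norm (y - a) * b < 1" using b by (simp only: pos_less_divide_eq)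
          ultimately show False by (simp add: mult.commute)
        qed
        moreover have "1/b > 0" using b by simp
        ultimately show ?thesis by blast
      next
        case False
        have "\<iota> z \<notin> K" using True False KS unfolding S_def B_def by blast
        have "isCont \<iota> z" unfolding \<iota>_def using False by (intro continuous_intros) auto
        moreover have "open (- K)" using compact_imp_closed[OF \<open>compact K\<close>] by (simp add: open_Compl)
        ultimately have "\<exists>N. open N \<and> z \<in> N \<and> (\<forall>y\<in>N. \<iota> y \<in> - K)"
          using \<open>\<iota> z \<notin> K\<close> unfolding continuous_at_open by blast
        then obtain N where N: "open N" "z \<in> N" "\<forall>y\<in>N. \<iota> y \<in> - K"
          by blast
        then obtain d where "d > 0" "ball z d \<subseteq> N" by (meson open_contains_ball)
        then have "y \<notin> T" if "dist y z < d" for y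
        proof -
          have "y \<in> N" using \<open>ball z d \<subseteq> N\<close> that by (auto simp: dist_commute)
          then show ?thesis using N(3) by (simp add: T_def)
        qed
        then show ?thesis using \<open>d > 0\<close> by blast
      qed
      then obtain d where d: "d > 0" "\<And>y. dist y z < d \<Longrightarrow> y \<notin> T" by blast
      have "dist (q y) (q z) < e" if "dist y z < d" for y
      proof (cases "y \<in> A")
        case True then show ?thesis using q0[THEN iffD2, OF \<open>z \<in> A\<close>] q0[THEN iffD2, OF True] e by simp
      next
        case False
        then have "y \<noteq> a" using aA by blast
        then have "\<iota> y \<notin> K" using d(2)[OF that] by (simp add: T_def)
        have "h (\<iota> y) \<notin> cball (h 0) (1/e)"
        proof
          assume "h (\<iota> y) \<in> cball (h 0) (1/e)"
          then have "k (h (\<iota> y)) \<in> K" unfolding K_def by (rule imageI)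
          then show False using kh[OF iS(1)[OF False]] \<open>\<iota> y \<notin> K\<close> by simp
        qed
        then have "norm (h (\<iota> y) - h 0) > 1/e"
          unfolding mem_cball dist_norm norm_minus_commute[of "h 0"] by linarith
        then have "inverse (norm (h (\<iota> y) - h 0)) < inverse (1/e)"
          by (rule less_imp_inverse_less) (use e in simp)
        then have "norm (q y) < e" using False unfolding q_def by (simp add: norm_inverse)
        then show ?thesis using q0[THEN iffD2, OF \<open>z \<in> A\<close>] by (simp add: dist_norm)
      qed
      then show ?thesis using d(1) by blast
    qed
    then show ?thesis by (simp add: continuous_at_eps_delta)
  qed
  then have "continuous_on UNIV q" by (simp add: continuous_at_imp_continuous_on)
  then show ?thesis using that[OF _ inj[unfolded A_def] q0[unfolded A_def]] by simp
qed

section \<open>Arcs and Jordan curves in frontiers\<close>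

text \<open>Janiszewski's theorem: a side of the curve joins \<open>x\<close> to \<open>y\<close>
  off the curve, a small ball around \<open>q\<close> joins them off \<open>R\<close>, and the two
  obstacles meet in a connected set. In the application the curve is a cycle through an edge,
  \<open>q\<close> an inner point of that edge and \<open>R\<close> a drawing without this
  edge.\<close>

lemma Jordan_same_side:
  fixes c :: "real \<Rightarrow> complex"
  assumes c: "simple_path c" "pathfinish c = pathstart c"
    and R: "closed R" "connected (path_image c \<inter> R)" "q \<notin> R"
  obtains eps where "eps > 0"
    "\<And>x y. \<lbrakk>x \<in> ball q eps; y \<in> ball q eps; x \<notin> path_image c; y \<notin> path_image c;
        x \<in> inside (path_image c) \<longleftrightarrow> y \<in> inside (path_image c)\<rbrakk>
      \<Longrightarrow> connected_component (- (path_image c \<union> R)) x y"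
proof -
  define C where "C = path_image c"
  note J = Jordan_inside_outside[OF c, folded C_def]
  have "open (- R)" using R(1) by (simp add: open_Compl)
  then obtain eps where eps: "eps > 0" "ball q eps \<subseteq> - R"
    using R(3) by (meson ComplI open_contains_ball)
  have "connected_component (- (C \<union> R)) x y"
    if xy: "x \<in> ball q eps" "y \<in> ball q eps" "x \<notin> C" "y \<notin> C" "x \<in> inside C \<longleftrightarrow> y \<in> inside C" for x y
  proof -
    define A where "A = (if x \<in> inside C then inside C else outside C)"
    have IO: "inside C \<union> outside C = - C" using J by blast
    have A: "connected A" "frontier A = C" using J unfolding A_def by auto
    have "x \<in> inside C \<or> x \<in> outside C" "y \<in> inside C \<or> y \<in> outside C"
      using IO xy(3,4) by blast+
    then have xyA: "x \<in> A" "y \<in> A" using xy(5) unfolding A_def by auto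
    note A = A xyA
    have AC: "A \<inter> C = {}" using J unfolding A_def by auto
    \<comment> \<open>\<open>R\<close> is cut down to the closed side of \<open>x\<close>. Its
      intersection with the curve stays the same, since the curve is the frontier of that side, and
      a connected set avoiding the curve cannot leave the side.\<close>
    define T where "T = R \<inter> closure A"
    have CT: "C \<inter> T = C \<inter> R" unfolding T_def using A(2) frontier_subset_closed[of "closure A"]
      by (auto simp: frontier_def)
    have "connected_component (- (C \<union> T)) x y"
    proof (rule Janiszewski)
      show "compact C" unfolding C_def using c(1) by (simp add: compact_simple_path_image)
      show "closed T" unfolding T_def using R(1) by (simp add: closed_Int)
      show "connected (C \<inter> T)" unfolding CT unfolding C_def by (rule R(2))
      show "connected_component (- C) x y"
        using A AC unfolding connected_component_def by blast
      show "connected_component (- T) x y"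
        unfolding connected_component_def T_def using xy(1,2) eps(2)
        by (intro exI[of _ "ball q eps"]) auto
    qed
    then obtain K where K: "connected K" "K \<subseteq> - (C \<union> T)" "x \<in> K" "y \<in> K"
      unfolding connected_component_def by blast
    have "K \<subseteq> A"
    proof (rule ccontr)
      assume "\<not> K \<subseteq> A"
      then have "K \<inter> frontier A \<noteq> {}" using connected_Int_frontier[OF K(1), of A] K(3) A(3) by blast
      then show False using A(2) K(2) by blast
    qed
    then have "K \<inter> R = {}" using K(2) closure_subset[of A] unfolding T_def by blast
    then have "K \<subseteq> - (C \<union> R)" using K(2) by blast
    then show ?thesis using K unfolding connected_component_def by blast
  qed
  then show ?thesis using that[OF eps(1)] unfolding C_def by blast
qed

lemma component_frontier_trap:
  assumes "connected K" "K \<inter> frontier F = {}" "x \<in> K" "x \<in> F"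
  shows "K \<subseteq> F"
  using assms connected_Int_frontier[of K F] by blast

text \<open>If the frontier of \<open>F\<close> left the arc at a last parameter \<open>u\<close>
  before \<open>t\<close>, it would be covered by the arc up to \<open>u\<close>, which separates
  nothing, and a closed set \<open>T\<close> away from \<open>g u\<close>. The two meet at most in
  \<open>g 0\<close>, so Janiszewski's theorem joins a point of \<open>F\<close> near
  \<open>g u\<close> to a later point of the arc without touching the frontier; but \<open>F\<close>
  contains no point of the arc.\<close>

lemma arc_in_frontier_aux:
  fixes g :: "real \<Rightarrow> complex"
  assumes g: "arc g" and R: "closed R" "path_image g \<inter> R \<subseteq> {pathstart g, pathfinish g}"
    and F: "F \<in> components (- (path_image g \<union> R))"
    and s: "0 < s" "s < t" "t < 1" "g s \<in> frontier F"
  shows "g t \<in> frontier F"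
proof (rule ccontr)
  assume nt: "g t \<notin> frontier F"
  have cont: "continuous_on {0..1} g" using g by (simp add: arc_def path_def)
  have inj: "inj_on g {0..1}" using g by (simp add: arc_def)
  have clM: "closed (path_image g \<union> R)" using g R(1) by (simp add: closed_Un closed_arc_image)
  have frF: "frontier F \<subseteq> path_image g \<union> R"
    using frontier_of_components_closed_complement[OF clM F] .
  have FM: "F \<inter> (path_image g \<union> R) = {}" using in_components_subset[OF F] by blast
  define Z where "Z = {r \<in> {s..t}. g r \<in> frontier F}"
  have "closed Z"
  proof -
    have "continuous_on {s..t} g" using cont s by (meson atLeastatMost_subset_iff continuous_on_subset less_imp_le)
    then have "closed ({s..t} \<inter> g -` frontier F)"
      by (intro continuous_closed_preimage) auto
    moreover have "Z = {s..t} \<inter> g -` frontier F" unfolding Z_def by auto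
    ultimately show ?thesis by simp
  qed
  have sZ: "s \<in> Z" using s unfolding Z_def by auto
  have bZ: "bdd_above Z" unfolding Z_def by (rule bdd_aboveI[of _ t]) auto
  define u where "u = Sup Z"
  have uZ: "u \<in> Z" unfolding u_def using closed_contains_Sup[OF _ bZ \<open>closed Z\<close>] sZ by blast
  then have u: "s \<le> u" "u \<le> t" "g u \<in> frontier F" unfolding Z_def by auto
  have "u \<noteq> t" using u(3) nt by auto
  then have ut: "u < t" using u by simp
  have above: "g r \<notin> frontier F" if "u < r" "r \<le> t" for r
  proof
    assume "g r \<in> frontier F"
    then have "r \<in> Z" using that u unfolding Z_def by auto
    then have "r \<le> u" unfolding u_def using bZ by (rule cSup_upper)
    then show False using that by simp
  qed
  define S where "S = g ` {0..u}"
  define T where "T = g ` {t..1} \<union> R"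
  have S_path: "S = path_image (subpath 0 u g)"
    using u s ut unfolding S_def by (simp add: path_image_subpath_gen closed_segment_eq_real_ivl)
  have arcS: "arc (subpath 0 u g)"
    by (rule arc_subpath_arc[OF g]) (use u s ut in auto)
  have compS: "compact S" unfolding S_path using arcS by (simp add: compact_arc_image)
  have "compact (g ` {t..1})"
    by (rule compact_continuous_image) (use cont s in \<open>auto intro: continuous_on_subset\<close>)
  then have clT: "closed T" unfolding T_def using R(1) by (simp add: closed_Un compact_imp_closed)
  have gR: "r = 0 \<or> r = 1" if "r \<in> {0..1}" "g r \<in> R" for r
  proof -
    have "g r \<in> {g 0, g 1}" using that R(2) unfolding path_image_def pathstart_def pathfinish_def by blast
    then show ?thesis using that inj unfolding inj_on_def by auto
  qed
  have ST: "S \<inter> T \<subseteq> {g 0}"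
  proof
    fix z assume z: "z \<in> S \<inter> T"
    then obtain r where r: "r \<in> {0..u}" "z = g r" unfolding S_def by auto
    then have r01: "r \<in> {0..1}" using ut s by auto
    have "z \<notin> g ` {t..1}"
    proof
      assume "z \<in> g ` {t..1}"
      then obtain r' where r': "r' \<in> {t..1}" "g r' = g r" using r by auto
      then have "r' = r" using inj r01 s unfolding inj_on_def by auto
      then show False using r r' ut by auto
    qed
    then have "g r \<in> R" using z r unfolding T_def by auto
    then have "r = 0" using gR[OF r01] r ut s by auto
    then show "z \<in> {g 0}" using r by simp
  qed
  have frST: "frontier F \<subseteq> S \<union> T"
  proof
    fix z assume z: "z \<in> frontier F"
    show "z \<in> S \<union> T"
    proof (cases "z \<in> R")
      case True then show ?thesis unfolding T_def by blast
    next
      case False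
      then obtain r where r: "r \<in> {0..1}" "z = g r" using z frF unfolding path_image_def by blast
      then have "\<not> (u < r \<and> r \<le> t)" using above z by blast
      then have "r \<le> u \<or> t \<le> r" by linarith
      then show ?thesis using r unfolding S_def T_def by auto
    qed
  qed
  have "g u \<notin> T"
  proof
    assume "g u \<in> T"
    then have "g u \<in> S \<inter> T" unfolding S_def using u s by auto
    then have "g u = g 0" using ST by auto
    then have "u = 0" using inj_onD[OF inj, of u 0] u s ut by auto
    then show False using u s by auto
  qed
  then obtain eps where eps: "eps > 0" "ball (g u) eps \<subseteq> - T"
    using clT by (meson ComplI open_Compl open_contains_ball)
  have "g u \<in> closure F" using u(3) by (simp add: frontier_def)
  then obtain x where x: "x \<in> F" "x \<in> ball (g u) eps"
    using eps(1) by (metis closure_approachable dist_commute mem_ball)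
  have "\<exists>d>0. \<forall>r\<in>{0..1}. dist r u < d \<longrightarrow> dist (g r) (g u) < eps"
    using cont eps(1) u s ut unfolding continuous_on_iff by auto
  then obtain d where d: "d > 0" "\<And>r. r \<in> {0..1} \<Longrightarrow> dist r u < d \<Longrightarrow> dist (g r) (g u) < eps" by blast
  define r where "r = min t (u + d/2)"
  have r: "u < r" "r \<le> t" "dist r u < d" using d(1) ut by (auto simp: r_def dist_real_def)
  have y: "g r \<in> ball (g u) eps" using d(2)[of r] r u s by (simp add: dist_commute)
  have yS: "g r \<notin> S"
  proof
    assume "g r \<in> S"
    then obtain r' where r': "r' \<in> {0..u}" "g r = g r'" unfolding S_def by auto
    then have "r = r'" using inj r u s unfolding inj_on_def by auto
    then show False using r r' by auto
  qed
  have "S \<subseteq> path_image g" unfolding S_def path_image_def using ut s by auto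
  then have xS: "x \<notin> S" using FM x(1) by blast
  have "connected_component (- (S \<union> T)) x (g r)"
  proof (rule Janiszewski[OF compS clT])
    show "connected (S \<inter> T)" using ST by (metis connected_empty connected_sing subset_singletonD)
    have "connected (- S)" unfolding S_path by (rule connected_arc_complement[OF arcS]) simp
    then show "connected_component (- S) x (g r)"
      using xS yS unfolding connected_component_def by blast
    show "connected_component (- T) x (g r)"
      unfolding connected_component_def using eps x y by (intro exI[of _ "ball (g u) eps"]) auto
  qed
  then obtain K where K: "connected K" "K \<subseteq> - (S \<union> T)" "x \<in> K" "g r \<in> K"
    unfolding connected_component_def by blast
  have "K \<subseteq> F" by (rule component_frontier_trap[OF K(1) _ K(3) x(1)]) (use K(2) frST in blast)
  then have "g r \<in> F" using K by blast
  moreover have "g r \<in> path_image g" unfolding path_image_def using r u s by auto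
  ultimately show False using FM by blast
qed

text \<open>Parameters below that of \<open>q\<close> are reached by reversing the arc, the two ends
  by closedness of the frontier.\<close>

lemma arc_in_frontier:
  fixes g :: "real \<Rightarrow> complex"
  assumes g: "arc g" and R: "closed R" "path_image g \<inter> R \<subseteq> {pathstart g, pathfinish g}"
    and F: "F \<in> components (- (path_image g \<union> R))"
    and q: "q \<in> path_image g - {pathstart g, pathfinish g}" "q \<in> frontier F"
  shows "path_image g \<subseteq> frontier F"
proof -
  obtain s where s: "s \<in> {0..1}" "q = g s" using q unfolding path_image_def by auto
  then have s01: "0 < s" "s < 1" using q unfolding pathstart_def pathfinish_def
    by (auto simp: less_le)
  have mid: "g t \<in> frontier F" if t: "0 < t" "t < 1" for t
  proof -
    consider "t = s" | "s < t" | "t < s" by linarith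
    then show ?thesis
    proof cases
      case 1 then show ?thesis using s q by simp
    next
      case 2 then show ?thesis using arc_in_frontier_aux[OF g R F s01(1) 2 t(2)] s q by simp
    next
      case 3
      have "reversepath g (1 - s) \<in> frontier F" using s q by (simp add: reversepath_def)
      moreover have "path_image (reversepath g) \<inter> R \<subseteq> {pathstart (reversepath g), pathfinish (reversepath g)}"
        using R(2) by auto
      moreover have "F \<in> components (- (path_image (reversepath g) \<union> R))"
        unfolding path_image_reversepath by (rule F)
      ultimately have "reversepath g (1 - t) \<in> frontier F"
        using arc_in_frontier_aux[OF arc_reversepath[OF g] R(1), of F "1 - s" "1 - t"] 3 t s01 by linarith
      then show ?thesis by (simp add: reversepath_def)
    qed
  qed
  have cont: "continuous_on {0..1} g" using g by (simp add: arc_def path_def)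
  have "g ` {0<..<1} \<subseteq> frontier F" using mid by auto
  then have "closure (g ` {0<..<1}) \<subseteq> frontier F" by (simp add: closure_minimal)
  moreover have "g ` closure {0<..<1} \<subseteq> closure (g ` {0<..<1})"
    by (rule image_closure_subset) (use cont in \<open>auto intro: subsetD[OF closure_subset]\<close>)
  ultimately show ?thesis unfolding path_image_def by auto
qed

section \<open>Plane graphs\<close>

fun path_edges :: "'a list \<Rightarrow> 'a set set" where
  "path_edges (x # y # zs) = insert {x, y} (path_edges (y # zs))"
| "path_edges _ = {}"

lemma path_edges_subset: "e \<in> path_edges xs \<Longrightarrow> e \<subseteq> set xs"
  by (induction xs rule: path_edges.induct) auto

text \<open>On two vertices the closing edge would be the only edge of the path, whence the bound
  three.\<close>

lemma closing_edge_notin_path_edges: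
  assumes "distinct xs" "length xs \<ge> 3"
  shows "{last xs, hd xs} \<notin> path_edges xs"
proof -
  obtain x y zs where xs: "xs = x # y # zs" "zs \<noteq> []"
    using assms(2) by (cases xs; cases "tl xs"; cases "tl (tl xs)") auto
  have l: "last xs \<in> set zs" using xs by simp
  have "x \<notin> set (y # zs)" using assms xs by auto
  then have "{last xs, x} \<notin> path_edges (y # zs)" using path_edges_subset[of _ "y # zs"] by blast
  moreover have "{last xs, x} \<noteq> {x, y}" using l assms xs by (auto simp: doubleton_eq_iff)
  ultimately show ?thesis using xs by simp
qed

locale plane_graph =
  fixes V :: "'a set" and E :: "'a set set" and p :: "'a \<Rightarrow> complex"
    and \<gamma> :: "'a set \<Rightarrow> real \<Rightarrow> complex"
  assumes graph: "simple_graph V E" and embedded: "plane_embedding V E p \<gamma>"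
begin

definition open_edge :: "'a set \<Rightarrow> complex set" where
  "open_edge e = path_image (\<gamma> e) - p ` e"

definition drawing :: "'a set \<Rightarrow> 'a set set \<Rightarrow> complex set" where
  "drawing U H = p ` U \<union> (\<Union>e\<in>H. path_image (\<gamma> e))"

definition subgraph :: "'a set \<Rightarrow> 'a set set \<Rightarrow> bool" where
  "subgraph U H \<longleftrightarrow> U \<subseteq> V \<and> H \<subseteq> E \<and> (\<forall>e\<in>H. e \<subseteq> U)"

lemma finite_V: "finite V" and edge_subset: "e \<in> E \<Longrightarrow> e \<subseteq> V" and edge_card: "e \<in> E \<Longrightarrow> card e = 2"
  using graph by (auto simp: simple_graph_def)

lemma finite_E: "finite E"
  using finite_V edge_subset by (meson PowI finite_Pow_iff finite_subset subsetI)

lemma inj_p: "inj_on p V"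
  and edge_arc: "e \<in> E \<Longrightarrow> arc (\<gamma> e)"
  and edge_ends: "e \<in> E \<Longrightarrow> {pathstart (\<gamma> e), pathfinish (\<gamma> e)} = p ` e"
  and open_edge_disjoint: "e \<in> E \<Longrightarrow> open_edge e \<inter> (p ` V \<union> (\<Union>f\<in>E - {e}. path_image (\<gamma> f))) = {}"
  using embedded by (auto simp: plane_embedding_def open_edge_def)

lemma edge_image: assumes "e \<in> E" shows "path_image (\<gamma> e) = p ` e \<union> open_edge e"
proof -
  have "p ` e \<subseteq> path_image (\<gamma> e)" unfolding edge_ends[OF assms, symmetric] by auto
  then show ?thesis unfolding open_edge_def by blast
qed

lemma no_loop: "{x, x} \<notin> E"
  using edge_card[of "{x, x}"] by auto

lemma open_edge_nonempty:
  assumes "e \<in> E" shows "open_edge e \<noteq> {}"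
proof -
  have inj: "inj_on (\<gamma> e) {0..1}" using edge_arc[OF assms] by (simp add: arc_def)
  have "\<gamma> e (1/2) \<noteq> \<gamma> e 0" "\<gamma> e (1/2) \<noteq> \<gamma> e 1"
    using inj_onD[OF inj, of "1/2" 0] inj_onD[OF inj, of "1/2" 1] by auto
  then have "\<gamma> e (1/2) \<notin> p ` e"
    using edge_ends[OF assms] unfolding pathstart_def pathfinish_def by auto
  moreover have "\<gamma> e (1/2) \<in> path_image (\<gamma> e)" unfolding path_image_def by auto
  ultimately show ?thesis unfolding open_edge_def by blast
qed

lemma subgraph_whole: "subgraph V E"
  and subgraph_delete: "subgraph V (E - H)"
  using edge_subset by (auto simp: subgraph_def)

lemma subgraph_edge: "e \<in> E \<Longrightarrow> subgraph e {e}"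
  using edge_subset by (auto simp: subgraph_def)

lemma compact_drawing: assumes "subgraph U H" shows "compact (drawing U H)"
proof -
  have "finite U" "finite H" using assms finite_V finite_E finite_subset unfolding subgraph_def by blast+
  moreover have "compact (path_image (\<gamma> e))" if "e \<in> H" for e
    using that assms edge_arc compact_arc_image unfolding subgraph_def by blast
  ultimately show ?thesis unfolding drawing_def
    by (intro compact_Un compact_UN) (auto intro: finite_imp_compact)
qed

lemma closed_drawing: "subgraph U H \<Longrightarrow> closed (drawing U H)"
  using compact_drawing compact_imp_closed by blast

lemma drawing_edge: "e \<in> E \<Longrightarrow> drawing e {e} = path_image (\<gamma> e)"
  using edge_image by (auto simp: drawing_def)

lemma drawing_mono: "U \<subseteq> U' \<Longrightarrow> H \<subseteq> H' \<Longrightarrow> drawing U H \<subseteq> drawing U' H'"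
  by (auto simp: drawing_def)

lemma drawing_alt:
  assumes "subgraph U H" shows "drawing U H = p ` U \<union> (\<Union>e\<in>H. open_edge e)"
proof -
  have "path_image (\<gamma> e) = p ` e \<union> open_edge e" "e \<subseteq> U" if "e \<in> H" for e
    using that assms edge_image unfolding subgraph_def by auto
  then show ?thesis unfolding drawing_def by blast
qed

lemma open_edge_vertex: "e \<in> E \<Longrightarrow> w \<in> V \<Longrightarrow> p w \<notin> open_edge e"
  using open_edge_disjoint by blast

lemma open_edges_disjoint: 
  assumes "e \<in> E" "f \<in> E" "e \<noteq> f" shows "open_edge e \<inter> open_edge f = {}"
proof -
  have "open_edge f \<subseteq> path_image (\<gamma> f)" by (auto simp: open_edge_def)
  then show ?thesis using open_edge_disjoint[OF assms(1)] assms by blast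
qed

text \<open>This turns the question how two pieces of the drawing meet, which decides whether arcs
  can be joined and whether Janiszewski's theorem applies, into a computation with vertex and edge
  sets.\<close>

lemma drawing_Int:
  assumes s: "subgraph U H" "subgraph U' H'"
  shows "drawing U H \<inter> drawing U' H' = drawing (U \<inter> U') (H \<inter> H')"
proof -
  have sI: "subgraph (U \<inter> U') (H \<inter> H')" using s unfolding subgraph_def by auto
  have H: "H \<subseteq> E" "H' \<subseteq> E" "U \<subseteq> V" "U' \<subseteq> V" using s unfolding subgraph_def by auto
  have "p ` U \<inter> p ` U' = p ` (U \<inter> U')"
    using inj_on_image_Int[OF inj_p H(3,4)] by simp
  moreover have "p ` U \<inter> (\<Union>e\<in>H'. open_edge e) = {}" "p ` U' \<inter> (\<Union>e\<in>H. open_edge e) = {}"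
    using open_edge_vertex[OF subsetD[OF H(2)] subsetD[OF H(3)]]
      open_edge_vertex[OF subsetD[OF H(1)] subsetD[OF H(4)]] by auto
  moreover have "(\<Union>e\<in>H. open_edge e) \<inter> (\<Union>e\<in>H'. open_edge e) = (\<Union>e\<in>H \<inter> H'. open_edge e)"
  proof
    show "(\<Union>e\<in>H. open_edge e) \<inter> (\<Union>e\<in>H'. open_edge e) \<subseteq> (\<Union>e\<in>H \<inter> H'. open_edge e)"
    proof
      fix z assume "z \<in> (\<Union>e\<in>H. open_edge e) \<inter> (\<Union>e\<in>H'. open_edge e)"
      then obtain e f where ef: "e \<in> H" "f \<in> H'" "z \<in> open_edge e" "z \<in> open_edge f" by blast
      then have "e = f" using open_edges_disjoint[of e f] H by blast
      then show "z \<in> (\<Union>e\<in>H \<inter> H'. open_edge e)" using ef by blast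
    qed
  qed blast
  moreover have "P \<inter> P' = Q \<Longrightarrow> P \<inter> A' = {} \<Longrightarrow> P' \<inter> A = {} \<Longrightarrow> A \<inter> A' = B
    \<Longrightarrow> (P \<union> A) \<inter> (P' \<union> A') = Q \<union> B" for P P' Q A A' B :: "complex set" by blast
  ultimately show ?thesis unfolding drawing_alt[OF s(1)] drawing_alt[OF s(2)] drawing_alt[OF sI]
    by simp
qed

lemma drawing_disjoint:
  assumes s: "subgraph U H" "subgraph U' H'" and d: "U \<inter> U' = {}"
  shows "drawing U H \<inter> drawing U' H' = {}"
proof -
  have "f \<notin> H \<inter> H'" for f
  proof
    assume f: "f \<in> H \<inter> H'"
    then have "f \<subseteq> U" "f \<subseteq> U'" using s unfolding subgraph_def by auto
    then have "f = {}" using d by blast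
    then show False using f edge_card[of f] s(1) unfolding subgraph_def by auto
  qed
  then have "H \<inter> H' = {}" by blast
  then show ?thesis unfolding drawing_Int[OF s] d by (simp add: drawing_def)
qed

lemma open_edge_drawing:
  assumes "subgraph U H" "e \<in> E" "e \<notin> H" shows "open_edge e \<inter> drawing U H = {}"
proof -
  have "U \<subseteq> V" "H \<subseteq> E" using assms by (auto simp: subgraph_def)
  then show ?thesis
    using open_edge_vertex[OF assms(2)] open_edges_disjoint[OF assms(2)] assms(3)
    unfolding drawing_alt[OF assms(1)] by fastforce
qed

lemma vertex_drawing:
  assumes "subgraph U H" "w \<in> V" "p w \<in> drawing U H" shows "w \<in> U"
proof -
  have "U \<subseteq> V" "H \<subseteq> E" using assms by (auto simp: subgraph_def)
  then have "p w \<in> p ` U" using assms(3) open_edge_vertex[OF _ assms(2)] unfolding drawing_alt[OF assms(1)] by auto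
  then show ?thesis using inj_on_image_mem_iff[OF inj_p assms(2) \<open>U \<subseteq> V\<close>] by simp
qed

lemma open_edge_subset_drawing: "e \<in> H \<Longrightarrow> open_edge e \<subseteq> drawing U H"
  unfolding drawing_def open_edge_def by blast

lemma drawing_split: "e \<in> E \<Longrightarrow> drawing V E = path_image (\<gamma> e) \<union> drawing V (E - {e})"
  by (auto simp: drawing_def)

lemma faces_eq: "faces V E p \<gamma> = components (- drawing V E)"
  by (simp add: faces_def drawing_def)

section \<open>Paths and cycles drawn as arcs and Jordan curves\<close>

definition gpath :: "'a list \<Rightarrow> bool" where
  "gpath xs \<longleftrightarrow> distinct xs \<and> set xs \<subseteq> V \<and> path_edges xs \<subseteq> E"

lemma gpath_subgraph: "gpath xs \<Longrightarrow> subgraph (set xs) (path_edges xs)"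
  using path_edges_subset unfolding gpath_def subgraph_def by blast

lemma edge_arc_between:
  assumes "{x, y} \<in> E"
  obtains g where "arc g" "pathstart g = p x" "pathfinish g = p y" "path_image g = path_image (\<gamma> {x, y})"
proof -
  have xy: "x \<noteq> y" using no_loop assms by auto
  then have "p x \<noteq> p y" using inj_p edge_subset[OF assms] unfolding inj_on_def by blast
  moreover have "{pathstart (\<gamma> {x, y}), pathfinish (\<gamma> {x, y})} = {p x, p y}"
    using edge_ends[OF assms] by simp
  ultimately have "(pathstart (\<gamma> {x, y}) = p x \<and> pathfinish (\<gamma> {x, y}) = p y) \<or>
    (pathstart (\<gamma> {x, y}) = p y \<and> pathfinish (\<gamma> {x, y}) = p x)" by (auto simp: doubleton_eq_iff)
  then show ?thesis
    using that[of "\<gamma> {x, y}"] that[of "reversepath (\<gamma> {x, y})"] edge_arc[OF assms]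
    by (auto simp: arc_reversepath)
qed

text \<open>A single vertex draws a point and not an arc, whence the bound on the length.
  Consecutive pieces meet only in their common vertex by \<open>drawing_Int\<close>.\<close>

lemma gpath_arc:
  "gpath xs \<Longrightarrow> length xs \<ge> 2 \<Longrightarrow>
    \<exists>g. arc g \<and> pathstart g = p (hd xs) \<and> pathfinish g = p (last xs)
      \<and> path_image g = drawing (set xs) (path_edges xs)"
proof (induction xs rule: path_edges.induct)
  case (1 x y zs)
  have xy: "{x, y} \<in> E" and gp: "gpath (y # zs)" and x: "x \<notin> set (y # zs)"
    using 1(2) unfolding gpath_def by auto
  obtain g where g: "arc g" "pathstart g = p x" "pathfinish g = p y" "path_image g = path_image (\<gamma> {x, y})"
    using edge_arc_between[OF xy] .
  have dxy: "drawing {x, y} {{x, y}} = path_image (\<gamma> {x, y})" using drawing_edge[OF xy] .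
  show ?case
  proof (cases zs)
    case Nil
    then show ?thesis using g dxy by (intro exI[of _ g]) auto
  next
    case (Cons a list)
    then obtain h where h: "arc h" "pathstart h = p y" "pathfinish h = p (last (y # zs))"
      "path_image h = drawing (set (y # zs)) (path_edges (y # zs))"
      using 1(1)[OF gp] by auto
    have "path_image g \<inter> path_image h = drawing ({x, y} \<inter> set (y # zs)) ({{x, y}} \<inter> path_edges (y # zs))"
      unfolding g(4) h(4) dxy[symmetric]
      by (rule drawing_Int) (use subgraph_edge[OF xy] gpath_subgraph[OF gp] in auto)
    moreover have "{x, y} \<inter> set (y # zs) = {y}" using x by auto
    moreover have "{{x, y}} \<inter> path_edges (y # zs) = {}" using x path_edges_subset[of _ "y # zs"] by blast
    ultimately have "path_image g \<inter> path_image h = {p y}" by (simp only:) (simp add: drawing_def)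
    then have "arc (g +++ h)" using g h by (intro arc_join) auto
    moreover have "path_image (g +++ h) = drawing (set (x # y # zs)) (path_edges (x # y # zs))"
      using g h dxy by (subst path_image_join) (auto simp: drawing_def)
    ultimately show ?thesis using g h by (intro exI[of _ "g +++ h"]) auto
  qed
qed auto

lemma connected_gpath:
  assumes "gpath xs" "xs \<noteq> []" shows "connected (drawing (set xs) (path_edges xs))"
proof (cases "length xs \<ge> 2")
  case True
  then show ?thesis using gpath_arc[OF assms(1)] by (metis connected_arc_image)
next
  case False
  then obtain x where "xs = [x]" using assms(2) by (cases xs; cases "tl xs") auto
  then show ?thesis by (simp add: drawing_def)
qed

text \<open>The edge from the last vertex to the first is singled out: it is the edge at which two
  faces are compared, and cycles are listed so as to make this edge the closing one.\<close>

definition gcycle :: "'a list \<Rightarrow> bool" where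
  "gcycle xs \<longleftrightarrow> gpath xs \<and> length xs \<ge> 3 \<and> {last xs, hd xs} \<in> E"

abbreviation closing :: "'a list \<Rightarrow> 'a set" where "closing xs \<equiv> {last xs, hd xs}"

definition cycle_image :: "'a list \<Rightarrow> complex set" where
  "cycle_image xs = drawing (set xs) (insert (closing xs) (path_edges xs))"

lemma gcycle_subgraph: "gcycle xs \<Longrightarrow> subgraph (set xs) (insert (closing xs) (path_edges xs))"
  using gpath_subgraph[of xs] hd_in_set[of xs] last_in_set[of xs]
  unfolding gcycle_def subgraph_def by fastforce

lemma cycle_image_eq:
  assumes "gcycle xs"
  shows "cycle_image xs = path_image (\<gamma> (closing xs)) \<union> drawing (set xs) (path_edges xs)"
  unfolding cycle_image_def drawing_def by auto

lemma gcycle_simple_path: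
  assumes "gcycle xs"
  obtains c where "simple_path c" "pathfinish c = pathstart c" "path_image c = cycle_image xs"
proof -
  have gp: "gpath xs" and len: "length xs \<ge> 3" and e: "closing xs \<in> E"
    using assms unfolding gcycle_def by auto
  obtain g where g: "arc g" "pathstart g = p (hd xs)" "pathfinish g = p (last xs)"
      "path_image g = drawing (set xs) (path_edges xs)"
    using gpath_arc[OF gp] len by auto
  obtain h where h: "arc h" "pathstart h = p (last xs)" "pathfinish h = p (hd xs)"
      "path_image h = path_image (\<gamma> (closing xs))"
    using edge_arc_between[OF e] .
  have "path_image g \<inter> path_image h = drawing (set xs \<inter> closing xs) (path_edges xs \<inter> {closing xs})"
    unfolding g(4) h(4) drawing_edge[OF e, symmetric]
    by (rule drawing_Int) (use subgraph_edge[OF e] gpath_subgraph[OF gp] in auto)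
  moreover have "path_edges xs \<inter> {closing xs} = {}"
    using closing_edge_notin_path_edges len gp unfolding gpath_def by blast
  ultimately have "path_image g \<inter> path_image h \<subseteq> {p (last xs), p (hd xs)}" by (auto simp: drawing_def)
  then have "simple_path (g +++ h)" using g h by (intro simple_path_join_loop) auto
  moreover have "path_image (g +++ h) = cycle_image xs"
    unfolding cycle_image_eq[OF assms] using g h by (subst path_image_join) auto
  ultimately show ?thesis using g h by (intro that[of "g +++ h"]) auto
qed

lemma gcycle_Jordan:
  assumes "gcycle xs"
  shows "open (inside (cycle_image xs))" "connected (inside (cycle_image xs))"
    "open (outside (cycle_image xs))" "connected (outside (cycle_image xs))"
    "inside (cycle_image xs) \<inter> outside (cycle_image xs) = {}"
    "inside (cycle_image xs) \<union> outside (cycle_image xs) = - cycle_image xs"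
    "frontier (inside (cycle_image xs)) = cycle_image xs"
    "frontier (outside (cycle_image xs)) = cycle_image xs"
proof -
  obtain c where c: "simple_path c" "pathfinish c = pathstart c" "path_image c = cycle_image xs"
    using gcycle_simple_path[OF assms] .
  note J = Jordan_inside_outside[OF c(1,2), unfolded c(3)]
  show "open (inside (cycle_image xs))" "connected (inside (cycle_image xs))"
    "open (outside (cycle_image xs))" "connected (outside (cycle_image xs))"
    "inside (cycle_image xs) \<inter> outside (cycle_image xs) = {}"
    "inside (cycle_image xs) \<union> outside (cycle_image xs) = - cycle_image xs"
    "frontier (inside (cycle_image xs)) = cycle_image xs"
    "frontier (outside (cycle_image xs)) = cycle_image xs"
    using J by blast+
qed

lemma connected_one_side:
  assumes "gcycle xs" "connected K" "K \<inter> cycle_image xs = {}"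
  shows "K \<subseteq> inside (cycle_image xs) \<or> K \<subseteq> outside (cycle_image xs)"
proof -
  note J = gcycle_Jordan[OF assms(1)]
  show ?thesis
  proof (rule ccontr)
    assume "\<not> ?thesis"
    then obtain x y where "x \<in> K" "x \<in> inside (cycle_image xs)" "y \<in> K" "y \<notin> inside (cycle_image xs)"
      using assms(3) J(6) by blast
    then have "K \<inter> frontier (inside (cycle_image xs)) \<noteq> {}"
      using connected_Int_frontier[OF assms(2)] by blast
    then show False using J(7) assms(3) by simp
  qed
qed

text \<open>The two sides are kept interchangeable, as no argument depends on which of them is
  bounded.\<close>

definition sides :: "'a list \<Rightarrow> complex set \<Rightarrow> complex set \<Rightarrow> bool" where
  "sides xs A B \<longleftrightarrow> (A = inside (cycle_image xs) \<and> B = outside (cycle_image xs)) \<or>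
    (A = outside (cycle_image xs) \<and> B = inside (cycle_image xs))"

lemma sides_facts:
  assumes "gcycle xs" "sides xs A B"
  shows "open A" "connected A" "A \<inter> B = {}" "A \<union> B = - cycle_image xs"
    "frontier A = cycle_image xs" "closure A = A \<union> cycle_image xs"
proof -
  note J = gcycle_Jordan[OF assms(1)]
  show "open A" "connected A" "frontier A = cycle_image xs"
    using assms(2) J(1-4,7,8) unfolding sides_def by auto
  then show "closure A = A \<union> cycle_image xs" using closure_Un_frontier[of A] by simp
  show "A \<inter> B = {}" using assms(2) J(5) unfolding sides_def by blast
  show "A \<union> B = - cycle_image xs" using assms(2) J(6) unfolding sides_def by blast
qed

lemma sides_inside:
  assumes "gcycle xs" "sides xs A B" "x \<in> A" "y \<in> A"
  shows "x \<in> inside (cycle_image xs) \<longleftrightarrow> y \<in> inside (cycle_image xs)"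
  using assms gcycle_Jordan(5)[OF assms(1)] unfolding sides_def by blast

text \<open>The cycle meets the remaining drawing in the path left when the closing edge is removed,
  a connected set, so \<open>Jordan_same_side\<close> applies. The subgraph is arbitrary because the
  lemma serves both the whole graph and a theta graph inside it.\<close>

lemma gcycle_same_side:
  assumes c: "gcycle xs" and s: "subgraph U H" "closing xs \<notin> H" "set xs \<subseteq> U" "path_edges xs \<subseteq> H"
    and q: "q \<in> open_edge (closing xs)"
  obtains eps where "eps > 0"
    "\<And>A B x y. \<lbrakk>sides xs A B; x \<in> ball q eps; y \<in> ball q eps; x \<in> A; y \<in> A\<rbrakk>
      \<Longrightarrow> connected_component (- drawing U (insert (closing xs) H)) x y"
proof -
  obtain c where cc: "simple_path c" "pathfinish c = pathstart c" "path_image c = cycle_image xs"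
    using gcycle_simple_path[OF c] .
  have e: "closing xs \<in> E" and gp: "gpath xs" and ne: "xs \<noteq> []" using c unfolding gcycle_def by auto
  have "cycle_image xs \<inter> drawing U H = drawing (set xs \<inter> U) (insert (closing xs) (path_edges xs) \<inter> H)"
    unfolding cycle_image_def by (rule drawing_Int[OF gcycle_subgraph[OF c] s(1)])
  moreover have "set xs \<inter> U = set xs" "insert (closing xs) (path_edges xs) \<inter> H = path_edges xs"
    using s by auto
  ultimately have con: "connected (path_image c \<inter> drawing U H)"
    using connected_gpath[OF gp ne] cc by simp
  have qn: "q \<notin> drawing U H" using open_edge_drawing[OF s(1) e s(2)] q by blast
  have un: "path_image c \<union> drawing U H = drawing U (insert (closing xs) H)"
    unfolding cc(3) cycle_image_def using s by (auto simp: drawing_def)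
  obtain eps where eps0: "eps > 0"
    "\<And>x y. \<lbrakk>x \<in> ball q eps; y \<in> ball q eps; x \<notin> path_image c; y \<notin> path_image c;
        x \<in> inside (path_image c) \<longleftrightarrow> y \<in> inside (path_image c)\<rbrakk>
      \<Longrightarrow> connected_component (- (path_image c \<union> drawing U H)) x y"
    by (rule Jordan_same_side[OF cc(1,2) closed_drawing[OF s(1)] con qn]) (rule that)
  note eps = eps0(1) eps0(2)[unfolded un, unfolded cc(3)]
  show ?thesis
  proof (rule that[OF eps(1)])
    fix A B x y assume *: "sides xs A B" "x \<in> ball q eps" "y \<in> ball q eps" "x \<in> A" "y \<in> A"
    have "x \<notin> cycle_image xs" "y \<notin> cycle_image xs" using sides_facts(4)[OF c *(1)] *(4,5) by blast+
    then show "connected_component (- drawing U (insert (closing xs) H)) x y"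
      by (rule eps(2)[OF *(2,3) _ _ sides_inside[OF c *(1,4,5)]])
  qed
qed

end

section \<open>Faces at an edge\<close>

text \<open>The relation is confined to \<open>S\<close>, but its reflexive transitive closure still
  relates every vertex to itself, also outside \<open>S\<close>.\<close>

definition adj :: "'a set \<Rightarrow> 'a set set \<Rightarrow> ('a \<times> 'a) set" where
  "adj S H = {(a, b). a \<in> S \<and> b \<in> S \<and> {a, b} \<in> H}"

lemma path_edges_append:
  "xs \<noteq> [] \<Longrightarrow> ys \<noteq> [] \<Longrightarrow>
    path_edges (xs @ ys) = path_edges xs \<union> path_edges ys \<union> {{last xs, hd ys}}"
proof (induction xs rule: path_edges.induct)
  case (1 x y zs)
  then show ?case by auto
next
  case ("2_2" x)
  then show ?case by (cases ys) auto
qed auto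

lemma path_edges_split: "path_edges (ps @ a # qs) = path_edges (ps @ [a]) \<union> path_edges (a # qs)"
proof (cases "ps = []")
  case False
  then show ?thesis
    using path_edges_append[OF False, of "a # qs"] path_edges_append[OF False, of "[a]"] by auto
qed simp

lemma path_edges_rev: "path_edges (rev xs) = path_edges xs"
proof (induction xs rule: path_edges.induct)
  case (1 x y zs)
  have "path_edges (rev (x # y # zs)) = path_edges (rev (y # zs) @ [x])" by simp
  also have "\<dots> = path_edges (rev (y # zs)) \<union> {{y, x}}"
    by (subst path_edges_append) (auto simp: last_rev simp del: rev.simps)
  finally show ?case using 1 by (auto simp: insert_commute)
qed auto

context plane_graph
begin

definition borders :: "complex set \<Rightarrow> 'a set \<Rightarrow> bool" where
  "borders F e \<longleftrightarrow> F \<in> faces V E p \<gamma> \<and> e \<in> E \<and> path_image (\<gamma> e) \<subseteq> frontier F"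

lemma face_facts:
  assumes "F \<in> faces V E p \<gamma>"
  shows "connected F" "open F" "F \<inter> drawing V E = {}" "frontier F \<subseteq> drawing V E" "F \<noteq> {}"
proof -
  have F: "F \<in> components (- drawing V E)" using assms by (simp add: faces_eq)
  have cl: "closed (drawing V E)" by (rule closed_drawing[OF subgraph_whole])
  show "connected F" using F in_components_connected by blast
  show "open F" using F cl open_components by (metis open_Compl)
  show "F \<inter> drawing V E = {}" using in_components_subset[OF F] by blast
  show "frontier F \<subseteq> drawing V E" by (rule frontier_of_components_closed_complement[OF cl F])
  show "F \<noteq> {}" using F in_components_nonempty by blast
qed

lemma face_absorb:
  assumes "F \<in> faces V E p \<gamma>" "x \<in> F" "connected_component (- drawing V E) x y"
  shows "y \<in> F"
proof -
  obtain K where K: "connected K" "K \<subseteq> - drawing V E" "x \<in> K" "y \<in> K"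
    using assms(3) unfolding connected_component_def by blast
  then have "K \<subseteq> F" using assms components_maximal[of F "- drawing V E" K] unfolding faces_eq by blast
  then show ?thesis using K by blast
qed

lemma faces_disjoint:
  assumes "F1 \<in> faces V E p \<gamma>" "F2 \<in> faces V E p \<gamma>" "x \<in> F1" "x \<in> F2"
  shows "F1 = F2"
  using components_nonoverlap[of F1 "- drawing V E" F2] assms unfolding faces_eq by blast

lemma near_frontier:
  fixes q :: complex
  assumes "q \<in> frontier F" "eps > 0" obtains x where "x \<in> F" "x \<in> ball q eps"
proof -
  have "q \<in> closure F" using assms by (simp add: frontier_def)
  then obtain x where "x \<in> F" "dist x q < eps" using assms(2) unfolding closure_approachable by blast
  then show ?thesis using that[of x] by (simp add: dist_commute)
qed

text \<open>One inner point of the edge is enough: the rest of the drawing meets the edge only in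
  its ends, so \<open>arc_in_frontier\<close> spreads the point over the whole edge.\<close>

lemma bordersI:
  assumes F: "F \<in> faces V E p \<gamma>" and e: "e \<in> E" and q: "q \<in> open_edge e" "q \<in> frontier F"
  shows "borders F e"
proof -
  have ends: "{pathstart (\<gamma> e), pathfinish (\<gamma> e)} = p ` e" by (rule edge_ends[OF e])
  have "path_image (\<gamma> e) \<inter> drawing V (E - {e}) = drawing (e \<inter> V) ({e} \<inter> (E - {e}))"
    unfolding drawing_edge[OF e, symmetric] by (rule drawing_Int[OF subgraph_edge[OF e] subgraph_delete])
  then have I: "path_image (\<gamma> e) \<inter> drawing V (E - {e}) \<subseteq> {pathstart (\<gamma> e), pathfinish (\<gamma> e)}"
    unfolding ends by (auto simp: drawing_def)
  have F': "F \<in> components (- (path_image (\<gamma> e) \<union> drawing V (E - {e})))"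
    using F unfolding faces_eq drawing_split[OF e] .
  have "path_image (\<gamma> e) \<subseteq> frontier F"
    by (rule arc_in_frontier[OF edge_arc[OF e] closed_drawing[OF subgraph_delete] I F' _ q(2)])
       (use q(1) in \<open>simp only: ends open_edge_def\<close>)
  then show ?thesis using F e unfolding borders_def by simp
qed

lemma borders_open_edge: "borders F e \<Longrightarrow> open_edge e \<subseteq> frontier F"
  unfolding borders_def open_edge_def by blast

lemma sides_sym: "sides xs A B \<Longrightarrow> sides xs B A"
  unfolding sides_def by blast

lemma sides_obtain:
  assumes "gcycle xs" "connected K" "K \<inter> cycle_image xs = {}"
  obtains A B where "sides xs A B" "K \<subseteq> A"
  using connected_one_side[OF assms] unfolding sides_def by blast

lemma side_trap:
  assumes "gcycle xs" "sides xs A B" "connected K" "K \<inter> cycle_image xs = {}" "x \<in> K" "x \<in> A"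
  shows "K \<subseteq> A"
  using component_frontier_trap[OF assms(3) _ assms(5,6)] sides_facts(5)[OF assms(1,2)] assms(4) by blast

lemma cycle_image_subset: "gcycle xs \<Longrightarrow> cycle_image xs \<subseteq> drawing V E"
  using gcycle_subgraph[of xs] unfolding cycle_image_def subgraph_def by (intro drawing_mono) auto

lemma gcycle_same_side_whole:
  assumes c: "gcycle xs" and q: "q \<in> open_edge (closing xs)"
  obtains eps where "eps > 0"
    "\<And>A B x y. \<lbrakk>sides xs A B; x \<in> ball q eps; y \<in> ball q eps; x \<in> A; y \<in> A\<rbrakk>
      \<Longrightarrow> connected_component (- drawing V E) x y"
proof -
  have e: "closing xs \<in> E" "gpath xs" using c unfolding gcycle_def by auto
  have ins: "insert (closing xs) (E - {closing xs}) = E" using e by auto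
  have pe: "path_edges xs \<subseteq> E - {closing xs}"
    using closing_edge_notin_path_edges[of xs] c unfolding gcycle_def gpath_def by auto
  have sV: "set xs \<subseteq> V" using e unfolding gpath_def by simp
  have ni: "closing xs \<notin> E - {closing xs}" by simp
  show ?thesis
    by (rule gcycle_same_side[OF c subgraph_delete ni sV pe q, unfolded ins]) (rule that)
qed

text \<open>All points of \<open>A\<close> near an inner point of the closing edge lie in a single
  component of the complement of the drawing, and this face therefore reaches that point.\<close>

lemma side_has_bordering_face:
  assumes c: "gcycle xs" and s: "sides xs A B"
  obtains F where "borders F (closing xs)" "F \<subseteq> A"
proof -
  have e: "closing xs \<in> E" using c unfolding gcycle_def by auto
  obtain q where q: "q \<in> open_edge (closing xs)" using open_edge_nonempty[OF e] by blast
  obtain eps where eps: "eps > 0"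
    "\<And>A B x y. \<lbrakk>sides xs A B; x \<in> ball q eps; y \<in> ball q eps; x \<in> A; y \<in> A\<rbrakk>
      \<Longrightarrow> connected_component (- drawing V E) x y"
    by (rule gcycle_same_side_whole[OF c q]) (rule that)
  have qC: "q \<in> cycle_image xs" using q unfolding cycle_image_eq[OF c] open_edge_def by blast
  then have qA: "q \<in> frontier A" using sides_facts(5)[OF c s] by simp
  obtain x where x: "x \<in> A" "x \<in> ball q eps" using near_frontier[OF qA eps(1)] .
  define F where "F = connected_component_set (- drawing V E) x"
  have "connected_component (- drawing V E) x x" by (rule eps(2)[OF s x(2) x(2) x(1) x(1)])
  then have xn: "x \<in> - drawing V E" using connected_component_in by metis
  then have F: "F \<in> faces V E p \<gamma>" unfolding faces_eq F_def components_def by blast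
  note ff = face_facts[OF F]
  have xF: "x \<in> F" unfolding F_def using xn by (simp add: connected_component_refl)
  have "F \<inter> cycle_image xs = {}" using ff(3) cycle_image_subset[OF c] by blast
  then have FA: "F \<subseteq> A" using side_trap[OF c s ff(1) _ xF x(1)] by blast
  have "q \<in> closure F" unfolding closure_approachable
  proof (intro allI impI)
    fix d :: real assume "d > 0"
    then obtain y where y: "y \<in> A" "y \<in> ball q (min d eps)"
      using near_frontier[OF qA, of "min d eps"] eps(1) by auto
    then have "connected_component (- drawing V E) x y" using eps(2)[OF s x(2) _ x(1)] by simp
    then have "y \<in> F" unfolding F_def by simp
    then show "\<exists>y\<in>F. dist y q < d" using y(2) by (auto simp: dist_commute)
  qed
  moreover have "q \<notin> F" using ff(3) qC cycle_image_subset[OF c] by blast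
  ultimately have "q \<in> frontier F" using ff(2) by (simp add: frontier_def interior_open)
  then have "borders F (closing xs)" by (rule bordersI[OF F e q])
  then show ?thesis using that FA by blast
qed

text \<open>On the same side the two faces would be joined to each other near an inner point of
  their common edge.\<close>

lemma bordering_faces_opposite:
  assumes c: "gcycle xs" and b: "borders F1 (closing xs)" "borders F2 (closing xs)" "F1 \<noteq> F2"
  obtains A B where "sides xs A B" "F1 \<subseteq> A" "F2 \<subseteq> B"
proof -
  have e: "closing xs \<in> E" and F: "F1 \<in> faces V E p \<gamma>" "F2 \<in> faces V E p \<gamma>"
    using b unfolding borders_def by auto
  have dis: "F1 \<inter> cycle_image xs = {}" "F2 \<inter> cycle_image xs = {}"
    using face_facts(3) F cycle_image_subset[OF c] by blast+
  obtain A B where AB: "sides xs A B" "F1 \<subseteq> A" using sides_obtain[OF c face_facts(1)[OF F(1)] dis(1)] .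
  obtain q where q: "q \<in> open_edge (closing xs)" using open_edge_nonempty[OF e] by blast
  obtain eps where eps: "eps > 0"
    "\<And>A B x y. \<lbrakk>sides xs A B; x \<in> ball q eps; y \<in> ball q eps; x \<in> A; y \<in> A\<rbrakk>
      \<Longrightarrow> connected_component (- drawing V E) x y"
    by (rule gcycle_same_side_whole[OF c q]) (rule that)
  have qf: "q \<in> frontier F1" "q \<in> frontier F2" using borders_open_edge b q by blast+
  obtain x where x: "x \<in> F1" "x \<in> ball q eps" using near_frontier[OF qf(1) eps(1)] .
  obtain y where y: "y \<in> F2" "y \<in> ball q eps" using near_frontier[OF qf(2) eps(1)] .
  have "y \<notin> A"
  proof
    assume "y \<in> A"
    then have "connected_component (- drawing V E) x y"
      using eps(2)[OF AB(1) x(2) y(2)] x(1) AB(2) by blast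
    then have "y \<in> F1" using face_absorb[OF F(1) x(1)] by blast
    then show False using faces_disjoint[OF F _ y(1)] b(3) by blast
  qed
  then have "y \<in> B" using sides_facts(4)[OF c AB(1)] y(1) dis(2) by blast
  then have "F2 \<subseteq> B" using side_trap[OF c sides_sym[OF AB(1)] face_facts(1)[OF F(2)] dis(2) y(1)] by blast
  then show ?thesis using that AB by blast
qed

text \<open>This is how crossings in the plane are excluded: a connected set off the cycle stays on
  one side, while the two frontiers belong to different closed sides.\<close>

lemma cycle_separates_faces:
  assumes c: "gcycle xs" and b: "borders F1 (closing xs)" "borders F2 (closing xs)" "F1 \<noteq> F2"
    and K: "connected K" "K \<inter> cycle_image xs = {}" "k1 \<in> K" "k1 \<in> frontier F1" "k2 \<in> K" "k2 \<in> frontier F2"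
  shows False
proof -
  obtain A B where AB: "sides xs A B" "F1 \<subseteq> A" "F2 \<subseteq> B" using bordering_faces_opposite[OF c b] .
  have "k1 \<in> closure A" "k2 \<in> closure B"
    using K(4,6) closure_mono[OF AB(2)] closure_mono[OF AB(3)] unfolding frontier_def by blast+
  then have "k1 \<in> A" "k2 \<in> B"
    using K sides_facts(6)[OF c AB(1)] sides_facts(6)[OF c sides_sym[OF AB(1)]] by blast+
  moreover have "K \<subseteq> A" by (rule side_trap[OF c AB(1) K(1,2,3) \<open>k1 \<in> A\<close>])
  ultimately show False using K(5) sides_facts(3)[OF c AB(1)] by blast
qed

text \<open>If \<open>e\<close> were a bridge of the boundary graph of \<open>F1\<close>, Janiszewski's theorem would connect the
  two faces across \<open>e\<close> in the complement of \<open>frontier F1\<close>.\<close>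

lemma boundary_edge_on_cycle:
  assumes b: "borders F1 {u, v}" "borders F2 {u, v}" "F1 \<noteq> F2"
  shows "(u, v) \<in> (adj {w \<in> V. p w \<in> frontier F1} (E - {{u, v}}))\<^sup>*"
proof (rule ccontr)
  define e where "e = {u, v}"
  define VF where "VF = {w \<in> V. p w \<in> frontier F1}"
  define K where "K = {w. (u, w) \<in> (adj VF (E - {e}))\<^sup>*}"
  define EF where "EF = {f \<in> E. path_image (\<gamma> f) \<subseteq> frontier F1}"
  assume "(u, v) \<notin> (adj {w \<in> V. p w \<in> frontier F1} (E - {{u, v}}))\<^sup>*"
  then have vK: "v \<notin> K" unfolding K_def VF_def e_def by simp
  have uK: "u \<in> K" unfolding K_def by simp
  have e: "e \<in> E" and F: "F1 \<in> faces V E p \<gamma>" "F2 \<in> faces V E p \<gamma>"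
    using b unfolding borders_def e_def by auto
  have EFV: "f \<subseteq> VF" if "f \<in> EF" for f
    using that edge_image edge_subset unfolding EF_def VF_def by blast
  have eEF: "e \<in> EF" using b(1) unfolding EF_def borders_def e_def by auto
  have uv: "u \<in> VF" "v \<in> VF" using EFV[OF eEF] unfolding e_def by auto
  have KV: "K \<subseteq> VF"
  proof
    fix w assume "w \<in> K"
    then have "(u, w) \<in> (adj VF (E - {e}))\<^sup>*" unfolding K_def by simp
    then show "w \<in> VF" by (cases rule: rtranclE) (use uv in \<open>auto simp: adj_def\<close>)
  qed
  have Kclosed: "b \<in> K" if "a \<in> K" "b \<in> VF" "{a, b} \<in> E - {e}" for a b
  proof -
    have "(a, b) \<in> adj VF (E - {e})" using that KV unfolding adj_def by auto
    then show ?thesis using that(1) unfolding K_def by (auto intro: rtrancl_into_rtrancl)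
  qed
  \<comment> \<open>\<open>K\<close> consists of the boundary vertices still reachable from
    \<open>u\<close> without \<open>e\<close>; \<open>P1\<close> and \<open>P2\<close> draw the
    boundary edges on \<open>K\<close> and on the remaining boundary vertices. Each of them meets
    the edge \<open>e\<close> in one end only, and they are disjoint.\<close>
  define P1 where "P1 = drawing K {f \<in> EF - {e}. f \<subseteq> K}"
  define P2 where "P2 = drawing (VF - K) {f \<in> EF - {e}. f \<subseteq> VF - K}"
  have VFV: "VF \<subseteq> V" unfolding VF_def by blast
  have EFE: "EF \<subseteq> E" unfolding EF_def by blast
  have s1: "subgraph K {f \<in> EF - {e}. f \<subseteq> K}" and s2: "subgraph (VF - K) {f \<in> EF - {e}. f \<subseteq> VF - K}"
    using KV VFV EFE unfolding subgraph_def by auto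
  have se: "subgraph e {e}" by (rule subgraph_edge[OF e])
  have eK: "K \<inter> e = {u}" "(VF - K) \<inter> e = {v}" using uK vK uv unfolding e_def by auto
  have i1: "P1 \<inter> path_image (\<gamma> e) = {p u}"
  proof -
    have "P1 \<inter> path_image (\<gamma> e) = drawing (K \<inter> e) ({f \<in> EF - {e}. f \<subseteq> K} \<inter> {e})"
      unfolding P1_def drawing_edge[OF e, symmetric] by (rule drawing_Int[OF s1 se])
    then show ?thesis unfolding eK(1) by (auto simp: drawing_def)
  qed
  have i2: "P2 \<inter> path_image (\<gamma> e) = {p v}"
  proof -
    have "P2 \<inter> path_image (\<gamma> e) = drawing ((VF - K) \<inter> e) ({f \<in> EF - {e}. f \<subseteq> VF - K} \<inter> {e})"
      unfolding P2_def drawing_edge[OF e, symmetric] by (rule drawing_Int[OF s2 se])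
    then show ?thesis unfolding eK(2) by (auto simp: drawing_def)
  qed
  have i3: "P1 \<inter> P2 = {}"
  proof -
    have "{f \<in> EF - {e}. f \<subseteq> K} \<inter> {f \<in> EF - {e}. f \<subseteq> VF - K} = {}"
    proof -
      have False if "f \<subseteq> K" "f \<subseteq> VF - K" "f \<in> EF" for f
      proof -
        have "f = {}" using that by blast
        then show False using edge_card[of f] that EFE by auto
      qed
      then show ?thesis by blast
    qed
    moreover have "K \<inter> (VF - K) = {}" by blast
    ultimately show ?thesis unfolding P1_def P2_def drawing_Int[OF s1 s2] by (simp add: drawing_def)
  qed
  have fr: "frontier F1 \<subseteq> (P1 \<union> path_image (\<gamma> e)) \<union> P2"
  proof
    fix z assume z: "z \<in> frontier F1"
    then have "z \<in> drawing V E" using face_facts(4)[OF F(1)] by blast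
    then consider w where "w \<in> V" "z = p w" | f where "f \<in> E" "z \<in> open_edge f"
      unfolding drawing_alt[OF subgraph_whole] by blast
    then show "z \<in> (P1 \<union> path_image (\<gamma> e)) \<union> P2"
    proof cases
      case 1
      then have "w \<in> VF" using z unfolding VF_def by simp
      then show ?thesis using 1 unfolding P1_def P2_def drawing_def by blast
    next
      case 2
      have "borders F1 f" by (rule bordersI[OF F(1) 2(1) 2(2) z])
      then have f: "f \<in> EF" using 2 unfolding EF_def borders_def by simp
      show ?thesis
      proof (cases "f = e")
        case True then show ?thesis using 2 unfolding open_edge_def by blast
      next
        case False
        obtain a b where ab: "f = {a, b}" using edge_card[OF 2(1)] by (meson card_2_iff)
        have "f \<subseteq> K \<or> f \<subseteq> VF - K"
        proof -
          have abV: "a \<in> VF" "b \<in> VF" using EFV[OF f] ab by auto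
          have "{a, b} \<in> E - {e}" "{b, a} \<in> E - {e}" using 2 False ab by (auto simp: insert_commute)
          then have "a \<in> K \<longleftrightarrow> b \<in> K" using Kclosed abV by blast
          then show ?thesis using abV ab by blast
        qed
        then have "f \<in> {f \<in> EF - {e}. f \<subseteq> K} \<or> f \<in> {f \<in> EF - {e}. f \<subseteq> VF - K}" using f False by blast
        then have "z \<in> P1 \<or> z \<in> P2"
          using 2(2) subsetD[OF open_edge_subset_drawing] unfolding P1_def P2_def by meson
        then show ?thesis by blast
      qed
    qed
  qed
  obtain q where q: "q \<in> open_edge e" using open_edge_nonempty[OF e] by blast
  have qR: "q \<notin> drawing V (E - {e})" using open_edge_drawing[OF subgraph_delete[of "{e}"] e] q by blast
  obtain eps where eps: "eps > 0" "ball q eps \<subseteq> - drawing V (E - {e})"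
    using closed_drawing[OF subgraph_delete[of "{e}"]] qR by (meson ComplI open_Compl open_contains_ball)
  have P12: "P1 \<subseteq> drawing V (E - {e})" "P2 \<subseteq> drawing V (E - {e})"
    unfolding P1_def P2_def by (rule drawing_mono; use KV VFV EFE in blast)+
  have qf: "q \<in> frontier F1" "q \<in> frontier F2"
    using borders_open_edge[OF b(1)] borders_open_edge[OF b(2)] q unfolding e_def by blast+
  obtain x where x: "x \<in> F1" "x \<in> ball q eps" using near_frontier[OF qf(1) eps(1)] .
  obtain y where y: "y \<in> F2" "y \<in> ball q eps" using near_frontier[OF qf(2) eps(1)] .
  have xy: "x \<notin> path_image (\<gamma> e)" "y \<notin> path_image (\<gamma> e)"
    using face_facts(3)[OF F(1)] face_facts(3)[OF F(2)] x(1) y(1) e unfolding drawing_def by blast+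
  have near: "connected_component (- P) x y" if "P \<subseteq> drawing V (E - {e})" for P
    unfolding connected_component_def using eps(2) x(2) y(2) that by (intro exI[of _ "ball q eps"]) auto
  \<comment> \<open>Janiszewski's theorem is used twice because the edge touches other pieces at
    both ends: first \<open>P1\<close> and the edge meet in \<open>p u\<close>, then their union
    meets \<open>P2\<close> in \<open>p v\<close>.\<close>
  have "connected_component (- (P1 \<union> path_image (\<gamma> e))) x y"
  proof (rule Janiszewski)
    show "compact P1" unfolding P1_def by (rule compact_drawing[OF s1])
    show "closed (path_image (\<gamma> e))" using edge_arc[OF e] by (simp add: closed_arc_image)
    show "connected (P1 \<inter> path_image (\<gamma> e))" unfolding i1 by simp
    show "connected_component (- P1) x y" by (rule near[OF P12(1)])
    have "connected (- path_image (\<gamma> e))" by (rule connected_arc_complement[OF edge_arc[OF e]]) simp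
    then show "connected_component (- path_image (\<gamma> e)) x y"
      using xy unfolding connected_component_def by blast
  qed
  then have "connected_component (- ((P1 \<union> path_image (\<gamma> e)) \<union> P2)) x y"
  proof (rule Janiszewski[rotated 3])
    show "compact (P1 \<union> path_image (\<gamma> e))" unfolding P1_def
      using compact_drawing[OF s1] edge_arc[OF e] by (simp add: compact_Un compact_arc_image)
    show "closed P2" unfolding P2_def by (rule closed_drawing[OF s2])
    have "(P1 \<union> path_image (\<gamma> e)) \<inter> P2 = {p v}" using i2 i3 by blast
    then show "connected ((P1 \<union> path_image (\<gamma> e)) \<inter> P2)" by simp
    show "connected_component (- P2) x y" by (rule near[OF P12(2)])
  qed
  then obtain C where C: "connected C" "C \<subseteq> - ((P1 \<union> path_image (\<gamma> e)) \<union> P2)" "x \<in> C" "y \<in> C"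
    unfolding connected_component_def by blast
  have "C \<subseteq> F1" by (rule component_frontier_trap[OF C(1) _ C(3) x(1)]) (use C(2) fr in blast)
  then show False using faces_disjoint[OF F _ y(1)] C(4) b(3) by blast
qed

end

section \<open>Faces at a vertex\<close>

context plane_graph
begin

lemma closure_open_edge:
  assumes e: "e \<in> E"
  shows "connected (open_edge e)" "path_image (\<gamma> e) \<subseteq> closure (open_edge e)"
proof -
  have cont: "continuous_on {0..1} (\<gamma> e)" using edge_arc[OF e] by (simp add: arc_def path_def)
  have inj: "inj_on (\<gamma> e) {0..1}" using edge_arc[OF e] by (simp add: arc_def)
  have "p ` e = \<gamma> e ` {0, 1}"
    using edge_ends[OF e] unfolding pathstart_def pathfinish_def by simp
  then have "open_edge e = \<gamma> e ` ({0..1} - {0, 1})"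
    unfolding open_edge_def path_image_def by (simp add: inj_on_image_set_diff[OF inj])
  moreover have "{0..1} - {0, 1} = {0<..<1::real}" by auto
  ultimately have oe: "open_edge e = \<gamma> e ` {0<..<1}" by simp
  show "connected (open_edge e)" unfolding oe
    by (rule connected_continuous_image) (auto intro: continuous_on_subset[OF cont])
  have "\<gamma> e ` closure {0<..<1} \<subseteq> closure (\<gamma> e ` {0<..<1})"
    by (rule image_closure_subset) (use cont in \<open>auto intro: subsetD[OF closure_subset]\<close>)
  then show "path_image (\<gamma> e) \<subseteq> closure (open_edge e)" unfolding oe path_image_def by simp
qed

lemma connected_half_edge:
  assumes "e \<in> E" "w \<in> e" shows "connected (insert (p w) (open_edge e))"
proof (rule connected_intermediate_closure[OF closure_open_edge(1)[OF assms(1)]])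
  have "p w \<in> path_image (\<gamma> e)" using edge_image[OF assms(1)] assms(2) by blast
  then show "insert (p w) (open_edge e) \<subseteq> closure (open_edge e)"
    using closure_open_edge(2)[OF assms(1)] closure_subset by blast
qed blast

text \<open>The path from \<open>a\<close> through \<open>ws\<close> to \<open>b\<close> with both
  end points left out. It may start and end on a cycle and still be a connected set disjoint from
  it.\<close>

definition open_path :: "'a \<Rightarrow> 'a list \<Rightarrow> 'a \<Rightarrow> complex set" where
  "open_path a ws b = open_edge {a, hd ws} \<union> drawing (set ws) (path_edges ws) \<union> open_edge {last ws, b}"

lemma connected_open_path:
  assumes "gpath ws" "ws \<noteq> []" "{a, hd ws} \<in> E" "{last ws, b} \<in> E"
  shows "connected (open_path a ws b)"
proof -
  have d: "connected (drawing (set ws) (path_edges ws))" by (rule connected_gpath[OF assms(1,2)])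
  have in1: "p (hd ws) \<in> drawing (set ws) (path_edges ws)" "p (last ws) \<in> drawing (set ws) (path_edges ws)"
    using assms(2) unfolding drawing_def by auto
  have "connected (insert (p (hd ws)) (open_edge {a, hd ws}) \<union> drawing (set ws) (path_edges ws))"
    by (rule connected_Un[OF connected_half_edge[OF assms(3)] d]) (use in1 in auto)
  then have "connected ((insert (p (hd ws)) (open_edge {a, hd ws}) \<union> drawing (set ws) (path_edges ws))
      \<union> insert (p (last ws)) (open_edge {last ws, b}))"
    by (rule connected_Un[OF _ connected_half_edge[OF assms(4)]]) (use in1 in auto)
  moreover have "(insert (p (hd ws)) (open_edge {a, hd ws}) \<union> drawing (set ws) (path_edges ws))
      \<union> insert (p (last ws)) (open_edge {last ws, b}) = open_path a ws b"
    unfolding open_path_def using in1 by blast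
  ultimately show ?thesis by simp
qed

lemma open_path_disjoint:
  assumes "gpath ws" "ws \<noteq> []" "{a, hd ws} \<in> E" "{last ws, b} \<in> E"
    and s: "subgraph U H" "U \<inter> set ws = {}"
  shows "open_path a ws b \<inter> drawing U H = {}"
proof -
  have "{a, hd ws} \<notin> H" "{last ws, b} \<notin> H"
    using s assms(2) unfolding subgraph_def by (metis disjoint_iff hd_in_set insertCI last_in_set subsetD)+
  then have "open_edge {a, hd ws} \<inter> drawing U H = {}" "open_edge {last ws, b} \<inter> drawing U H = {}"
    using open_edge_drawing[OF s(1)] assms(3,4) by blast+
  moreover have "drawing (set ws) (path_edges ws) \<inter> drawing U H = {}"
    by (rule drawing_disjoint[OF gpath_subgraph[OF assms(1)] s(1)]) (use s(2) in blast)
  ultimately show ?thesis unfolding open_path_def by blast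
qed

text \<open>The open path containing both edges is connected and misses the cycle.\<close>

lemma edges_to_path_same_side:
  assumes c: "gcycle xs" and ws: "gpath ws" "ws \<noteq> []" "set xs \<inter> set ws = {}"
    and e: "{a, hd ws} \<in> E" "{last ws, b} \<in> E" and s: "sides xs A B" "open_edge {a, hd ws} \<subseteq> A"
  shows "open_edge {last ws, b} \<subseteq> A"
proof -
  have "open_path a ws b \<inter> cycle_image xs = {}"
    unfolding cycle_image_def by (rule open_path_disjoint[OF ws(1,2) e gcycle_subgraph[OF c] ws(3)])
  moreover obtain x where "x \<in> open_edge {a, hd ws}" using open_edge_nonempty[OF e(1)] by blast
  ultimately have "open_path a ws b \<subseteq> A"
    using side_trap[OF c s(1) connected_open_path[OF ws(1,2) e], of x] s(2)
    unfolding open_path_def by blast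
  then show ?thesis unfolding open_path_def by blast
qed

lemma bordered_edge_side:
  assumes c: "gcycle xs" and s: "sides xs A B" and b: "borders F e" "F \<subseteq> A"
    and e: "e \<notin> insert (closing xs) (path_edges xs)"
  shows "open_edge e \<subseteq> A"
proof -
  have "e \<in> E" using b unfolding borders_def by simp
  then have "open_edge e \<inter> cycle_image xs = {}"
    unfolding cycle_image_def using open_edge_drawing[OF gcycle_subgraph[OF c]] e by blast
  moreover have "open_edge e \<subseteq> closure A"
    using borders_open_edge[OF b(1)] closure_mono[OF b(2)] unfolding frontier_def by blast
  ultimately show ?thesis using sides_facts(6)[OF c s] by blast
qed

text \<open>The three edges with \<open>xs\<close> and \<open>ys\<close> form a theta graph between
  \<open>v\<close> and the vertex \<open>t\<close> where \<open>ys\<close> reaches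
  \<open>xs\<close>, and the closure of each of its three regions contains only two of the three
  paths. The proof compares two of its cycles: the side of \<open>C13\<close> away from
  \<open>F\<close> is contained in the side of \<open>C12\<close> away from \<open>F\<close>, which
  puts \<open>e3\<close> on the wrong side of \<open>C12\<close>.\<close>

lemma face_borders_two_edges:
  assumes xs: "gpath xs" "v \<notin> set xs" and ys: "gpath ys" "v \<notin> set ys" "ys \<noteq> []"
    and c: "last ys \<in> set xs" "set ys \<inter> set xs = {last ys}"
    and d: "hd xs \<noteq> last xs" "hd ys \<noteq> hd xs" "hd ys \<noteq> last xs"
    and F: "borders F {v, hd xs}" "borders F {v, last xs}" "borders F {v, hd ys}"
  shows False
proof -
  define e1 e2 e3 where "e1 = {v, hd xs}" and "e2 = {v, last xs}" and "e3 = {v, hd ys}"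
  have e: "e1 \<in> E" "e2 \<in> E" "e3 \<in> E" and Ff: "F \<in> faces V E p \<gamma>"
    using F unfolding borders_def e1_def e2_def e3_def by auto
  have vV: "v \<in> V" using edge_subset[OF e(1)] unfolding e1_def by simp
  obtain as bs where split: "xs = as @ last ys # bs" using c(1) by (meson split_list)
  define t where "t = last ys"
  have xs_split: "xs = as @ t # bs" using split t_def by simp
  have ne: "xs \<noteq> []" using c(1) by auto
  have dx: "distinct xs" "path_edges xs \<subseteq> E" "set xs \<subseteq> V"
    and dy: "distinct ys" "path_edges ys \<subseteq> E" "set ys \<subseteq> V"
    using xs ys unfolding gpath_def by auto
  have rev_ys: "rev ys \<noteq> []" "hd (rev ys) = t" "last (rev ys) = hd ys"
    using ys(3) by (auto simp: t_def hd_rev last_rev)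
  \<comment> \<open>The second cycle runs along \<open>xs\<close> up to \<open>t\<close> and then
    back along \<open>ys\<close>. It shares with the first cycle the edge \<open>e1\<close>, which
    closes both.\<close>
  define zs where "zs = as @ rev ys"
  have hd_zs: "hd zs = hd xs"
    using rev_ys xs_split unfolding zs_def by (cases as) auto
  have last_zs: "last zs = hd ys" "zs \<noteq> []" using rev_ys unfolding zs_def by auto
  have pe_xs: "path_edges xs = path_edges (as @ [t]) \<union> path_edges (t # bs)"
    unfolding xs_split by (rule path_edges_split)
  have pe_zs: "path_edges zs = path_edges (as @ [t]) \<union> path_edges ys"
  proof (cases "as = []")
    case True then show ?thesis unfolding zs_def by (simp add: path_edges_rev)
  next
    case False
    then show ?thesis unfolding zs_def
      using path_edges_append[OF False rev_ys(1)] path_edges_append[OF False, of "[t]"] rev_ys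
      by (auto simp: path_edges_rev)
  qed
  have disj: "set as \<inter> set ys = {}" "set bs \<inter> set ys = {}"
  proof -
    have "x = t" if "x \<in> set xs" "x \<in> set ys" for x using c(2) that unfolding t_def by blast
    moreover have "t \<notin> set as" "t \<notin> set bs" using dx(1) xs_split by auto
    ultimately show "set as \<inter> set ys = {}" "set bs \<inter> set ys = {}" using xs_split by auto
  qed
  have dz: "distinct zs"
    unfolding zs_def using dx(1) dy(1) xs_split disj(1) by auto
  have sz: "set zs = set as \<union> set ys" unfolding zs_def by simp
  have gx: "gcycle (xs @ [v])"
  proof -
    have "length xs \<ge> 2" using d(1) ne by (cases xs; cases "tl xs") auto
    then show ?thesis using dx xs(2) e vV ne
      unfolding gcycle_def gpath_def path_edges_append[OF ne, of "[v]", simplified] e1_def e2_def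
      by (auto simp: insert_commute)
  qed
  have gz: "gcycle (zs @ [v])"
  proof -
    have "length zs \<ge> 2" using d(2) last_zs hd_zs by (cases zs; cases "tl zs") auto
    moreover have "path_edges (as @ [t]) \<subseteq> E" "set as \<subseteq> V" "v \<notin> set as"
      using pe_xs dx xs_split xs(2) by auto
    ultimately show ?thesis using dz dy ys(2) e vV last_zs hd_zs sz
      unfolding gcycle_def gpath_def path_edges_append[OF last_zs(2), of "[v]", simplified] pe_zs e1_def e3_def
      by (auto simp: insert_commute)
  qed
  have clx: "closing (xs @ [v]) = e1" and clz: "closing (zs @ [v]) = e1"
    unfolding e1_def using ne last_zs hd_zs by auto
  have pex: "path_edges (xs @ [v]) = insert e2 (path_edges xs)"
    and pez: "path_edges (zs @ [v]) = insert e3 (path_edges zs)"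
    using path_edges_append[OF ne, of "[v]"] path_edges_append[OF last_zs(2), of "[v]"] last_zs
    unfolding e2_def e3_def by (auto simp: insert_commute)
  have ve: "v \<in> e1" "v \<in> e2" "v \<in> e3" unfolding e1_def e2_def e3_def by auto
  have vpe: "v \<notin> f" if "f \<in> path_edges xs \<union> path_edges ys \<union> path_edges zs" for f
  proof -
    have "f \<subseteq> set xs \<or> f \<subseteq> set ys \<or> f \<subseteq> set zs" using that path_edges_subset by blast
    moreover have "v \<notin> set zs" using sz ys(2) xs(2) xs_split by auto
    ultimately show ?thesis using xs(2) ys(2) by blast
  qed
  have e_ne: "e1 \<noteq> e2" "e1 \<noteq> e3" "e2 \<noteq> e3"
    using d unfolding e1_def e2_def e3_def by (auto simp: doubleton_eq_iff)
  have e_notin: "e1 \<notin> path_edges xs \<union> path_edges zs" "e2 \<notin> path_edges zs" "e3 \<notin> path_edges xs"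
    using vpe ve by blast+
  have ni3: "e3 \<notin> insert (closing (xs @ [v])) (path_edges (xs @ [v]))"
    unfolding clx pex using e_ne e_notin by blast
  have ni2: "e2 \<notin> insert (closing (zs @ [v])) (path_edges (zs @ [v]))"
    unfolding clz pez using e_ne e_notin by blast
  define C12 C13 where "C12 = cycle_image (xs @ [v])" and "C13 = cycle_image (zs @ [v])"
  have dis: "F \<inter> drawing V E = {}" and conF: "connected F" using face_facts[OF Ff] by auto
  obtain A12 B12 where s12: "sides (xs @ [v]) A12 B12" "F \<subseteq> A12"
    using sides_obtain[OF gx conF] dis cycle_image_subset[OF gx] by blast
  obtain A13 B13 where s13: "sides (zs @ [v]) A13 B13" "F \<subseteq> A13"
    using sides_obtain[OF gz conF] dis cycle_image_subset[OF gz] by blast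
  have e3A: "open_edge e3 \<subseteq> A12"
    by (rule bordered_edge_side[OF gx s12(1) F(3)[folded e3_def] s12(2) ni3])
  have e2A: "open_edge e2 \<subseteq> A13"
    by (rule bordered_edge_side[OF gz s13(1) F(2)[folded e2_def] s13(2) ni2])
  have base: "drawing (set as \<union> {t, v}) (insert e1 (path_edges (as @ [t]))) \<subseteq> C13"
    unfolding C13_def cycle_image_def clz pez pe_zs using ys(3)
    by (intro drawing_mono) (auto simp: zs_def t_def)
  then have vt: "p v \<in> C13" "p t \<in> C13" unfolding drawing_def by auto
  \<comment> \<open>What the first cycle has off the second is connected: the open path from
    \<open>t\<close> through \<open>bs\<close> to \<open>v\<close>, or just the open edge
    \<open>e2\<close> when \<open>xs\<close> ends in \<open>t\<close>. Since it contains
    \<open>e2\<close>, it lies on the side of \<open>F\<close>.\<close>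
  have C12_sub: "\<exists>X. connected X \<and> X \<inter> C13 = {} \<and> open_edge e2 \<subseteq> X \<and> C12 \<subseteq> C13 \<union> X"
  proof (cases "bs = []")
    case True
    have lx: "last xs = t" using True xs_split by simp
    have "open_edge e2 \<inter> C13 = {}" unfolding C13_def cycle_image_def
      by (rule open_edge_drawing[OF gcycle_subgraph[OF gz] e(2) ni2])
    moreover have "C12 \<subseteq> C13 \<union> open_edge e2"
    proof -
      have "C12 \<subseteq> drawing (set as \<union> {t, v}) (insert e1 (path_edges (as @ [t]))) \<union> path_image (\<gamma> e2)"
        unfolding C12_def cycle_image_def clx pex pe_xs using True xs_split by (auto simp: drawing_def)
      moreover note base
      moreover have "path_image (\<gamma> e2) \<subseteq> C13 \<union> open_edge e2"
        using edge_image[OF e(2)] vt unfolding e2_def lx by auto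
      ultimately show ?thesis by blast
    qed
    ultimately show ?thesis using closure_open_edge(1)[OF e(2)] by blast
  next
    case False
    have lb: "last bs = last xs" using False xs_split by simp
    have gb: "gpath bs" using dx xs_split pe_xs False unfolding gpath_def by (cases bs) auto
    have th: "{t, hd bs} \<in> E" using dx(2) pe_xs False by (cases bs) auto
    have be2: "{last bs, v} = e2" unfolding lb e2_def by (simp add: insert_commute)
    have pet: "path_edges (t # bs) = insert {t, hd bs} (path_edges bs)" using False by (cases bs) auto
    define X where "X = open_path t bs v"
    have conX: "connected X" unfolding X_def
      by (rule connected_open_path[OF gb False th]) (simp add: be2 e)
    have "set (zs @ [v]) \<inter> set bs = {}"
      using dx(1) xs_split disj(2) xs(2) sz by auto
    then have "X \<inter> C13 = {}" unfolding X_def C13_def cycle_image_def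
      by (intro open_path_disjoint[OF gb False th _ gcycle_subgraph[OF gz]]) (simp_all add: be2 e)
    moreover have "open_edge e2 \<subseteq> X" unfolding X_def open_path_def be2 by blast
    moreover have "C12 \<subseteq> C13 \<union> X"
    proof -
      have "C12 \<subseteq> drawing (set as \<union> {t, v}) (insert e1 (path_edges (as @ [t])))
          \<union> drawing (set bs) (path_edges bs) \<union> path_image (\<gamma> {t, hd bs}) \<union> path_image (\<gamma> e2)"
        unfolding C12_def cycle_image_def clx pex pe_xs pet using xs_split by (auto simp: drawing_def)
      moreover note base
      moreover note vt
      moreover have "p (hd bs) \<in> X" "p (last bs) \<in> X"
        unfolding X_def open_path_def drawing_def using False by auto
      moreover have "path_image (\<gamma> {t, hd bs}) = {p t, p (hd bs)} \<union> open_edge {t, hd bs}"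
        using edge_image[OF th] by simp
      moreover have "path_image (\<gamma> e2) = {p (last bs), p v} \<union> open_edge e2"
        using edge_image[OF e(2)] unfolding be2[symmetric] by simp
      moreover have "drawing (set bs) (path_edges bs) \<subseteq> X" "open_edge {t, hd bs} \<subseteq> X" "open_edge e2 \<subseteq> X"
        unfolding X_def open_path_def be2 by blast+
      ultimately show ?thesis by (simp only:) blast
    qed
    ultimately show ?thesis using conX by blast
  qed
  then obtain X where X: "connected X" "X \<inter> C13 = {}" "open_edge e2 \<subseteq> X" "C12 \<subseteq> C13 \<union> X" by blast
  obtain x2 where x2: "x2 \<in> open_edge e2" using open_edge_nonempty[OF e(2)] by blast
  have XA: "X \<subseteq> A13"
    by (rule side_trap[OF gz s13(1) X(1) X(2)[unfolded C13_def], of x2]) (use x2 X(3) e2A in auto)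
  note f13 = sides_facts[OF gz s13(1)] and g13 = sides_facts[OF gz sides_sym[OF s13(1)]]
    and f12 = sides_facts[OF gx s12(1)] and g12 = sides_facts[OF gx sides_sym[OF s12(1)]]
  have B13C12: "B13 \<inter> C12 = {}"
    using X(4) XA f13(3) g13(4) unfolding C13_def by blast
  define U H where "U = set xs \<union> set ys \<union> {v}" and "H = path_edges xs \<union> path_edges ys \<union> {e2, e3}"
  have sUH: "subgraph U H"
  proof -
    have "e2 \<subseteq> U" "e3 \<subseteq> U"
      unfolding e2_def e3_def U_def using last_in_set[OF ne] hd_in_set[OF ys(3)] by auto
    moreover have "f \<subseteq> U" if "f \<in> path_edges xs \<union> path_edges ys" for f
      using that path_edges_subset unfolding U_def by blast
    moreover have "U \<subseteq> V" "H \<subseteq> E" unfolding U_def H_def using dx dy vV e by auto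
    ultimately show ?thesis unfolding subgraph_def H_def by blast
  qed
  have e1H: "closing (xs @ [v]) \<notin> H" unfolding clx H_def using e_ne vpe ve by blast
  obtain q where q: "q \<in> open_edge e1" using open_edge_nonempty[OF e(1)] by blast
  have sx: "set (xs @ [v]) \<subseteq> U" "path_edges (xs @ [v]) \<subseteq> H" unfolding pex U_def H_def by auto
  obtain eps where eps: "eps > 0"
    "\<And>A B x y. \<lbrakk>sides (xs @ [v]) A B; x \<in> ball q eps; y \<in> ball q eps; x \<in> A; y \<in> A\<rbrakk>
      \<Longrightarrow> connected_component (- drawing U (insert (closing (xs @ [v])) H)) x y"
    by (rule gcycle_same_side[OF gx sUH e1H sx, of q]) (use q clx in simp, rule that)
  have qF: "q \<in> frontier F" using borders_open_edge[OF F(1)] q unfolding e1_def by blast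
  have "q \<in> C13" unfolding C13_def cycle_image_eq[OF gz] clz using q unfolding open_edge_def by blast
  then have qB: "q \<in> frontier B13" using g13(5) unfolding C13_def by simp
  obtain f where f: "f \<in> F" "f \<in> ball q eps" using near_frontier[OF qF eps(1)] .
  obtain y where y: "y \<in> B13" "y \<in> ball q eps" using near_frontier[OF qB eps(1)] .
  \<comment> \<open>On one side of the first cycle, the points \<open>f\<close> and \<open>y\<close>
    near \<open>q\<close> would be joined off the whole theta graph, in particular off the second
    cycle, which separates them.\<close>
  have "y \<notin> A12"
  proof
    assume yA: "y \<in> A12"
    have fA: "f \<in> A12" using f s12(2) by blast
    have "connected_component (- drawing U (insert (closing (xs @ [v])) H)) f y"
      by (rule eps(2)[OF s12(1) f(2) y(2) fA yA])
    then obtain K where K: "connected K" "K \<subseteq> - drawing U (insert (closing (xs @ [v])) H)" "f \<in> K" "y \<in> K"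
      unfolding connected_component_def by blast
    have "C13 \<subseteq> drawing U (insert (closing (xs @ [v])) H)"
      unfolding C13_def cycle_image_def clx clz pez pe_zs U_def H_def
      by (rule drawing_mono) (use pe_xs sz xs_split in auto)
    then have "K \<inter> cycle_image (zs @ [v]) = {}" using K(2) unfolding C13_def by blast
    then have "K \<subseteq> A13" using side_trap[OF gz s13(1) K(1) _ K(3)] f(1) s13(2) by blast
    then show False using K(4) y(1) f13(3) by blast
  qed
  then have "y \<in> B12" using f12(4) y(1) B13C12 unfolding C12_def by blast
  then have "B13 \<subseteq> B12"
    using side_trap[OF gx sides_sym[OF s12(1)] g13(2) B13C12[unfolded C12_def] y(1)] by blast
  then have "closure B13 \<subseteq> closure B12" by (rule closure_mono)
  moreover have "open_edge e3 \<subseteq> closure B13"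
  proof -
    have "open_edge e3 \<subseteq> C13" unfolding C13_def cycle_image_def
      by (rule open_edge_subset_drawing) (simp add: pez)
    then show ?thesis using g13(6) unfolding C13_def by blast
  qed
  ultimately have "open_edge e3 \<subseteq> B12 \<union> C12" using g12(6) unfolding C12_def by blast
  moreover have "A12 \<inter> (B12 \<union> C12) = {}" using f12(3,4) unfolding C12_def by blast
  ultimately show False using e3A open_edge_nonempty[OF e(3)] by blast
qed

end

section \<open>Contraction and greedy colouring\<close>

lemma planar_subgraph:
  assumes "planar V E" "V' \<subseteq> V" "E' \<subseteq> E" shows "planar V' E'"
proof -
  obtain p \<gamma> where pe: "plane_embedding V E p \<gamma>" using assms(1) unfolding planar_def by blast
  have "plane_embedding V' E' p \<gamma>"
    unfolding plane_embedding_def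
  proof (intro conjI ballI)
    show "inj_on p V'" using pe assms(2) unfolding plane_embedding_def by (meson inj_on_subset)
    fix e assume "e \<in> E'"
    then have e: "e \<in> E" using assms(3) by blast
    show "arc (\<gamma> e)" "{pathstart (\<gamma> e), pathfinish (\<gamma> e)} = p ` e"
      using pe e unfolding plane_embedding_def by blast+
    have "(path_image (\<gamma> e) - p ` e) \<inter> (p ` V \<union> (\<Union>f\<in>E - {e}. path_image (\<gamma> f))) = {}"
      using pe e unfolding plane_embedding_def by blast
    moreover have "p ` V' \<union> (\<Union>f\<in>E' - {e}. path_image (\<gamma> f)) \<subseteq> p ` V \<union> (\<Union>f\<in>E - {e}. path_image (\<gamma> f))"
      using assms(2,3) by (intro Un_mono image_mono UN_mono) auto
    moreover have "X \<inter> B = {} \<Longrightarrow> A \<subseteq> B \<Longrightarrow> X \<inter> A = {}" for X A B :: "complex set" by blast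
    ultimately show "(path_image (\<gamma> e) - p ` e) \<inter> (p ` V' \<union> (\<Union>f\<in>E' - {e}. path_image (\<gamma> f))) = {}"
      by simp
  qed
  then show ?thesis unfolding planar_def by blast
qed

definition merge :: "'a \<Rightarrow> 'a \<Rightarrow> 'a \<Rightarrow> 'a" where
  "merge x y z = (if z = y then x else z)"

text \<open>The map from \<open>arc_collapse\<close> shrinks the drawn edge to a point and is
  injective elsewhere. Every other edge meets the collapsed one in at most one point, so its image
  is an arc again.\<close>

lemma planar_contract:
  assumes g: "simple_graph V E" and pl: "planar V E" and xy: "{x, y} \<in> E"
  shows "planar (V - {y}) ((`) (merge x y) ` (E - {{x, y}}))"
proof -
  obtain p \<gamma> where pe: "plane_embedding V E p \<gamma>" using pl unfolding planar_def by blast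
  interpret plane_graph V E p \<gamma> by unfold_locales (fact g, fact pe)
  define A where "A = path_image (\<gamma> {x, y})"
  obtain q where q: "continuous_on UNIV q" "inj_on q (- A)" "\<And>z. q z = (0::complex) \<longleftrightarrow> z \<in> A"
    using arc_collapse[OF edge_arc[OF xy]] unfolding A_def by blast
  have xyV: "x \<in> V" "y \<in> V" using edge_subset[OF xy] by auto
  have A_draw: "A = drawing {x, y} {{x, y}}" unfolding A_def drawing_edge[OF xy] ..
  have pA: "p w \<in> A \<longleftrightarrow> w = x \<or> w = y" if "w \<in> V" for w
    using vertex_drawing[OF subgraph_edge[OF xy] that] unfolding A_draw drawing_def by auto
  \<comment> \<open>Edges from \<open>x\<close> and from \<open>y\<close> to a common neighbour have
    the same image; choosing one preimage for each contracted edge removes the parallel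
    copy.\<close>
  define pre where "pre e' = (SOME e. e \<in> E - {{x, y}} \<and> merge x y ` e = e')" for e'
  define E' where "E' = (`) (merge x y) ` (E - {{x, y}})"
  have pre: "pre e' \<in> E" "pre e' \<noteq> {x, y}" "merge x y ` pre e' = e'" if "e' \<in> E'" for e'
  proof -
    have "\<exists>e. e \<in> E - {{x, y}} \<and> merge x y ` e = e'" using that unfolding E'_def by blast
    then have "pre e' \<in> E - {{x, y}} \<and> merge x y ` pre e' = e'" unfolding pre_def by (rule someI_ex)
    then show "pre e' \<in> E" "pre e' \<noteq> {x, y}" "merge x y ` pre e' = e'" by blast+
  qed
  have q_merge: "q (p (merge x y w)) = q (p w)" for w
    using q(3)[of "p x"] q(3)[of "p y"] pA[OF xyV(1)] pA[OF xyV(2)] unfolding merge_def by auto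
  define p' where "p' = q \<circ> p"
  define \<gamma>' where "\<gamma>' e' = q \<circ> \<gamma> (pre e')" for e'
  have img: "path_image (\<gamma>' e') = q ` path_image (\<gamma> (pre e'))" for e'
    unfolding \<gamma>'_def path_image_def by (simp add: image_comp)
  have ends: "p' ` e' = q ` (p ` pre e')" if "e' \<in> E'" for e'
  proof -
    have "p' ` e' = p' ` (merge x y ` pre e')" by (simp only: pre(3)[OF that])
    also have "\<dots> = (\<lambda>w. q (p (merge x y w))) ` pre e'" unfolding p'_def by (simp add: image_image)
    finally show ?thesis unfolding q_merge by (simp add: image_image)
  qed
  \<comment> \<open>As the graph is simple, another edge contains at most one of \<open>x\<close>
    and \<open>y\<close>.\<close>
  have oneA: "a = b" if e: "e \<in> E" "e \<noteq> {x, y}" and ab: "a \<in> path_image (\<gamma> e)" "b \<in> path_image (\<gamma> e)" "a \<in> A" "b \<in> A" for e a b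
  proof -
    have "path_image (\<gamma> e) \<inter> A = drawing (e \<inter> {x, y}) ({e} \<inter> {{x, y}})"
      unfolding A_draw drawing_edge[OF e(1), symmetric] by (rule drawing_Int[OF subgraph_edge[OF e(1)] subgraph_edge[OF xy]])
    then have sub: "path_image (\<gamma> e) \<inter> A = p ` (e \<inter> {x, y})" using e(2) by (auto simp: drawing_def)
    have "\<not> {x, y} \<subseteq> e"
    proof
      assume "{x, y} \<subseteq> e"
      moreover have "finite e" "card e = card {x, y}" using edge_card[OF e(1)] edge_card[OF xy] card_ge_0_finite[of e] by auto
      ultimately show False using e(2) by (metis card_subset_eq)
    qed
    then have "e \<inter> {x, y} \<subseteq> {x} \<or> e \<inter> {x, y} \<subseteq> {y}" by blast
    moreover have "a \<in> p ` (e \<inter> {x, y})" "b \<in> p ` (e \<inter> {x, y})" using sub ab by blast+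
    ultimately show ?thesis by blast
  qed
  have "plane_embedding (V - {y}) E' p' \<gamma>'"
    unfolding plane_embedding_def
  proof (intro conjI ballI)
    show "inj_on p' (V - {y})"
    proof (rule inj_onI)
      fix a b assume ab: "a \<in> V - {y}" "b \<in> V - {y}" "p' a = p' b"
      then have qq: "q (p a) = q (p b)" by (simp add: p'_def)
      show "a = b"
      proof (cases "p a \<in> A")
        case True
        then have "p b \<in> A" using q(3) qq by metis
        then show ?thesis using True pA ab by auto
      next
        case False
        then have "p b \<notin> A" using q(3) qq by metis
        then have "p a = p b" using inj_onD[OF q(2) qq] False by simp
        then show ?thesis using inj_onD[OF inj_p] ab by blast
      qed
    qed
    fix e' assume e': "e' \<in> E'"
    define e where "e = pre e'"
    have e: "e \<in> E" "e \<noteq> {x, y}" unfolding e_def using pre[OF e'] by auto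
    have arc: "arc (\<gamma> e)" by (rule edge_arc[OF e(1)])
    show "arc (\<gamma>' e')"
      unfolding arc_def
    proof
      show "path (\<gamma>' e')" unfolding path_def \<gamma>'_def e_def[symmetric]
        using arc continuous_on_compose[of "{0..1}" "\<gamma> e" q] continuous_on_subset[OF q(1)]
        unfolding arc_def path_def by blast
      show "inj_on (\<gamma>' e') {0..1}"
      proof (rule inj_onI)
        fix s t :: real assume st: "s \<in> {0..1}" "t \<in> {0..1}" "\<gamma>' e' s = \<gamma>' e' t"
        then have qq: "q (\<gamma> e s) = q (\<gamma> e t)" unfolding \<gamma>'_def e_def by simp
        have im: "\<gamma> e s \<in> path_image (\<gamma> e)" "\<gamma> e t \<in> path_image (\<gamma> e)" using st unfolding path_image_def by auto
        have "\<gamma> e s = \<gamma> e t"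
        proof (cases "\<gamma> e s \<in> A")
          case True
          then have "\<gamma> e t \<in> A" using q(3) qq by metis
          then show ?thesis using oneA[OF e im True] by simp
        next
          case False
          then have "\<gamma> e t \<notin> A" using q(3) qq by metis
          then show ?thesis using inj_onD[OF q(2) qq] False by simp
        qed
        then show "s = t" using arc st unfolding arc_def inj_on_def by blast
      qed
    qed
    show "{pathstart (\<gamma>' e'), pathfinish (\<gamma>' e')} = p' ` e'"
      unfolding ends[OF e'] e_def[symmetric] edge_ends[OF e(1), symmetric] \<gamma>'_def pathstart_def pathfinish_def
      by (simp add: e_def)
    show "(path_image (\<gamma>' e') - p' ` e') \<inter> (p' ` (V - {y}) \<union> (\<Union>f\<in>E' - {e'}. path_image (\<gamma>' f))) = {}"
    proof -
      have False if z: "z \<in> path_image (\<gamma>' e')" "z \<notin> p' ` e'"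
        "z \<in> p' ` (V - {y}) \<union> (\<Union>f\<in>E' - {e'}. path_image (\<gamma>' f))" for z
      proof -
        obtain w where w: "w \<in> path_image (\<gamma> e)" "z = q w" using z(1) unfolding img e_def by blast
        have "w \<notin> p ` e" using z(2) w(2) unfolding ends[OF e'] e_def by blast
        then have wo: "w \<in> open_edge e" using w(1) unfolding open_edge_def by blast
        have "w \<notin> A"
          using open_edge_drawing[OF subgraph_edge[OF xy] e(1)] e(2) wo unfolding A_draw by blast
        have inA: "w = w'" if "z = q w'" for w'
        proof -
          have "w' \<notin> A" using q(3) \<open>w \<notin> A\<close> that w(2) by metis
          then show ?thesis using inj_onD[OF q(2), of w w'] that w(2) \<open>w \<notin> A\<close> by simp
        qed
        from z(3) show False
        proof
          assume "z \<in> p' ` (V - {y})"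
          then obtain a where "a \<in> V" "z = q (p a)" unfolding p'_def by auto
          then show False using inA open_edge_vertex[OF e(1)] wo by metis
        next
          assume "z \<in> (\<Union>f\<in>E' - {e'}. path_image (\<gamma>' f))"
          then obtain f' where f': "f' \<in> E'" "f' \<noteq> e'" "z \<in> path_image (\<gamma>' f')" by blast
          then obtain w' where w': "w' \<in> path_image (\<gamma> (pre f'))" "z = q w'" unfolding img by blast
          have "pre f' \<noteq> e" using pre(3)[OF f'(1)] pre(3)[OF e'] f'(2) unfolding e_def by metis
          then show False using open_edge_disjoint[OF e(1)] wo w' inA[OF w'(2)] pre(1)[OF f'(1)] by blast
        qed
      qed
      then show ?thesis by blast
    qed
  qed
  then show ?thesis unfolding planar_def E'_def by blast
qed

section \<open>Induced subgraphs and list colourings\<close>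

definition induced :: "'a set set \<Rightarrow> 'a set \<Rightarrow> 'a set set" where
  "induced E U = {e \<in> E. e \<subseteq> U}"

definition proper :: "('a \<Rightarrow> nat set) \<Rightarrow> 'a set \<Rightarrow> 'a set set \<Rightarrow> ('a \<Rightarrow> nat) \<Rightarrow> bool" where
  "proper L U H c \<longleftrightarrow> (\<forall>x\<in>U. c x \<in> L x) \<and> (\<forall>a b. {a, b} \<in> H \<longrightarrow> c a \<noteq> c b)"

definition nbrs :: "'a set set \<Rightarrow> 'a \<Rightarrow> 'a set" where
  "nbrs E x = {y. {x, y} \<in> E}"

lemma simple_graph_induced: "simple_graph V E \<Longrightarrow> U \<subseteq> V \<Longrightarrow> simple_graph U (induced E U)"
  unfolding simple_graph_def induced_def by (auto intro: finite_subset)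

lemma degree_nbrs:
  assumes "simple_graph V E" shows "vertex_degree E x = card (nbrs E x)"
proof -
  have no: "{x, x} \<notin> E" using assms unfolding simple_graph_def by auto
  have "bij_betw (\<lambda>y. {x, y}) (nbrs E x) {e \<in> E. x \<in> e}"
  proof (rule bij_betw_imageI)
    show "inj_on (\<lambda>y. {x, y}) (nbrs E x)" by (auto simp: inj_on_def doubleton_eq_iff)
    show "(\<lambda>y. {x, y}) ` nbrs E x = {e \<in> E. x \<in> e}"
    proof
      show "{e \<in> E. x \<in> e} \<subseteq> (\<lambda>y. {x, y}) ` nbrs E x"
      proof
        fix e assume e: "e \<in> {e \<in> E. x \<in> e}"
        then have "card e = 2" using assms unfolding simple_graph_def by blast
        then obtain a b where "e = {a, b}" by (meson card_2_iff)
        then have "\<exists>y. e = {x, y}" using e by (auto simp: insert_commute)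
        then show "e \<in> (\<lambda>y. {x, y}) ` nbrs E x" using e unfolding nbrs_def by auto
      qed
    qed (auto simp: nbrs_def)
  qed
  then show ?thesis unfolding vertex_degree_def using bij_betw_same_card by metis
qed

lemma nbrs_facts:
  assumes "simple_graph V E" shows "nbrs E x \<subseteq> V" "finite (nbrs E x)" "x \<notin> nbrs E x"
proof -
  show "nbrs E x \<subseteq> V" using assms unfolding simple_graph_def nbrs_def by auto
  then show "finite (nbrs E x)" using assms finite_subset unfolding simple_graph_def by blast
  show "x \<notin> nbrs E x" using assms unfolding simple_graph_def nbrs_def by auto
qed

lemma proper_extend_one:
  assumes "simple_graph V E" "proper M S (induced E S) c" "x \<notin> S" "finite S"
    and "card (nbrs E x \<inter> S) < card (M x)"
  obtains k where "proper M (insert x S) (induced E (insert x S)) (c(x := k))"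
proof -
  have "card (c ` (nbrs E x \<inter> S)) < card (M x)"
    using assms(4,5) card_image_le[of "nbrs E x \<inter> S" c] by simp
  then obtain k where k: "k \<in> M x" "k \<notin> c ` (nbrs E x \<inter> S)"
    using assms(4) by (metis card_mono finite_Int finite_imageI not_less subsetI)
  have xx: "{x, x} \<notin> E" using nbrs_facts(3)[OF assms(1), of x] unfolding nbrs_def by auto
  have "proper M (insert x S) (induced E (insert x S)) (c(x := k))"
    unfolding proper_def
  proof (intro conjI ballI allI impI)
    fix y assume "y \<in> insert x S"
    then show "(c(x := k)) y \<in> M y" using k assms(2) unfolding proper_def by auto
  next
    fix a b assume ab: "{a, b} \<in> induced E (insert x S)"
    then have abE: "{a, b} \<in> E" "{b, a} \<in> E" and abS: "a \<in> insert x S" "b \<in> insert x S"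
      unfolding induced_def by (auto simp: insert_commute)
    show "(c(x := k)) a \<noteq> (c(x := k)) b"
    proof (cases "a = x")
      case True
      then have "b \<noteq> x" using xx abE by auto
      then show ?thesis using True k(2) abE abS unfolding nbrs_def by auto
    next
      case False
      show ?thesis
      proof (cases "b = x")
        case True
        then show ?thesis using False k(2) abE abS unfolding nbrs_def by auto
      next
        case b: False
        then have "{a, b} \<in> induced E S" using ab False abS unfolding induced_def by auto
        then show ?thesis using b False assms(2) unfolding proper_def by auto
      qed
    qed
  qed
  then show ?thesis using that by blast
qed

lemma proper_union:
  assumes pr: "proper L A (induced E A) \<phi>" "proper L W (induced E W) \<psi>" and d: "A \<inter> W = {}"
    and cross: "\<And>a b. \<lbrakk>a \<in> A; b \<in> W; {a, b} \<in> E\<rbrakk> \<Longrightarrow> \<phi> a \<noteq> \<psi> b"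
  shows "proper L (A \<union> W) (induced E (A \<union> W)) (\<lambda>x. if x \<in> A then \<phi> x else \<psi> x)"
  unfolding proper_def
proof (intro conjI ballI allI impI)
  fix x assume "x \<in> A \<union> W"
  then show "(if x \<in> A then \<phi> x else \<psi> x) \<in> L x" using pr unfolding proper_def by auto
next
  fix a b assume "{a, b} \<in> induced E (A \<union> W)"
  then have ab: "{a, b} \<in> E" "{b, a} \<in> E" and abU: "a \<in> A \<union> W" "b \<in> A \<union> W"
    unfolding induced_def by (auto simp: insert_commute)
  consider "a \<in> A" "b \<in> A" | "a \<in> A" "b \<notin> A" | "a \<notin> A" "b \<in> A" | "a \<notin> A" "b \<notin> A" by blast
  then show "(if a \<in> A then \<phi> a else \<psi> a) \<noteq> (if b \<in> A then \<phi> b else \<psi> b)"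
  proof cases
    case 1
    then have "{a, b} \<in> induced E A" using ab unfolding induced_def by auto
    then show ?thesis using 1 pr(1) unfolding proper_def by auto
  next
    case 2 then show ?thesis using cross[of a b] ab abU by auto
  next
    case 3
    then have "\<phi> b \<noteq> \<psi> a" using cross[of b a] ab abU by auto
    then show ?thesis using 3 by auto
  next
    case 4
    then have "{a, b} \<in> induced E W" using ab abU unfolding induced_def by auto
    then show ?thesis using 4 pr(2) unfolding proper_def by auto
  qed
qed

lemma rtrancl_crossing:
  assumes "(u, x) \<in> r\<^sup>*" "u \<in> R" "x \<notin> R"
  obtains a b where "(a, b) \<in> r" "a \<in> R" "b \<notin> R"
proof -
  have "\<exists>a b. (a, b) \<in> r \<and> a \<in> R \<and> b \<notin> R"
    using assms by (induction rule: rtrancl_induct) blast+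
  then show ?thesis using that by blast
qed

text \<open>Colour \<open>D\<close> towards \<open>u\<close>: every other vertex is coloured while
  some neighbour in \<open>D\<close> is still uncoloured and so has a colour to spare, and
  \<open>u\<close> comes last with its extra colour.\<close>

lemma greedy_colouring:
  assumes g: "simple_graph V E" and D: "finite D" "u \<in> D" "\<And>x. x \<in> D \<Longrightarrow> (u, x) \<in> (adj D E)\<^sup>*"
    and M: "\<And>x. x \<in> D \<Longrightarrow> card (nbrs E x \<inter> D) \<le> card (M x)" "card (nbrs E u \<inter> D) < card (M u)"
  obtains c where "proper M D (induced E D) c"
proof -
  \<comment> \<open>\<open>P R\<close> says that the vertices of \<open>R\<close> can be left to the
    end. A largest such \<open>R\<close> is all of \<open>D\<close>: otherwise connectedness
    provides a vertex outside \<open>R\<close> with a neighbour in \<open>R\<close>, and this vertex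
    may be coloured just before \<open>R\<close>.\<close>
  define P where "P R \<longleftrightarrow> R \<subseteq> D \<and> u \<in> R \<and>
    ((\<exists>c. proper M (D - R) (induced E (D - R)) c) \<longrightarrow> (\<exists>c. proper M D (induced E D) c))" for R
  have step: "\<exists>c. proper M (insert x S) (induced E (insert x S)) c"
    if a: "x \<in> D" "x \<notin> S" "S \<subseteq> D" "card (nbrs E x \<inter> S) < card (M x)" "\<exists>c. proper M S (induced E S) c" for x S
  proof -
    obtain c where c: "proper M S (induced E S) c" using a(5) by blast
    show ?thesis
      by (rule proper_extend_one[OF g c a(2) finite_subset[OF a(3) D(1)] a(4)]) blast
  qed
  have P0: "P {u}"
  proof -
    have "card (nbrs E u \<inter> (D - {u})) < card (M u)"
      using M(2) card_mono[of "nbrs E u \<inter> D" "nbrs E u \<inter> (D - {u})"] D(1) by fastforce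
    then show ?thesis unfolding P_def using step[of u "D - {u}"] D(2) by (auto simp: insert_absorb)
  qed
  have bound: "\<forall>R. P R \<longrightarrow> card R < Suc (card D)"
    unfolding P_def using D(1) by (simp add: card_mono less_Suc_eq_le)
  obtain R where R: "P R" "\<And>R'. P R' \<Longrightarrow> card R' \<le> card R"
    using ex_has_greatest_nat[of P "{u}" card "Suc (card D)"] P0 bound by blast
  have RD: "R \<subseteq> D" "u \<in> R" using R(1) unfolding P_def by auto
  have "R = D"
  proof (rule ccontr)
    assume "R \<noteq> D"
    then obtain y where y: "y \<in> D" "y \<notin> R" using RD by blast
    obtain a x where ax: "(a, x) \<in> adj D E" "a \<in> R" "x \<notin> R"
      using rtrancl_crossing[OF D(3)[OF y(1)] RD(2) y(2)] .
    then have x: "x \<in> D" "a \<in> nbrs E x" "a \<in> D" unfolding adj_def nbrs_def by (auto simp: insert_commute)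
    have "card (nbrs E x \<inter> (D - insert x R)) < card (nbrs E x \<inter> D)"
      by (rule psubset_card_mono) (use D(1) x ax in auto)
    then have lt: "card (nbrs E x \<inter> (D - insert x R)) < card (M x)" using M(1)[OF x(1)] by simp
    have eq: "insert x (D - insert x R) = D - R" using x ax by auto
    have "P (insert x R)" unfolding P_def
      using step[OF x(1) _ _ lt] R(1) x RD unfolding eq P_def by auto
    then have "card (insert x R) \<le> card R" using R(2) by blast
    moreover have "finite R" using RD D(1) finite_subset by blast
    ultimately show False using ax by simp
  qed
  moreover have "\<exists>c. proper M {} (induced E {}) c"
    using g unfolding proper_def induced_def simple_graph_def by auto
  ultimately show ?thesis using R(1) that unfolding P_def by auto
qed

section \<open>Minimal uncolourable graphs\<close>

locale bad_lists =
  fixes V :: "'a set" and E :: "'a set set" and L :: "'a \<Rightarrow> nat set"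
  assumes minimal: "minimal_non_4_choosable_planar V E"
    and lists: "\<And>x. x \<in> V \<Longrightarrow> finite (L x) \<and> card (L x) = 4"
    and uncolourable: "\<And>c. \<not> proper L V E c"
begin

lemma graph: "simple_graph V E" and planarVE: "planar V E"
  using minimal unfolding minimal_non_4_choosable_planar_def by auto

lemma finite_V: "finite V" and edge_subset: "e \<in> E \<Longrightarrow> e \<subseteq> V" and edge_card: "e \<in> E \<Longrightarrow> card e = 2"
  using graph by (auto simp: simple_graph_def)

lemma no_loop: "{x, x} \<notin> E"
  using edge_card[of "{x, x}"] by auto

lemma smaller_colourable:
  fixes V' :: "'a set" and E' :: "'a set set"
  assumes "simple_graph V' E'" "planar V' E'" "card V' < card V"
    "\<And>x. x \<in> V' \<Longrightarrow> finite (L' x) \<and> card (L' x) = 4"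
  obtains c where "proper L' V' E' c"
proof -
  have "choosable 4 V' E'"
  proof (rule ccontr)
    assume "\<not> choosable 4 V' E'"
    then have "card V \<le> card V'"
      using minimal assms(1,2) unfolding minimal_non_4_choosable_planar_def by blast
    then show False using assms(3) by simp
  qed
  then have "\<exists>c. (\<forall>v\<in>V'. c v \<in> L' v) \<and> (\<forall>u v. {u, v} \<in> E' \<longrightarrow> c u \<noteq> c v)"
    using assms(4) unfolding choosable_def by simp
  then show ?thesis using that unfolding proper_def by blast
qed

lemma induced_colourable:
  assumes "U \<subseteq> V" "U \<noteq> V" obtains c where "proper L U (induced E U) c"
proof -
  have "card U < card V" using assms finite_V by (simp add: psubset_card_mono psubset_eq)
  moreover have "planar U (induced E U)"
    by (rule planar_subgraph[OF planarVE assms(1)]) (auto simp: induced_def)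
  ultimately show ?thesis
    using smaller_colourable[OF simple_graph_induced[OF graph assms(1)], of L] that lists assms(1) by blast
qed

lemma induced_whole: "induced E V = E"
  unfolding induced_def using edge_subset by blast

lemma no_extension:
  assumes "proper L (V - D) (induced E (V - D)) c0"
    and "proper (\<lambda>x. L x - c0 ` (nbrs E x - D)) D (induced E D) c1" "D \<subseteq> V"
  shows False
proof -
  have c1: "proper L D (induced E D) c1" using assms(2) unfolding proper_def by blast
  have "c1 a \<noteq> c0 b" if "a \<in> D" "b \<in> V - D" "{a, b} \<in> E" for a b
  proof -
    have "c1 a \<notin> c0 ` (nbrs E a - D)" using assms(2) that(1) unfolding proper_def by blast
    moreover have "c0 b \<in> c0 ` (nbrs E a - D)" using that unfolding nbrs_def by blast
    ultimately show ?thesis by auto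
  qed
  then have "proper L (D \<union> (V - D)) (induced E (D \<union> (V - D))) (\<lambda>x. if x \<in> D then c1 x else c0 x)"
    by (intro proper_union[OF c1 assms(1)]) auto
  moreover have "D \<union> (V - D) = V" using assms(3) by blast
  ultimately show False using uncolourable induced_whole by simp
qed

lemma nbrs_split: "card (nbrs E x) = card (nbrs E x \<inter> D) + card (nbrs E x - D)"
  using nbrs_facts(2)[OF graph, of x] by (metis Diff_disjoint Int_Diff_Un Int_Diff_disjoint card_Un_disjoint finite_Diff finite_Int)

lemma remaining_list:
  assumes "x \<in> V"
  shows "card (nbrs E x \<inter> D) + 4 \<le> card (L x - c ` (nbrs E x - D)) + card (nbrs E x)"
proof -
  have "finite (nbrs E x - D)" using nbrs_facts(2)[OF graph] by blast
  then have "card (c ` (nbrs E x - D)) \<le> card (nbrs E x - D)" by (rule card_image_le)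
  moreover have "card (L x) - card (c ` (nbrs E x - D)) \<le> card (L x - c ` (nbrs E x - D))"
    by (rule diff_card_le_card_Diff) (use \<open>finite (nbrs E x - D)\<close> in simp)
  ultimately show ?thesis using lists[OF assms] nbrs_split[of x D] by simp
qed

lemma min_degree: assumes "x \<in> V" shows "card (nbrs E x) \<ge> 4"
proof (rule ccontr)
  assume "\<not> card (nbrs E x) \<ge> 4"
  moreover obtain c0 where c0: "proper L (V - {x}) (induced E (V - {x})) c0"
    using induced_colourable[of "V - {x}"] assms by blast
  ultimately have "card (L x - c0 ` (nbrs E x - {x})) > 0" using remaining_list[OF assms, of "{x}" c0] by linarith
  then obtain k where k: "k \<in> L x - c0 ` (nbrs E x - {x})" by (metis card.empty equals0I less_irrefl)
  have "proper (\<lambda>x'. L x' - c0 ` (nbrs E x' - {x})) {x} (induced E {x}) (\<lambda>_. k)"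
    unfolding proper_def induced_def using k no_loop by (auto simp: doubleton_eq_iff)
  then show False using no_extension[OF c0] assms by blast
qed

section \<open>Attainable colours and the identification of vertices\<close>

definition attainable :: "'a set \<Rightarrow> 'a \<Rightarrow> nat set" where
  "attainable U x = {c x | c. proper L U (induced E U) c}"

lemma attainable_subset: "x \<in> U \<Longrightarrow> attainable U x \<subseteq> L x"
  unfolding attainable_def proper_def by blast

text \<open>After a permutation of the colours on \<open>W\<close> the colours attainable at \<open>r\<close> from \<open>I\<close> and at \<open>w\<close>
  from \<open>W\<close> become disjoint, so that the graph with \<open>w\<close> identified with \<open>r\<close> is not 4-choosable.\<close>

lemma identification_impossible:
  assumes IW: "I \<subseteq> V" "W \<subseteq> V" "I \<inter> W = {}" "r \<in> I" "w \<in> W"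
    and pl: "planar (I \<union> (W - {w})) (induced E I \<union> (`) (merge r w) ` induced E W)"
    and A: "card (attainable I r) + card (attainable W w) \<le> 4"
  shows False
proof -
  define AI AW where "AI = attainable I r" and "AW = attainable W w"
  have rw: "r \<in> V" "w \<in> V" "r \<noteq> w" using IW by auto
  note Lr = lists[OF rw(1)] and Lw = lists[OF rw(2)]
  have sub: "AI \<subseteq> L r" "AW \<subseteq> L w" unfolding AI_def AW_def using attainable_subset IW by auto
  have fin: "finite AI" "finite AW" using sub Lr Lw finite_subset by blast+
  \<comment> \<open>Here the bound four enters: there is room in \<open>L r\<close> to move the
    colours attainable at \<open>w\<close> to colours not attainable at \<open>r\<close>.\<close>
  have "card AW \<le> card (L r - AI)" using A fin Lr sub unfolding AI_def[symmetric] AW_def[symmetric]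
    by (simp add: card_Diff_subset)
  then obtain g where g: "g ` AW \<subseteq> L r - AI" "inj_on g AW"
    using card_le_inj[OF fin(2), of "L r - AI"] Lr by blast
  have "card (L w - AW) = card (L r - g ` AW)"
    using Lw Lr fin sub g card_image[OF g(2)] by (simp add: card_Diff_subset Diff_subset subset_trans[OF g(1)])
  then obtain h where h: "bij_betw h (L w - AW) (L r - g ` AW)"
    using finite_same_card_bij[of "L w - AW" "L r - g ` AW"] Lr Lw by blast
  define f where "f k = (if k \<in> AW then g k else h k)" for k
  have f1: "bij_betw f AW (g ` AW)" using g(2) unfolding f_def by (auto simp: bij_betw_def inj_on_def)
  have f2: "bij_betw f (L w - AW) (L r - g ` AW)"
    using h by (rule bij_betw_cong[THEN iffD1, rotated]) (auto simp: f_def)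
  have "bij_betw f (AW \<union> (L w - AW)) (g ` AW \<union> (L r - g ` AW))"
    by (rule bij_betw_combine[OF f1 f2]) blast
  moreover have "AW \<union> (L w - AW) = L w" "g ` AW \<union> (L r - g ` AW) = L r" using sub g(1) by blast+
  ultimately have f: "bij_betw f (L w) (L r)" by simp
  \<comment> \<open>Colours outside \<open>L w\<close> are shifted beyond all colours of
    \<open>L r\<close>, so that \<open>\<pi>\<close> extends the bijection \<open>f\<close>
    injectively to all colours.\<close>
  define K where "K = Suc (Max (L r))"
  have K: "k < K" if "k \<in> L r" for k using that Lr unfolding K_def by (simp add: less_Suc_eq_le)
  define \<pi> where "\<pi> k = (if k \<in> L w then f k else k + K)" for k
  have \<pi>Lw: "\<pi> ` L w = L r" using f unfolding \<pi>_def bij_betw_def by auto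
  have inj: "inj \<pi>"
  proof (rule injI)
    fix a b assume ab: "\<pi> a = \<pi> b"
    have fL: "f k < K" if "k \<in> L w" for k using K f that unfolding bij_betw_def by blast
    show "a = b"
      using ab fL[of a] fL[of b] f unfolding \<pi>_def bij_betw_def inj_on_def by (auto split: if_splits)
  qed
  define V' E' where "V' = I \<union> (W - {w})" and "E' = induced E I \<union> (`) (merge r w) ` induced E W"
  define L' where "L' x = (if x \<in> I then L x else \<pi> ` L x)" for x
  have "V' \<subset> V" using IW unfolding V'_def by blast
  then have "card V' < card V" using finite_V by (simp add: psubset_card_mono)
  moreover have "simple_graph V' E'"
    unfolding simple_graph_def
  proof (intro conjI ballI)
    show "finite V'" using finite_V IW unfolding V'_def by (meson finite_Diff finite_UnI finite_subset)
    fix e assume "e \<in> E'"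
    then consider "e \<in> induced E I" | e0 where "e0 \<in> induced E W" "e = merge r w ` e0"
      unfolding E'_def by blast
    then have "e \<subseteq> V' \<and> card e = 2"
    proof cases
      case 1 then show ?thesis using edge_card unfolding induced_def V'_def by auto
    next
      case 2
      then have e0: "e0 \<subseteq> W" "card e0 = 2" using edge_card unfolding induced_def by auto
      have "inj_on (merge r w) W" using IW unfolding merge_def inj_on_def by auto
      then have "card e = 2" using 2 e0 card_image inj_on_subset by metis
      moreover have "e \<subseteq> V'" using 2 e0 IW unfolding V'_def merge_def by auto
      ultimately show ?thesis by simp
    qed
    then show "e \<subseteq> V'" "card e = 2" by auto
  qed
  moreover have "finite (L' x) \<and> card (L' x) = 4" if "x \<in> V'" for x
  proof -
    have "x \<in> V" using that IW unfolding V'_def by auto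
    then show ?thesis using lists[of x] card_image[OF inj_on_subset[OF inj], of "L x"] unfolding L'_def by auto
  qed
  ultimately obtain c where c: "proper L' V' E' c"
    using smaller_colourable[of V' E' L'] pl unfolding V'_def E'_def by blast
  have "c x \<in> L x" if "x \<in> I" for x
  proof -
    have "c x \<in> L' x" using c that unfolding proper_def V'_def by blast
    then show ?thesis using that unfolding L'_def by simp
  qed
  then have "proper L I (induced E I) c" using c unfolding proper_def E'_def by blast
  then have cr: "c r \<in> AI" unfolding AI_def attainable_def by blast
  have crL: "c r \<in> L r" using cr sub by blast
  \<comment> \<open>Undoing \<open>\<pi>\<close> on \<open>W\<close> gives a colouring from the
    original lists in which \<open>w\<close> receives the preimage of the colour of
    \<open>r\<close>. So \<open>c r\<close> is attainable at \<open>r\<close> and also lies in the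
    image of \<open>AW\<close> under \<open>g\<close>, which was chosen to avoid
    \<open>AI\<close>.\<close>
  define d where "d z = inv \<pi> (c (merge r w z))" for z
  have \<pi>d: "\<pi> (d z) = c (merge r w z) \<and> d z \<in> L z" if "z \<in> W" for z
  proof -
    have "c (merge r w z) \<in> \<pi> ` L z"
    proof (cases "z = w")
      case True then show ?thesis using crL \<pi>Lw unfolding merge_def by simp
    next
      case False
      then have "z \<in> V'" "z \<notin> I" using that IW unfolding V'_def by auto
      then have "c z \<in> \<pi> ` L z" using c unfolding proper_def L'_def by auto
      then show ?thesis using False unfolding merge_def by simp
    qed
    then show ?thesis unfolding d_def using inj by (auto simp: inv_f_f)
  qed
  have "proper L W (induced E W) d" unfolding proper_def
  proof (intro conjI ballI allI impI)
    fix z assume "z \<in> W" then show "d z \<in> L z" using \<pi>d by blast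
  next
    fix a b assume ab: "{a, b} \<in> induced E W"
    then have W: "a \<in> W" "b \<in> W" unfolding induced_def by auto
    have "merge r w ` {a, b} \<in> E'" using ab unfolding E'_def by blast
    then have "{merge r w a, merge r w b} \<in> E'" by simp
    then have "c (merge r w a) \<noteq> c (merge r w b)" using c unfolding proper_def by blast
    then show "d a \<noteq> d b" using \<pi>d[OF W(1)] \<pi>d[OF W(2)] by metis
  qed
  then have dw: "d w \<in> AW" unfolding AW_def attainable_def by blast
  have "c r = \<pi> (d w)" using \<pi>d[OF IW(5)] unfolding merge_def by simp
  also have "\<dots> = g (d w)" using dw sub unfolding \<pi>_def f_def by auto
  finally have "c r \<in> g ` AW" using dw by blast
  then show False using cr g(1) by blast
qed

text \<open>The glued graph is part of the graph with \<open>{r, w}\<close> contracted: edges inside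
  \<open>I\<close> avoid \<open>w\<close> and are not changed by the contraction.\<close>

lemma planar_identify_adjacent:
  assumes "simple_graph U H" "planar U H" and IW: "I \<inter> W = {}" "r \<in> I" "w \<in> W" "I \<union> W \<subseteq> U"
    and rw: "{r, w} \<in> H" and H: "induced E I \<union> induced E W \<subseteq> H"
  shows "planar (I \<union> (W - {w})) (induced E I \<union> (`) (merge r w) ` induced E W)"
proof (rule planar_subgraph[OF planar_contract[OF assms(1,2) rw]])
  show "I \<union> (W - {w}) \<subseteq> U - {w}" using IW by blast
  have id: "merge r w ` e = e" if "e \<subseteq> I" for e using that IW unfolding merge_def by force
  have ne: "e \<noteq> {r, w}" if "e \<subseteq> I \<or> e \<subseteq> W" for e using that IW by blast
  have a: "e \<in> (`) (merge r w) ` (H - {{r, w}})" if "e \<in> induced E I" for e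
  proof -
    have "e \<subseteq> I" "e \<in> H" using that H unfolding induced_def by auto
    then have "e = merge r w ` e" "e \<in> H - {{r, w}}" using id ne by auto
    then show ?thesis by blast
  qed
  have b: "merge r w ` e \<in> (`) (merge r w) ` (H - {{r, w}})" if "e \<in> induced E W" for e
  proof -
    have "e \<subseteq> W" "e \<in> H" using that H unfolding induced_def by auto
    then have "e \<in> H - {{r, w}}" using ne by auto
    then show ?thesis by blast
  qed
  show "induced E I \<union> (`) (merge r w) ` induced E W \<subseteq> (`) (merge r w) ` (H - {{r, w}})"
    by (rule Un_least) (rule subsetI, erule a, rule image_subsetI, erule b)
qed

text \<open>Contracting \<open>{u, r}\<close> makes \<open>r\<close> adjacent to \<open>w\<close>,
  and contracting this new edge identifies the two.\<close>

lemma planar_identify_common_nbr: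
  assumes IW: "I \<inter> W = {}" "r \<in> I" "w \<in> W" "I \<union> W \<subseteq> V" and u: "u \<in> V - (I \<union> W)" "{u, r} \<in> E" "{u, w} \<in> E"
  shows "planar (I \<union> (W - {w})) (induced E I \<union> (`) (merge r w) ` induced E W)"
proof -
  define H where "H = (`) (merge r u) ` (E - {{r, u}})"
  have ru: "{r, u} \<in> E" using u(2) by (simp add: insert_commute)
  have pH: "planar (V - {u}) H" unfolding H_def by (rule planar_contract[OF graph planarVE ru])
  define H' where "H' = induced E I \<union> induced E W \<union> {{r, w}}"
  have H'H: "H' \<subseteq> H"
  proof
    fix e assume "e \<in> H'"
    then consider "e \<in> E" "e \<subseteq> I \<union> W" | "e = {r, w}" unfolding H'_def induced_def by blast
    then show "e \<in> H"
    proof cases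
      case 1
      then have "u \<notin> e" using u(1) by blast
      then have "merge r u ` e = e" unfolding merge_def by force
      moreover have "e \<noteq> {r, u}" using \<open>u \<notin> e\<close> by auto
      ultimately show ?thesis using 1(1) unfolding H_def by (metis DiffI image_eqI singletonD)
    next
      case 2
      have "w \<noteq> u" "w \<noteq> r" using u(1) IW by auto
      then have "merge r u ` {u, w} = {r, w}" "{u, w} \<noteq> {r, u}" unfolding merge_def by (auto simp: doubleton_eq_iff)
      then show ?thesis using 2 u(3) unfolding H_def by (metis DiffI image_eqI singletonD)
    qed
  qed
  have "simple_graph (V - {u}) H'"
    unfolding simple_graph_def
  proof (intro conjI ballI)
    show "finite (V - {u})" using finite_V by simp
    fix e assume e: "e \<in> H'"
    have "r \<noteq> w" using IW by auto
    then show "card e = 2" using e edge_card unfolding H'_def induced_def by auto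
    show "e \<subseteq> V - {u}" using e IW u(1) unfolding H'_def induced_def by auto
  qed
  moreover have "planar (V - {u}) H'" by (rule planar_subgraph[OF pH _ H'H]) simp
  ultimately show ?thesis
    by (rule planar_identify_adjacent[OF _ _ IW(1-3)]) (use IW u in \<open>auto simp: H'_def\<close>)
qed

text \<open>Colourings of the two parts clash only if the ends of the bridge get equal colours. As
  no colouring of the whole exists, this happens for every pair, so each end has a single attainable
  colour. Two such sets are well within the bound of \<open>identification_impossible\<close>, and
  contracting the bridge identifies its ends.\<close>

lemma no_bridge:
  assumes "{u, v} \<in> E" "A \<subseteq> V" "u \<in> A" "v \<notin> A"
    and only: "\<And>a b. a \<in> A \<Longrightarrow> b \<in> V - A \<Longrightarrow> {a, b} \<in> E \<Longrightarrow> a = u \<and> b = v"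
  shows False
proof -
  define W where "W = V - A"
  have v: "v \<in> W" using edge_subset[OF assms(1)] assms(4) unfolding W_def by auto
  obtain c1 where c1: "proper L A (induced E A) c1" using induced_colourable[of A] assms v unfolding W_def by blast
  obtain c2 where c2: "proper L W (induced E W) c2" using induced_colourable[of W] assms unfolding W_def by blast
  have eq: "\<phi> u = \<psi> v" if pr: "proper L A (induced E A) \<phi>" "proper L W (induced E W) \<psi>" for \<phi> \<psi>
  proof (rule ccontr)
    assume ne: "\<phi> u \<noteq> \<psi> v"
    have "\<phi> a \<noteq> \<psi> b" if "a \<in> A" "b \<in> W" "{a, b} \<in> E" for a b
      using only[of a b] that ne unfolding W_def by blast
    then have "proper L (A \<union> W) (induced E (A \<union> W)) (\<lambda>x. if x \<in> A then \<phi> x else \<psi> x)"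
      by (intro proper_union[OF pr]) (auto simp: W_def)
    moreover have "A \<union> W = V" using assms(2) unfolding W_def by blast
    ultimately show False using uncolourable induced_whole by simp
  qed
  have "attainable A u \<subseteq> {c2 v}" "attainable W v \<subseteq> {c1 u}"
    unfolding attainable_def using eq[OF _ c2] eq[OF c1] by auto
  then have "card (attainable A u) \<le> card {c2 v}" "card (attainable W v) \<le> card {c1 u}"
    by (meson card_mono finite.emptyI finite_insert)+
  then have "card (attainable A u) + card (attainable W v) \<le> 4" by simp
  moreover have "planar (A \<union> (W - {v})) (induced E A \<union> (`) (merge u v) ` induced E W)"
  proof (rule planar_identify_adjacent[OF graph planarVE _ assms(3) v _ assms(1)])
    show "A \<inter> W = {}" "A \<union> W \<subseteq> V" using assms(2) unfolding W_def by blast+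
    show "induced E A \<union> induced E W \<subseteq> E" unfolding induced_def by blast
  qed
  moreover have "W \<subseteq> V" "A \<inter> W = {}" unfolding W_def by blast+
  ultimately show False
    using identification_impossible[OF assms(2) _ _ assms(3) v] by blast
qed

text \<open>\<open>u\<close> plays the vertex with the extra colour in
  \<open>greedy_colouring\<close>: it gains one as soon as \<open>r\<close> and \<open>w\<close>
  have equal colours or one of these colours is missing from \<open>L u\<close>. Otherwise two
  disjoint sets of attainable colours share the four colours of \<open>L u\<close>, which is the
  bound needed for identifying \<open>w\<close> with \<open>r\<close>.\<close>

lemma reducible_separator:
  assumes D: "D \<subseteq> V" "u \<in> D" "\<And>x. x \<in> D \<Longrightarrow> (u, x) \<in> (adj D E)\<^sup>*" "\<And>x. x \<in> D \<Longrightarrow> card (nbrs E x) \<le> 4"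
    and IW: "V - D = I \<union> W" "I \<inter> W = {}" "\<And>a b. a \<in> I \<Longrightarrow> b \<in> W \<Longrightarrow> {a, b} \<notin> E"
    and r: "r \<in> I" "{u, r} \<in> E" and w: "w \<in> W" "{u, w} \<in> E"
  shows False
proof -
  have sub: "I \<subseteq> V" "W \<subseteq> V" "D \<inter> (I \<union> W) = {}" using IW(1) D(1) by blast+
  have uV: "u \<in> V" using D by blast
  have key: "\<phi> r \<noteq> \<psi> w \<and> \<phi> r \<in> L u \<and> \<psi> w \<in> L u"
    if pr: "proper L I (induced E I) \<phi>" "proper L W (induced E W) \<psi>" for \<phi> \<psi>
  proof (rule ccontr)
    assume neg: "\<not> (\<phi> r \<noteq> \<psi> w \<and> \<phi> r \<in> L u \<and> \<psi> w \<in> L u)"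
    define c0 where "c0 x = (if x \<in> I then \<phi> x else \<psi> x)" for x
    have c0rw: "c0 r = \<phi> r" "c0 w = \<psi> w" using r w IW(2) unfolding c0_def by auto
    have c0: "proper L (V - D) (induced E (V - D)) c0"
      unfolding IW(1) c0_def by (rule proper_union[OF pr IW(2)]) (use IW(3) in blast)
    define M where "M x = L x - c0 ` (nbrs E x - D)" for x
    have M1: "card (nbrs E x \<inter> D) \<le> card (M x)" if "x \<in> D" for x
      using remaining_list[of x D c0] D(4)[OF that] D(1) that unfolding M_def by fastforce
    define N where "N = nbrs E u - D"
    have finN: "finite N" unfolding N_def using nbrs_facts(2)[OF graph] by blast
    have rwN: "r \<in> N" "w \<in> N" "r \<noteq> w" using r w IW(2) sub(3) unfolding N_def nbrs_def by auto
    \<comment> \<open>Either two outer neighbours of \<open>u\<close> share a colour or one of their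
      colours is not in \<open>L u\<close>; both ways they cost \<open>u\<close> fewer colours than
      their number.\<close>
    have lt: "card (L u \<inter> c0 ` N) < card N"
    proof (cases "c0 r \<in> L u \<and> c0 w \<in> L u")
      case True
      then have "c0 r = c0 w" using neg c0rw by auto
      then have "\<not> inj_on c0 N" using rwN unfolding inj_on_def by blast
      then have "card (c0 ` N) < card N" using card_image_le[OF finN, of c0] eq_card_imp_inj_on[OF finN, of c0] by linarith
      moreover have "card (L u \<inter> c0 ` N) \<le> card (c0 ` N)" using finN by (intro card_mono) auto
      ultimately show ?thesis by simp
    next
      case False
      then obtain z where z: "z \<in> N" "c0 z \<notin> L u" using rwN by blast
      have "card (L u \<inter> c0 ` N) \<le> card (c0 ` (N - {z}))" using finN z by (intro card_mono) auto
      also have "\<dots> \<le> card (N - {z})" using finN by (intro card_image_le) simp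
      also have "\<dots> < card N" using finN z(1) by (meson card_Diff1_less)
      finally show ?thesis .
    qed
    have "card (M u) = 4 - card (L u \<inter> c0 ` N)"
      unfolding M_def N_def[symmetric] using lists[OF uV] by (simp add: card_Diff_subset_Int)
    moreover have "card (nbrs E u) = card (nbrs E u \<inter> D) + card N" unfolding N_def by (rule nbrs_split)
    ultimately have M2: "card (nbrs E u \<inter> D) < card (M u)" using lt D(4)[OF D(2)] by linarith
    have finD: "finite D" using D(1) finite_V finite_subset by blast
    obtain c1 where "proper M D (induced E D) c1"
      using greedy_colouring[OF graph finD D(2,3) M1 M2] by blast
    then show False using no_extension[OF c0 _ D(1)] unfolding M_def by blast
  qed
  have dis: "attainable I r \<inter> attainable W w = {}" and att: "attainable I r \<union> attainable W w \<subseteq> L u"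
  proof -
    obtain c1 where c1: "proper L I (induced E I) c1" using induced_colourable[of I] sub D(2) uV IW by blast
    obtain c2 where c2: "proper L W (induced E W) c2" using induced_colourable[of W] sub D(2) uV IW by blast
    show "attainable I r \<inter> attainable W w = {}" unfolding attainable_def using key by auto
    show "attainable I r \<union> attainable W w \<subseteq> L u"
      unfolding attainable_def using key[OF _ c2] key[OF c1] by auto
  qed
  have "finite (attainable I r \<union> attainable W w)" using att lists[OF uV] finite_subset by blast
  then have "card (attainable I r) + card (attainable W w) = card (attainable I r \<union> attainable W w)"
    using card_Un_disjoint[OF _ _ dis] by simp
  also have "\<dots> \<le> 4" using card_mono[OF _ att] lists[OF uV] by simp
  finally have "card (attainable I r) + card (attainable W w) \<le> 4" .
  moreover have "planar (I \<union> (W - {w})) (induced E I \<union> (`) (merge r w) ` induced E W)"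
    by (rule planar_identify_common_nbr[OF IW(2) r(1) w(1) _ _ r(2) w(2)]) (use sub D(1,2) uV in blast)+
  ultimately show False using identification_impossible[OF sub(1,2) IW(2) r(1) w(1)] by blast
qed

end

section \<open>Theta graphs\<close>

lemma path_edges_Cons: "zs \<noteq> [] \<Longrightarrow> path_edges (a # zs) = insert {a, hd zs} (path_edges zs)"
  by (cases zs) auto

lemma path_vertex_on_edge:
  "length zs \<ge> 2 \<Longrightarrow> x \<in> set zs \<Longrightarrow> \<exists>e \<in> path_edges zs. x \<in> e"
proof (induction zs rule: path_edges.induct)
  case (1 a b zs)
  then show ?case by (cases zs) auto
qed auto

lemma path_edges_first:
  assumes "distinct (a # zs)" "{a, x} \<in> path_edges (a # zs)" shows "x = hd zs"
proof -
  have ne: "zs \<noteq> []" using assms by auto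
  have "{a, x} \<notin> path_edges zs" using path_edges_subset[of "{a, x}" zs] assms(1) by auto
  then have "{a, x} = {a, hd zs}" using assms(2) path_edges_Cons[OF ne, of a] by auto
  then show ?thesis by (auto simp: doubleton_eq_iff)
qed

lemma path_adj_rtrancl:
  assumes "path_edges (a # zs) \<subseteq> H" "set (a # zs) \<subseteq> S" "x \<in> set (a # zs)"
  shows "(a, x) \<in> (adj S H)\<^sup>*"
  using assms
proof (induction zs arbitrary: a)
  case (Cons b zs)
  show ?case
  proof (cases "x = a")
    case False
    then have "(b, x) \<in> (adj S H)\<^sup>*" using Cons by auto
    moreover have "(a, b) \<in> adj S H" using Cons(2,3) unfolding adj_def by auto
    ultimately show ?thesis by (rule converse_rtrancl_into_rtrancl[rotated])
  qed simp
qed simp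

lemma sym_adj: "sym (adj S H)"
  unfolding adj_def sym_def by (auto simp: insert_commute)

lemma adj_rtrancl_sym: "(a, b) \<in> (adj S H)\<^sup>* \<Longrightarrow> (b, a) \<in> (adj S H)\<^sup>*"
  by (rule symD[OF sym_rtrancl[OF sym_adj]])

lemma walk_exists:
  assumes "(u, v) \<in> (adj S H)\<^sup>*" "u \<in> S"
  shows "\<exists>zs. zs \<noteq> [] \<and> hd zs = u \<and> last zs = v \<and> set zs \<subseteq> S \<and> path_edges zs \<subseteq> H"
  using assms(1)
proof (induction rule: rtrancl_induct)
  case base
  then show ?case using assms(2) by (intro exI[of _ "[u]"]) auto
next
  case (step y z)
  then obtain zs where zs: "zs \<noteq> []" "hd zs = u" "last zs = y" "set zs \<subseteq> S" "path_edges zs \<subseteq> H" by blast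
  have "path_edges (zs @ [z]) = path_edges zs \<union> {{y, z}}" using path_edges_append[OF zs(1), of "[z]"] zs(3) by simp
  then show ?case using zs step(2) unfolding adj_def by (intro exI[of _ "zs @ [z]"]) auto
qed

text \<open>A walk of least length repeats no vertex and has no chord, since either would allow a
  shortcut.\<close>

lemma shortest_path:
  assumes "(u, v) \<in> (adj S H)\<^sup>*" "u \<in> S"
  obtains zs where "zs \<noteq> []" "hd zs = u" "last zs = v" "distinct zs" "set zs \<subseteq> S" "path_edges zs \<subseteq> H"
    "\<And>a b. \<lbrakk>a \<in> set zs; b \<in> set zs; a \<noteq> b; {a, b} \<in> H\<rbrakk> \<Longrightarrow> {a, b} \<in> path_edges zs"
proof -
  define W where "W zs \<longleftrightarrow> zs \<noteq> [] \<and> hd zs = u \<and> last zs = v \<and> set zs \<subseteq> S \<and> path_edges zs \<subseteq> H" for zs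
  obtain w0 where w0: "W w0" using walk_exists[OF assms] unfolding W_def by (elim exE)
  obtain zs where zs: "W zs" "\<And>zs'. W zs' \<Longrightarrow> length zs \<le> length zs'"
    using ex_has_least_nat[of W w0 length, OF w0] by (elim exE conjE) simp
  have w: "zs \<noteq> []" "hd zs = u" "last zs = v" "set zs \<subseteq> S" "path_edges zs \<subseteq> H"
    using zs(1) unfolding W_def by auto
  have dist: "distinct zs"
  proof (rule ccontr)
    assume "\<not> distinct zs"
    then obtain ps qs rs y where d: "zs = ps @ [y] @ qs @ [y] @ rs" using not_distinct_decomp by blast
    have "W (ps @ y # rs)"
      unfolding W_def
    proof (intro conjI)
      show "hd (ps @ y # rs) = u" using w(2) d by (cases ps) auto
      show "last (ps @ y # rs) = v" using w(3) d by (cases rs) auto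
      show "set (ps @ y # rs) \<subseteq> S" using w(4) d by auto
      have "path_edges (ps @ [y]) \<subseteq> H" using w(5) d path_edges_split[of ps y "qs @ [y] @ rs"] by auto
      moreover have "path_edges (y # rs) \<subseteq> H" using w(5) d path_edges_split[of "ps @ [y] @ qs" y rs] by auto
      ultimately show "path_edges (ps @ y # rs) \<subseteq> H" using path_edges_split[of ps y rs] by auto
    qed simp
    then have "length zs \<le> length (ps @ y # rs)" using zs(2) by blast
    then show False using d by simp
  qed
  have ordered: "{a, b} \<in> path_edges zs" if "zs = ps @ a # qs @ b # rs" "{a, b} \<in> H" for a b ps qs rs
  proof (cases "qs = []")
    case True
    then show ?thesis using that(1) path_edges_split[of ps a "b # rs"] by auto
  next
    case False
    have "W (ps @ a # b # rs)"
      unfolding W_def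
    proof (intro conjI)
      show "hd (ps @ a # b # rs) = u" using w(2) that(1) by (cases ps) auto
      show "last (ps @ a # b # rs) = v" using w(3) that(1) by auto
      show "set (ps @ a # b # rs) \<subseteq> S" using w(4) that(1) by auto
      have "path_edges (ps @ [a]) \<subseteq> H" using w(5) that(1) path_edges_split[of ps a "qs @ b # rs"] by auto
      moreover have "path_edges (b # rs) \<subseteq> H" using w(5) that(1) path_edges_split[of "ps @ a # qs" b rs] by auto
      ultimately show "path_edges (ps @ a # b # rs) \<subseteq> H" using path_edges_split[of ps a "b # rs"] that(2) by auto
    qed simp
    then have "length zs \<le> length (ps @ a # b # rs)" using zs(2) by blast
    then show ?thesis using that(1) False by (cases qs) auto
  qed
  have "{a, b} \<in> path_edges zs" if ab: "a \<in> set zs" "b \<in> set zs" "a \<noteq> b" "{a, b} \<in> H" for a b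
  proof -
    obtain ps rs where d: "zs = ps @ a # rs" using ab(1) by (meson split_list)
    then consider "b \<in> set ps" | "b \<in> set rs" using ab by auto
    then show ?thesis
    proof cases
      case 1
      then obtain p1 p2 where "ps = p1 @ b # p2" by (meson split_list)
      then show ?thesis using ordered[of p1 b p2 a rs] d ab(4) by (simp add: insert_commute)
    next
      case 2
      then obtain r1 r2 where "rs = r1 @ b # r2" by (meson split_list)
      then show ?thesis using ordered[of ps a r1 b r2] d ab(4) by simp
    qed
  qed
  then show ?thesis using that[OF w(1-3) dist w(4,5)] by blast
qed

text \<open>A path ending in \<open>T\<close> is cut at its first vertex in
  \<open>T\<close>.\<close>

lemma path_to_set:
  assumes "(u, t) \<in> (adj S H)\<^sup>*" "u \<in> S" "t \<in> T"
  obtains ys where "ys \<noteq> []" "hd ys = u" "last ys \<in> T" "set ys \<inter> T = {last ys}" "distinct ys" "set ys \<subseteq> S" "path_edges ys \<subseteq> H"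
proof -
  obtain zs where zs: "zs \<noteq> []" "hd zs = u" "last zs = t" "distinct zs" "set zs \<subseteq> S" "path_edges zs \<subseteq> H"
    using shortest_path[OF assms(1,2)] by blast
  then have "\<exists>x\<in>set zs. x \<in> T" using assms(3) last_in_set by metis
  then obtain ps c rs where d: "zs = ps @ c # rs" "c \<in> T" "\<forall>y\<in>set ps. y \<notin> T"
    using split_list_first_prop[of zs "\<lambda>x. x \<in> T"] by blast
  show ?thesis
  proof (rule that[of "ps @ [c]"])
    show "hd (ps @ [c]) = u" using zs(2) d(1) by (cases ps) auto
    show "path_edges (ps @ [c]) \<subseteq> H" using zs(6) d(1) path_edges_split[of ps c rs] by auto
  qed (use zs d in auto)
qed

text \<open>\<open>as\<close> is a leg leaving a vertex of colour \<open>\<alpha>\<close>, and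
  \<open>y\<close> is a colour that its far end can receive. Conflicts with a vertex behind the far
  end are left to the user of the leg.\<close>

definition leg_end :: "('a \<Rightarrow> nat set) \<Rightarrow> nat \<Rightarrow> 'a list \<Rightarrow> nat \<Rightarrow> bool" where
  "leg_end M \<alpha> as y \<longleftrightarrow> (\<exists>f. (\<forall>x\<in>set as. f x \<in> M x) \<and> f (hd as) \<noteq> \<alpha> \<and> f (last as) = y \<and>
     (\<forall>a b. {a, b} \<in> path_edges as \<longrightarrow> f a \<noteq> f b))"

lemma leg_end_single: "c \<in> M a \<Longrightarrow> c \<noteq> \<alpha> \<Longrightarrow> leg_end M \<alpha> [a] c"
  unfolding leg_end_def by (intro exI[of _ "\<lambda>_. c"]) auto

lemma leg_end_Cons:
  assumes "c \<in> M a" "c \<noteq> \<alpha>" "leg_end M c as y" "as \<noteq> []" "a \<notin> set as"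
  shows "leg_end M \<alpha> (a # as) y"
proof -
  obtain f where f: "\<forall>x\<in>set as. f x \<in> M x" "f (hd as) \<noteq> c" "f (last as) = y"
    "\<And>a b. {a, b} \<in> path_edges as \<Longrightarrow> f a \<noteq> f b" using assms(3) unfolding leg_end_def by blast
  have ha: "hd as \<noteq> a" "last as \<noteq> a" using assms(4,5) hd_in_set last_in_set by metis+
  have "(f(a := c)) x \<noteq> (f(a := c)) y" if e: "{x, y} \<in> path_edges (a # as)" for x y
  proof (cases "{x, y} \<in> path_edges as")
    case True
    then have "x \<noteq> a" "y \<noteq> a" using path_edges_subset[OF True] assms(5) by auto
    then show ?thesis using f(4)[OF True] by simp
  next
    case False
    then have "{x, y} = {a, hd as}" using e path_edges_Cons[OF assms(4), of a] by auto
    then have "x = a \<and> y = hd as \<or> x = hd as \<and> y = a" by (auto simp: doubleton_eq_iff)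
    then show ?thesis using f(2) ha by auto
  qed
  then show ?thesis unfolding leg_end_def
    using f assms ha by (intro exI[of _ "f(a := c)"]) auto
qed

lemma two_element_choice: "card (M::nat set) \<ge> 2 \<Longrightarrow> \<exists>c\<in>M. c \<noteq> \<alpha>"
proof (rule ccontr)
  assume c: "card M \<ge> 2" "\<not> (\<exists>c\<in>M. c \<noteq> \<alpha>)"
  then have "card M \<le> card {\<alpha>}" by (intro card_mono) auto
  then show False using c by simp
qed

lemma leg_end_exists:
  assumes "as \<noteq> []" "distinct as" "\<And>x. x \<in> set as \<Longrightarrow> card (M x) \<ge> 2"
  shows "\<exists>y. leg_end M \<alpha> as y"
  using assms
proof (induction as arbitrary: \<alpha>)
  case (Cons a as)
  obtain c where c: "c \<in> M a" "c \<noteq> \<alpha>" using two_element_choice[of "M a" \<alpha>] Cons(4) by auto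
  show ?case
  proof (cases "as = []")
    case True then show ?thesis using leg_end_single[where M = M and a = a, OF c] by blast
  next
    case False
    then obtain y where "leg_end M c as y" using Cons(1)[OF False, of c] Cons(3,4) by auto
    then show ?thesis using leg_end_Cons[where M = M and a = a, OF c _ False] Cons(3) by auto
  qed
qed simp

text \<open>A leg determines its last colour under two different starting colours only if the first
  list is exactly \<open>{\<alpha>, \<beta>}\<close>. The leg then continues with the two colours
  exchanged, and so on up to its end.\<close>

lemma leg_end_forced:
  assumes "as \<noteq> []" "distinct as" "\<And>x. x \<in> set as \<Longrightarrow> card (M x) \<ge> 2" "\<alpha> \<noteq> \<beta>"
    and "\<And>z. leg_end M \<alpha> as z \<Longrightarrow> z = y" "\<And>z. leg_end M \<beta> as z \<Longrightarrow> z = y'"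
  shows "{y, y'} = {\<alpha>, \<beta>} \<and> y \<noteq> y'"
  using assms
proof (induction as arbitrary: \<alpha> \<beta> y y')
  case (Cons a as)
  have cM: "card (M a) \<ge> 2" using Cons(4) by simp
  show ?case
  proof (cases "as = []")
    case True
    have 1: "c = y" if "c \<in> M a" "c \<noteq> \<alpha>" for c using leg_end_single[where M = M and a = a, OF that] Cons(6) True by blast
    have 2: "c = y'" if "c \<in> M a" "c \<noteq> \<beta>" for c using leg_end_single[where M = M and a = a, OF that] Cons(7) True by blast
    obtain c d where "c \<in> M a" "c \<noteq> \<alpha>" "d \<in> M a" "d \<noteq> y" using two_element_choice[OF cM] by metis
    then show ?thesis using 1 2 Cons(5) two_element_choice[OF cM, of \<beta>] by auto
  next
    case False
    have d: "distinct as" "\<And>x. x \<in> set as \<Longrightarrow> card (M x) \<ge> 2" "a \<notin> set as" using Cons(3,4) by auto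
    have f1: "z = y" if "c \<in> M a" "c \<noteq> \<alpha>" "leg_end M c as z" for c z
      using leg_end_Cons[where M = M and a = a, OF that False d(3)] Cons(6) by blast
    have f2: "z = y'" if "c \<in> M a" "c \<noteq> \<beta>" "leg_end M c as z" for c z
      using leg_end_Cons[where M = M and a = a, OF that False d(3)] Cons(7) by blast
    \<comment> \<open>Two admissible colours at \<open>a\<close> would be two different starting
      colours of the shorter leg with the same forced end, which the induction hypothesis rules
      out.\<close>
    have u1: "c = d" if "c \<in> M a" "c \<noteq> \<alpha>" "d \<in> M a" "d \<noteq> \<alpha>" for c d
      using Cons(1)[OF False d(1,2), of c d y y] f1 that by blast
    have u2: "c = d" if "c \<in> M a" "c \<noteq> \<beta>" "d \<in> M a" "d \<noteq> \<beta>" for c d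
      using Cons(1)[OF False d(1,2), of c d y' y'] f2 that by blast
    obtain c where c: "c \<in> M a" "c \<noteq> \<alpha>" using two_element_choice[OF cM] by blast
    obtain d where d': "d \<in> M a" "d \<noteq> c" using two_element_choice[OF cM] by blast
    have "d = \<alpha>" using u1[OF c, of d] d' by blast
    then have aM: "\<alpha> \<in> M a" using d' by simp
    then have "c = \<beta>" using u2[of c \<alpha>] c Cons(5) by blast
    then have bM: "\<beta> \<in> M a" using c by simp
    have "{y, y'} = {\<beta>, \<alpha>} \<and> y \<noteq> y'"
      using Cons(1)[OF False d(1,2), of \<beta> \<alpha> y y'] f1[OF bM] f2[OF aM] Cons(5) by blast
    then show ?thesis by (simp add: insert_commute)
  qed
qed simp

context bad_lists
begin

lemma inner_vertex_two_nbrs: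
  assumes "path_edges (a # as @ [b]) \<subseteq> E" "distinct (a # as @ [b])" "x \<in> set as"
  shows "card (nbrs E x \<inter> set (a # as @ [b])) \<ge> 2"
proof -
  obtain ps qs where d: "as = ps @ x # qs" using assms(3) by (meson split_list)
  define l where "l = last (a # ps)"
  define r where "r = hd (qs @ [b])"
  have split: "a # as @ [b] = (a # ps) @ x # (qs @ [b])" using d by simp
  have "path_edges (a # as @ [b]) = path_edges (a # ps) \<union> path_edges (x # qs @ [b]) \<union> {{l, x}}"
    unfolding split l_def by (subst path_edges_append) auto
  then have "{l, x} \<in> E" using assms(1) by auto
  moreover have "{x, r} \<in> E"
    using assms(1) unfolding split path_edges_split[of "a # ps" x "qs @ [b]"] r_def
    by (cases qs) auto
  ultimately have "{l, r} \<subseteq> nbrs E x" unfolding nbrs_def by (auto simp: insert_commute)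
  moreover have lm: "l \<in> set (a # ps)" unfolding l_def using last_in_set by blast
  moreover have rm: "r \<in> set (qs @ [b])" unfolding r_def by (rule hd_in_set) simp
  moreover have "l \<noteq> r"
  proof -
    have "set (a # ps) \<inter> set (qs @ [b]) = {}" using assms(2) unfolding split by auto
    then show ?thesis using lm rm by blast
  qed
  ultimately have "{l, r} \<subseteq> nbrs E x \<inter> set (a # as @ [b])" unfolding split by auto
  then have "card {l, r} \<le> card (nbrs E x \<inter> set (a # as @ [b]))" by (intro card_mono) auto
  then show ?thesis using \<open>l \<noteq> r\<close> by simp
qed

text \<open>After the rest is coloured, the inner vertices of the legs and \<open>v\<close> keep at
  least two colours, \<open>u\<close> at least three. If a colour \<open>\<alpha>\<close> at
  \<open>v\<close> cannot be completed, then \<open>\<alpha>\<close> and the end colours of the two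
  legs fill the list of \<open>u\<close>; so each leg has only one end colour for each of two
  colours at \<open>v\<close>. By \<open>leg_end_forced\<close> both legs end in the same colour,
  although the three colours at \<open>u\<close> must be distinct.\<close>

lemma theta_reducible:
  assumes ne: "as \<noteq> []" "bs \<noteq> []" and dist: "distinct (v # as @ [u])" "distinct (v # bs @ [u])" "set as \<inter> set bs = {}"
    and E: "path_edges (v # as @ [u]) \<subseteq> E" "path_edges (v # bs @ [u]) \<subseteq> E" "{u, v} \<in> E"
    and deg: "\<And>x. x \<in> set as \<union> set bs \<union> {u} \<Longrightarrow> card (nbrs E x) \<le> 4" "card (nbrs E v) \<le> 5"
    and ind: "induced E ({u, v} \<union> set as \<union> set bs) \<subseteq>
      path_edges (v # as @ [u]) \<union> path_edges (v # bs @ [u]) \<union> {{u, v}}"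
  shows False
proof -
  define X where "X = {u, v} \<union> set as \<union> set bs"
  have pe: "path_edges (v # cs @ [u]) = {{v, hd cs}} \<union> path_edges cs \<union> {{last cs, u}}" if "cs \<noteq> []" for cs
    using path_edges_Cons[of "cs @ [u]" v] path_edges_append[OF that, of "[u]"] that by auto
  have XV: "X \<subseteq> V"
  proof -
    have "x \<in> V" if "x \<in> set (v # cs @ [u])" "path_edges (v # cs @ [u]) \<subseteq> E" for x cs
    proof -
      have "\<exists>e \<in> path_edges (v # cs @ [u]). x \<in> e"
        by (rule path_vertex_on_edge) (use that in auto)
      then show ?thesis using that(2) edge_subset by blast
    qed
    then show ?thesis unfolding X_def using E(1,2) by auto
  qed
  obtain c0 where c0: "proper L (V - X) (induced E (V - X)) c0"
    using induced_colourable[of "V - X"] XV unfolding X_def by blast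
  define M where "M x = L x - c0 ` (nbrs E x - X)" for x
  have Mge: "card (nbrs E x \<inter> X) + 4 \<le> card (M x) + card (nbrs E x)" if "x \<in> X" for x
    unfolding M_def using remaining_list[of x X c0] XV that by blast
  have finM: "finite (M x)" if "x \<in> X" for x unfolding M_def using lists XV that by blast
  have finX: "finite X" unfolding X_def by simp
  have leg: "card (M x) \<ge> 2" if "x \<in> set cs" "cs = as \<or> cs = bs" for x cs
  proof -
    have "card (nbrs E x \<inter> set (v # cs @ [u])) \<ge> 2"
      using inner_vertex_two_nbrs[of v cs u x] that E dist by blast
    moreover have "card (nbrs E x \<inter> set (v # cs @ [u])) \<le> card (nbrs E x \<inter> X)"
      by (rule card_mono) (use finX that in \<open>auto simp: X_def\<close>)
    moreover have "card (nbrs E x) \<le> 4" "x \<in> X" using deg(1)[of x] that unfolding X_def by auto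
    ultimately show ?thesis using Mge[of x] by linarith
  qed
  have hl: "hd as \<in> set as" "last as \<in> set as" "hd bs \<in> set bs" "last bs \<in> set bs" using ne by auto
  have edges: "{v, hd as} \<in> E" "{last as, u} \<in> E" "{v, hd bs} \<in> E" "{last bs, u} \<in> E"
    using E pe[OF ne(1)] pe[OF ne(2)] by auto
  have uv: "u \<noteq> v" "u \<notin> set as" "u \<notin> set bs" "v \<notin> set as" "v \<notin> set bs" using dist by auto
  have three_nbrs: "card (nbrs E x \<inter> X) \<ge> 3"
    if "{a, b, c} \<subseteq> nbrs E x \<inter> X" "a \<noteq> b" "a \<noteq> c" "b \<noteq> c" for x a b c
    using card_mono[OF _ that(1)] finX that(2-4) by simp
  have ne_ends: "hd as \<noteq> hd bs" "last as \<noteq> last bs" "u \<noteq> hd as" "u \<noteq> hd bs" "v \<noteq> last as" "v \<noteq> last bs"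
    using uv hl dist(3) by auto
  \<comment> \<open>Three neighbours inside the theta graph leave at most two outside for
    \<open>v\<close>, of degree at most five, and at most one for \<open>u\<close>, of degree at
    most four. This gives two and three remaining colours.\<close>
  have "{u, hd as, hd bs} \<subseteq> nbrs E v \<inter> X"
    using edges E(3) hl unfolding nbrs_def X_def by (auto simp: insert_commute)
  then have Mv: "card (M v) \<ge> 2"
    using three_nbrs[of u "hd as" "hd bs" v] ne_ends Mge[of v] deg(2) unfolding X_def by simp
  have "{v, last as, last bs} \<subseteq> nbrs E u \<inter> X"
    using edges E(3) hl unfolding nbrs_def X_def by (auto simp: insert_commute)
  then have Mu: "card (M u) \<ge> 3"
    using three_nbrs[of v "last as" "last bs" u] ne_ends Mge[of u] deg(1)[of u] unfolding X_def by simp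
  have sub: "M u \<subseteq> {\<alpha>, y, z}" if \<alpha>: "\<alpha> \<in> M v" and y: "leg_end M \<alpha> as y" and z: "leg_end M \<alpha> bs z" for \<alpha> y z
  proof
    fix k assume k: "k \<in> M u"
    show "k \<in> {\<alpha>, y, z}"
    proof (rule ccontr)
      assume nk: "k \<notin> {\<alpha>, y, z}"
      obtain f where f: "\<forall>x\<in>set as. f x \<in> M x" "f (hd as) \<noteq> \<alpha>" "f (last as) = y"
        "\<And>a b. {a, b} \<in> path_edges as \<Longrightarrow> f a \<noteq> f b" using y unfolding leg_end_def by blast
      obtain g where g: "\<forall>x\<in>set bs. g x \<in> M x" "g (hd bs) \<noteq> \<alpha>" "g (last bs) = z"
        "\<And>a b. {a, b} \<in> path_edges bs \<Longrightarrow> g a \<noteq> g b" using z unfolding leg_end_def by blast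
      define c where "c x = (if x = u then k else if x = v then \<alpha> else if x \<in> set as then f x else g x)" for x
      have cas: "c x = f x" if "x \<in> set as" for x using that uv unfolding c_def by auto
      have cbs: "c x = g x" if "x \<in> set bs" for x using that uv dist(3) unfolding c_def by auto
      have cuv: "c u = k" "c v = \<alpha>" using uv unfolding c_def by auto
      have "proper M X (induced E X) c" unfolding proper_def
      proof (intro conjI ballI allI impI)
        fix x assume "x \<in> X"
        then show "c x \<in> M x" using k \<alpha> f(1) g(1) cas cbs cuv unfolding X_def by auto
      next
        fix a b assume ab: "{a, b} \<in> induced E X"
        define s where "s = {a, b}"
        have "s \<in> path_edges (v # as @ [u]) \<union> path_edges (v # bs @ [u]) \<union> {{u, v}}"
          using ind ab unfolding X_def s_def by (rule subsetD)
        then consider "s = {v, hd as}" | "s \<in> path_edges as" | "s = {last as, u}"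
          | "s = {v, hd bs}" | "s \<in> path_edges bs" | "s = {last bs, u}" | "s = {u, v}"
          unfolding pe[OF ne(1)] pe[OF ne(2)] by blast
        then show "c a \<noteq> c b"
        proof cases
          case 1 then show ?thesis using f(2) cas[OF hl(1)] cuv by (auto simp: s_def doubleton_eq_iff)
        next
          case 2
          then have "a \<in> set as" "b \<in> set as" using path_edges_subset[OF 2] unfolding s_def by auto
          then show ?thesis using f(4)[OF 2[unfolded s_def]] cas by simp
        next
          case 3 then show ?thesis using f(3) cas[OF hl(2)] cuv nk by (auto simp: s_def doubleton_eq_iff)
        next
          case 4 then show ?thesis using g(2) cbs[OF hl(3)] cuv by (auto simp: s_def doubleton_eq_iff)
        next
          case 5
          then have "a \<in> set bs" "b \<in> set bs" using path_edges_subset[OF 5] unfolding s_def by auto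
          then show ?thesis using g(4)[OF 5[unfolded s_def]] cbs by simp
        next
          case 6 then show ?thesis using g(3) cbs[OF hl(4)] cuv nk by (auto simp: s_def doubleton_eq_iff)
        next
          case 7 then show ?thesis using cuv nk by (auto simp: s_def doubleton_eq_iff)
        qed
      qed
      then show False using no_extension[OF c0 _ XV] unfolding M_def by blast
    qed
  qed
  have three: "M u = {\<alpha>, y, z} \<and> \<alpha> \<noteq> y \<and> \<alpha> \<noteq> z \<and> y \<noteq> z"
    if "\<alpha> \<in> M v" "leg_end M \<alpha> as y" "leg_end M \<alpha> bs z" for \<alpha> y z
  proof -
    have s: "M u \<subseteq> {\<alpha>, y, z}" by (rule sub[OF that])
    have "card (M u) \<le> card {\<alpha>, y, z}" by (rule card_mono[OF _ s]) simp
    then have c3: "card {\<alpha>, y, z} \<ge> 3" using Mu by simp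
    then have "\<alpha> \<noteq> y \<and> \<alpha> \<noteq> z \<and> y \<noteq> z" by (auto simp: card_insert_if split: if_splits)
    moreover from this have "card {\<alpha>, y, z} = 3" by simp
    then have "M u = {\<alpha>, y, z}" using s Mu by (intro card_seteq) auto
    ultimately show ?thesis by blast
  qed
  \<comment> \<open>The colour 0 to be avoided is a dummy: any element of the list will do.\<close>
  obtain \<alpha> where \<alpha>: "\<alpha> \<in> M v" using Mv two_element_choice[of "M v" 0] by blast
  obtain \<beta> where \<beta>: "\<beta> \<in> M v" "\<beta> \<noteq> \<alpha>" using Mv two_element_choice[of "M v" \<alpha>] by blast
  have da: "distinct as" "distinct bs" using dist by auto
  have la: "\<And>x. x \<in> set as \<Longrightarrow> card (M x) \<ge> 2" and lb: "\<And>x. x \<in> set bs \<Longrightarrow> card (M x) \<ge> 2" using leg by blast+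
  have ex: "\<exists>y. leg_end M \<kappa> as y" "\<exists>y. leg_end M \<kappa> bs y" for \<kappa>
    using leg_end_exists[OF ne(1) da(1), of M] leg_end_exists[OF ne(2) da(2), of M] la lb by blast+
  obtain y1 z1 y2 z2 where y1: "leg_end M \<alpha> as y1" and z1: "leg_end M \<alpha> bs z1"
    and y2: "leg_end M \<beta> as y2" and z2: "leg_end M \<beta> bs z2" using ex by blast
  note t1 = three[OF \<alpha> y1 z1] and t2 = three[OF \<beta>(1) y2 z2]
  have "{y1, y2} = {\<alpha>, \<beta>} \<and> y1 \<noteq> y2"
  proof (rule leg_end_forced[OF ne(1) da(1) la])
    show "\<alpha> \<noteq> \<beta>" using \<beta> by simp
    fix z show "leg_end M \<alpha> as z \<Longrightarrow> z = y1" using three[OF \<alpha> _ z1, of z] t1 by auto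
    show "leg_end M \<beta> as z \<Longrightarrow> z = y2" using three[OF \<beta>(1) _ z2, of z] t2 by auto
  qed
  moreover have "{z1, z2} = {\<alpha>, \<beta>} \<and> z1 \<noteq> z2"
  proof (rule leg_end_forced[OF ne(2) da(2) lb])
    show "\<alpha> \<noteq> \<beta>" using \<beta> by simp
    fix z show "leg_end M \<alpha> bs z \<Longrightarrow> z = z1" using three[OF \<alpha> y1, of z] t1 by auto
    show "leg_end M \<beta> bs z \<Longrightarrow> z = z2" using three[OF \<beta>(1) y2, of z] t2 by auto
  qed
  ultimately have "y1 = \<beta>" "z1 = \<beta>" using t1 by (auto simp: doubleton_eq_iff)
  then show False using t1 by simp
qed

end

section \<open>Faces with one vertex of large degree\<close>

locale bad_plane_graph = plane_graph V E p \<gamma> + crit: bad_lists V E L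
  for V :: "'a set" and E :: "'a set set" and p :: "'a \<Rightarrow> complex"
    and \<gamma> :: "'a set \<Rightarrow> real \<Rightarrow> complex" and L :: "'a \<Rightarrow> nat set"
begin

lemma borders_vertex: "borders F e \<Longrightarrow> w \<in> e \<Longrightarrow> p w \<in> frontier F"
  unfolding borders_def using edge_image by blast

text \<open>The one chord allowed is \<open>{u, v}\<close>: it will be the edge bordered by the face
  around which the path runs.\<close>

definition chordless :: "'a \<Rightarrow> 'a list \<Rightarrow> 'a \<Rightarrow> bool" where
  "chordless u as v \<longleftrightarrow> as \<noteq> [] \<and> distinct (u # as @ [v]) \<and> path_edges (u # as @ [v]) \<subseteq> E \<and>
    (\<forall>a\<in>set (u # as @ [v]). \<forall>b\<in>set (u # as @ [v]). a \<noteq> b \<longrightarrow> {a, b} \<in> E \<longrightarrow>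
      {a, b} \<in> path_edges (u # as @ [v]) \<union> {{u, v}})"

lemma chordlessD:
  assumes "chordless u as v"
  shows "as \<noteq> []" "distinct (u # as @ [v])" "path_edges (u # as @ [v]) \<subseteq> E"
    "\<And>a b. \<lbrakk>a \<in> set (u # as @ [v]); b \<in> set (u # as @ [v]); a \<noteq> b; {a, b} \<in> E\<rbrakk>
      \<Longrightarrow> {a, b} \<in> path_edges (u # as @ [v]) \<union> {{u, v}}"
proof -
  note c = assms[unfolded chordless_def]
  show "as \<noteq> []" "distinct (u # as @ [v])" "path_edges (u # as @ [v]) \<subseteq> E"
    using c by blast+
  fix a b assume "a \<in> set (u # as @ [v])" "b \<in> set (u # as @ [v])" "a \<noteq> b" "{a, b} \<in> E"
  then show "{a, b} \<in> path_edges (u # as @ [v]) \<union> {{u, v}}"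
    using c[THEN conjunct2, THEN conjunct2, THEN conjunct2] by (meson bspec)
qed

text \<open>The edge \<open>{u, v}\<close> is removed before a shortest path is taken in the graph
  induced on the frontier vertices, so that the path has an inner vertex and no chord other than
  this edge.\<close>

lemma boundary_path:
  assumes b: "borders F1 {u, v}" "borders F2 {u, v}" "F1 \<noteq> F2"
  obtains as where "chordless u as v" "\<And>x. x \<in> set as \<Longrightarrow> x \<in> V \<and> p x \<in> frontier F1"
proof -
  define S where "S = {w \<in> V. p w \<in> frontier F1}"
  have uvE: "{u, v} \<in> E" using b(1) unfolding borders_def by simp
  have uv: "u \<noteq> v" using uvE no_loop by auto
  have uS: "u \<in> S" unfolding S_def using borders_vertex[OF b(1)] edge_subset[OF uvE] by auto
  have rt: "(u, v) \<in> (adj S (E - {{u, v}}))\<^sup>*" unfolding S_def by (rule boundary_edge_on_cycle[OF b])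
  obtain zs where zs: "zs \<noteq> []" "hd zs = u" "last zs = v" "distinct zs" "set zs \<subseteq> S" "path_edges zs \<subseteq> E - {{u, v}}"
    "\<And>a b. \<lbrakk>a \<in> set zs; b \<in> set zs; a \<noteq> b; {a, b} \<in> E - {{u, v}}\<rbrakk> \<Longrightarrow> {a, b} \<in> path_edges zs"
    by (rule shortest_path[OF rt uS]) (rule that)
  obtain ys where ys: "zs = u # ys" using zs(1,2) by (cases zs) auto
  have yne: "ys \<noteq> []" using zs(3) ys uv by auto
  define as where "as = butlast ys"
  have zs_eq: "zs = u # as @ [v]" unfolding as_def using ys yne zs(3) by (metis append_butlast_last_id last_ConsR)
  have "as \<noteq> []"
  proof
    assume "as = []"
    then have "path_edges zs = {{u, v}}" using zs_eq by simp
    then show False using zs(6) by blast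
  qed
  moreover have "{a, b} \<in> path_edges zs \<union> {{u, v}}"
    if "a \<in> set zs" "b \<in> set zs" "a \<noteq> b" "{a, b} \<in> E" for a b
    using zs(7)[OF that(1-3)] that(4) by blast
  moreover have "path_edges zs \<subseteq> E" using zs(6) by blast
  ultimately have "chordless u as v" unfolding chordless_def zs_eq[symmetric] using zs(4) by blast
  moreover have "x \<in> V \<and> p x \<in> frontier F1" if "x \<in> set as" for x
    using zs(5) that unfolding zs_eq S_def by auto
  ultimately show ?thesis using that by blast
qed

lemma path_edges_butlast: "path_edges (u # as) \<subseteq> path_edges (u # as @ [v])"
  using path_edges_append[of "u # as" "[v]"] by auto

lemma nbrs_on_chordless_path:
  assumes "chordless u as v" and x: "x \<in> nbrs E u" "x \<in> set as"
  shows "x = hd as"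
proof -
  note assms = chordlessD(2,1,4)[OF assms(1)]
  have ne: "u \<noteq> x" "x \<noteq> v" "u \<noteq> v" using assms(1) x(2) by auto
  have "{u, x} \<in> path_edges (u # as @ [v]) \<union> {{u, v}}"
    using assms(3)[of u x] x ne unfolding nbrs_def by simp
  then have "{u, x} \<in> path_edges (u # as @ [v])" using ne by (auto simp: doubleton_eq_iff)
  then have "x = hd (as @ [v])" using path_edges_first[of u "as @ [v]" x] assms(1) by simp
  then show ?thesis using assms(2) by simp
qed

lemma no_two_bad_faces:
  assumes b: "borders F1 {u, v}" "borders F2 {u, v}" "F1 \<noteq> F2"
    and deg: "\<And>F w. \<lbrakk>F = F1 \<or> F = F2; w \<in> V; w \<noteq> v; p w \<in> frontier F\<rbrakk> \<Longrightarrow> card (nbrs E w) \<le> 4"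
      "card (nbrs E v) \<le> 5"
  shows False
proof -
  have uvE: "{u, v} \<in> E" using b(1) unfolding borders_def by simp
  then have uvV: "u \<in> V" "v \<in> V" "u \<noteq> v" using edge_subset no_loop by auto
  obtain as where cas: "chordless u as v" and as3: "\<And>x. x \<in> set as \<Longrightarrow> x \<in> V \<and> p x \<in> frontier F1"
    by (rule boundary_path[OF b]) (rule that)
  note as = chordlessD(1,2)[OF cas] as3 chordlessD(3,4)[OF cas]
  obtain bs where cbs: "chordless u bs v" and bs3: "\<And>x. x \<in> set bs \<Longrightarrow> x \<in> V \<and> p x \<in> frontier F2"
    by (rule boundary_path[OF b(2,1) b(3)[symmetric]]) (rule that)
  note bs = chordlessD(1,2)[OF cbs] bs3 chordlessD(3,4)[OF cbs]
  define D where "D = insert u (set as \<union> set bs)"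
  have notin: "u \<notin> set as" "u \<notin> set bs" "v \<notin> set as" "v \<notin> set bs" "v \<notin> D"
    using as(2) bs(2) uvV(3) unfolding D_def by auto
  have DV: "D \<subseteq> V" unfolding D_def using as(3) bs(3) uvV by blast
  have degD: "card (nbrs E x) \<le> 4" if "x \<in> D" for x
  proof -
    have "x \<noteq> v" using that notin(5) by blast
    moreover have "p x \<in> frontier F1 \<or> p x \<in> frontier F2"
      using that as(3) bs(3) borders_vertex[OF b(1), of u] unfolding D_def by blast
    ultimately show ?thesis using deg(1) that DV by blast
  qed
  show False
  proof (cases "set as \<inter> set bs = {} \<and> (\<forall>x\<in>set as. \<forall>y\<in>set bs. {x, y} \<notin> E)")
    case True
    \<comment> \<open>The legs of the theta graph are read from \<open>v\<close> to
      \<open>u\<close>, hence the reversed paths.\<close>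
    have pr: "path_edges (v # rev cs @ [u]) = path_edges (u # cs @ [v])" for cs
      using path_edges_rev[of "u # cs @ [v]"] by simp
    show False
    proof (rule crit.theta_reducible[of "rev as" "rev bs" v u])
      show "induced E ({u, v} \<union> set (rev as) \<union> set (rev bs))
        \<subseteq> path_edges (v # rev as @ [u]) \<union> path_edges (v # rev bs @ [u]) \<union> {{u, v}}"
        unfolding pr
      proof
        fix e assume e: "e \<in> induced E ({u, v} \<union> set (rev as) \<union> set (rev bs))"
        then have eE: "e \<in> E" and eX: "e \<subseteq> {u, v} \<union> set as \<union> set bs" unfolding induced_def by auto
        obtain x y where xy: "e = {x, y}" "x \<noteq> y" using edge_card[OF eE] by (meson card_2_iff)
        have xyE: "{x, y} \<in> E" "{y, x} \<in> E" using eE xy by (auto simp: insert_commute)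
        have "\<not> (x \<in> set as \<and> y \<in> set bs)" "\<not> (y \<in> set as \<and> x \<in> set bs)" using True xyE by blast+
        then have "{x, y} \<subseteq> set (u # as @ [v]) \<or> {x, y} \<subseteq> set (u # bs @ [v])" using eX xy by auto
        then have "{x, y} \<in> path_edges (u # as @ [v]) \<union> {{u, v}} \<or> {x, y} \<in> path_edges (u # bs @ [v]) \<union> {{u, v}}"
          using as(5)[OF _ _ xy(2) xyE(1)] bs(5)[OF _ _ xy(2) xyE(1)] by blast
        then show "e \<in> path_edges (u # as @ [v]) \<union> path_edges (u # bs @ [v]) \<union> {{u, v}}"
          unfolding xy(1) by auto
      qed
      show "path_edges (v # rev as @ [u]) \<subseteq> E" "path_edges (v # rev bs @ [u]) \<subseteq> E"
        unfolding pr by (fact as(4), fact bs(4))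
      show "\<And>x. x \<in> set (rev as) \<union> set (rev bs) \<union> {u} \<Longrightarrow> card (nbrs E x) \<le> 4"
        using degD unfolding D_def by auto
    qed (use as(1,2) bs(1,2) True uvE deg(2) in auto)
  next
    case False
    \<comment> \<open>A connected piece on the two paths which touches both faces: a common vertex,
      or an edge joining the paths. It obstructs every cycle through \<open>{u, v}\<close> that
      avoids the paths.\<close>
    obtain Z H z1 z2 where Z: "subgraph Z H" "connected (drawing Z H)" "Z \<subseteq> set as \<union> set bs"
      "z1 \<in> Z" "z2 \<in> Z" "p z1 \<in> frontier F1" "p z2 \<in> frontier F2"
    proof (cases "set as \<inter> set bs = {}")
      case True
      then obtain x y where xy: "x \<in> set as" "y \<in> set bs" "{x, y} \<in> E" using False by blast
      show ?thesis
      proof (rule that[of "{x, y}" "{{x, y}}" x y])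
        show "connected (drawing {x, y} {{x, y}})"
          unfolding drawing_edge[OF xy(3)] using edge_arc[OF xy(3)] by (simp add: connected_arc_image)
      qed (use xy as(3) bs(3) subgraph_edge[OF xy(3)] in auto)
    next
      case F: False
      then obtain z where z: "z \<in> set as" "z \<in> set bs" by blast
      show ?thesis
        by (rule that[of "{z}" "{}" z z]) (use z as(3) bs(3) in \<open>auto simp: subgraph_def drawing_def\<close>)
    qed
    define W where "W = {x. (v, x) \<in> (adj (V - D) E)\<^sup>*}"
    define I where "I = V - D - W"
    have vVD: "v \<in> V - D" using uvV notin by blast
    have WV: "W \<subseteq> V - D"
    proof
      fix w assume "w \<in> W"
      then have "(v, w) \<in> (adj (V - D) E)\<^sup>*" unfolding W_def by simp
      then show "w \<in> V - D" by (cases rule: rtranclE) (use vVD in \<open>auto simp: adj_def\<close>)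
    qed
    have nsub: "nbrs E u \<inter> (D \<union> {v}) \<subseteq> {v, hd as, hd bs}"
    proof
      fix x assume x: "x \<in> nbrs E u \<inter> (D \<union> {v})"
      have "x \<noteq> u" using x nbrs_facts(3)[OF graph, of u] by blast
      then consider "x = v" | "x \<in> set as" | "x \<in> set bs" using x unfolding D_def by blast
      then show "x \<in> {v, hd as, hd bs}"
      proof cases
        case 2 then show ?thesis using nbrs_on_chordless_path[OF cas] x by blast
      next
        case 3 then show ?thesis using nbrs_on_chordless_path[OF cbs] x by blast
      qed simp
    qed
    \<comment> \<open>\<open>u\<close> has degree at least four, while chordlessness leaves only
      \<open>v\<close> and the first vertices of the two paths as its neighbours inside
      \<open>D \<union> {v}\<close>.\<close>
    have "\<exists>r. r \<in> nbrs E u \<and> r \<notin> D \<union> {v}"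
    proof (rule ccontr)
      assume "\<not> ?thesis"
      then have "nbrs E u \<subseteq> {v, hd as, hd bs}" using nsub by blast
      then have "card (nbrs E u) \<le> card {v, hd as, hd bs}" by (intro card_mono) auto
      also have "\<dots> \<le> 3" by (simp add: card_insert_if)
      finally show False using crit.min_degree[OF uvV(1)] by simp
    qed
    then obtain r where r: "r \<in> nbrs E u" "r \<notin> D" "r \<noteq> v" by blast
    have rV: "r \<in> V - D" using r nbrs_facts(1)[OF graph, of u] by blast
    have urE: "{u, r} \<in> E" using r unfolding nbrs_def by simp
    \<comment> \<open>A path from \<open>r\<close> to \<open>v\<close> off \<open>D\<close> would
      close up with \<open>u\<close> to a cycle through \<open>{u, v}\<close>; it would separate the
      two faces, although \<open>Z\<close> joins their frontiers off the cycle.\<close>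
    have "r \<notin> W"
    proof
      assume "r \<in> W"
      then have rt: "(r, v) \<in> (adj (V - D) E)\<^sup>*" unfolding W_def by (simp add: adj_rtrancl_sym)
      obtain ws where ws: "ws \<noteq> []" "hd ws = r" "last ws = v" "distinct ws" "set ws \<subseteq> V - D" "path_edges ws \<subseteq> E"
        using shortest_path[OF rt rV] by metis
      have len: "length ws \<ge> 2" using ws(1-3) r(3) by (cases ws; cases "tl ws") auto
      have c: "gcycle (u # ws)"
        unfolding gcycle_def gpath_def path_edges_Cons[OF ws(1)] ws(2)
        using ws len uvV urE uvE DV unfolding D_def by (auto simp: insert_commute)
      have cl: "closing (u # ws) = {u, v}" using ws by (auto simp: insert_commute)
      have "Z \<inter> set (u # ws) = {}" using Z(3) ws(5) notin unfolding D_def by auto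
      then have "drawing Z H \<inter> cycle_image (u # ws) = {}"
        unfolding cycle_image_def by (rule drawing_disjoint[OF Z(1) gcycle_subgraph[OF c]])
      moreover have "p z1 \<in> drawing Z H" "p z2 \<in> drawing Z H" using Z(4,5) unfolding drawing_def by auto
      ultimately show False
        using cycle_separates_faces[OF c _ _ b(3) Z(2)] b(1,2) Z(6,7) unfolding cl by blast
    qed
    then have rI: "r \<in> I" using rV unfolding I_def by blast
    have vW: "v \<in> W" unfolding W_def by simp
    show False
    proof (rule crit.reducible_separator[OF DV _ _ degD _ _ _ rI urE vW uvE])
      show "u \<in> D" unfolding D_def by simp
      show "(u, x) \<in> (adj D E)\<^sup>*" if x: "x \<in> D" for x
      proof -
        consider "x \<in> set (u # as)" | "x \<in> set (u # bs)" using x unfolding D_def by auto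
        then show ?thesis
        proof cases
          case 1
          show ?thesis
            by (rule path_adj_rtrancl[OF _ _ 1]) (use path_edges_butlast[of u as v] as(4) in \<open>auto simp: D_def\<close>)
        next
          case 2
          show ?thesis
            by (rule path_adj_rtrancl[OF _ _ 2]) (use path_edges_butlast[of u bs v] bs(4) in \<open>auto simp: D_def\<close>)
        qed
      qed
      show "V - D = I \<union> W" "I \<inter> W = {}" unfolding I_def using WV by blast+
      show "{a, c} \<notin> E" if ac: "a \<in> I" "c \<in> W" for a c
      proof
        assume "{a, c} \<in> E"
        then have "(c, a) \<in> adj (V - D) E" using ac WV unfolding adj_def I_def by (auto simp: insert_commute)
        then have "a \<in> W" using ac(2) unfolding W_def by (auto intro: rtrancl_into_rtrancl)
        then show False using ac(1) unfolding I_def by blast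
      qed
    qed
  qed
qed

section \<open>Components of the graph without \<open>v\<close>\<close>

abbreviation linked :: "'a \<Rightarrow> 'a \<Rightarrow> 'a \<Rightarrow> bool" where
  "linked v a b \<equiv> (a, b) \<in> (adj (V - {v}) E)\<^sup>*"

lemma linked_in: "linked v a b \<Longrightarrow> a \<in> V - {v} \<Longrightarrow> b \<in> V - {v}"
  by (erule rtranclE) (auto simp: adj_def)

lemma nbr_facts: assumes "u \<in> nbrs E v" shows "u \<in> V - {v}" "{v, u} \<in> E" "{u, v} \<in> E"
  using assms nbrs_facts(1,3)[OF graph, of v] unfolding nbrs_def by (auto simp: insert_commute)

lemma link_edge:
  assumes "linked v u a" "u \<in> V - {v}" "{a, b} \<in> E" "b \<noteq> v" shows "linked v u b"
proof -
  have "a \<in> V - {v}" using linked_in[OF assms(1,2)] .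
  moreover have "b \<in> V" using edge_subset[OF assms(3)] by simp
  ultimately have "(a, b) \<in> adj (V - {v}) E" using assms(3,4) unfolding adj_def by auto
  then show ?thesis using assms(1) by (rule rtrancl_into_rtrancl[rotated])
qed

text \<open>Otherwise \<open>{u, v}\<close> would be a bridge.\<close>

lemma linked_nbr_exists:
  assumes u: "u \<in> nbrs E v"
  obtains w where "w \<in> nbrs E v" "w \<noteq> u" "linked v u w"
proof -
  define A where "A = {x. linked v u x}"
  note nf = nbr_facts[OF u]
  have AV: "A \<subseteq> V - {v}" unfolding A_def using linked_in[OF _ nf(1)] by blast
  have "\<exists>w \<in> nbrs E v. w \<noteq> u \<and> linked v u w"
  proof (rule ccontr)
    assume neg: "\<not> ?thesis"
    show False
    proof (rule crit.no_bridge[OF nf(3)])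
      show "A \<subseteq> V" "v \<notin> A" using AV by blast+
      show "u \<in> A" unfolding A_def by simp
      fix a b assume ab: "a \<in> A" "b \<in> V - A" "{a, b} \<in> E"
      have "b = v"
      proof (rule ccontr)
        assume "b \<noteq> v"
        then have "b \<in> A" using link_edge[OF _ nf(1) ab(3)] ab(1) unfolding A_def by blast
        then show False using ab(2) by blast
      qed
      moreover have "a \<in> nbrs E v" using ab(3) \<open>b = v\<close> unfolding nbrs_def by (simp add: insert_commute)
      ultimately show "a = u \<and> b = v" using neg ab(1) unfolding A_def by blast
    qed
  qed
  then show ?thesis using that by blast
qed

lemma link_path:
  assumes u: "u \<in> V - {v}" and l: "linked v u w"
  obtains xs where "gpath xs" "xs \<noteq> []" "hd xs = u" "last xs = w" "v \<notin> set xs" "\<And>x. x \<in> set xs \<Longrightarrow> linked v u x"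
proof -
  obtain xs where xs: "xs \<noteq> []" "hd xs = u" "last xs = w" "distinct xs" "set xs \<subseteq> V - {v}" "path_edges xs \<subseteq> E"
    using shortest_path[OF l u] by metis
  obtain ys where ys: "xs = u # ys" using xs(1,2) by (cases xs) auto
  have "linked v u x" if "x \<in> set xs" for x
    using path_adj_rtrancl[of u ys E "V - {v}" x] xs(5,6) that unfolding ys by blast
  moreover have "gpath xs" unfolding gpath_def using xs by blast
  ultimately show ?thesis using that xs by blast
qed

lemma link_cycle:
  assumes u: "u \<in> nbrs E v" and w: "w \<in> nbrs E v" "w \<noteq> u" and l: "linked v u w"
  obtains xs where "gcycle (xs @ [v])" "closing (xs @ [v]) = {v, u}" "v \<notin> set xs" "\<And>x. x \<in> set xs \<Longrightarrow> linked v u x"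
proof -
  note nu = nbr_facts[OF u] and nw = nbr_facts[OF w(1)]
  obtain xs where xs: "gpath xs" "xs \<noteq> []" "hd xs = u" "last xs = w" "v \<notin> set xs" "\<And>x. x \<in> set xs \<Longrightarrow> linked v u x"
    by (rule link_path[OF nu(1) l]) (rule that)
  have len: "length xs \<ge> 2" using xs(2-4) w(2) by (cases xs; cases "tl xs") auto
  have vV: "v \<in> V" using edge_subset[OF nu(2)] by simp
  have "path_edges (xs @ [v]) = path_edges xs \<union> {{w, v}}" using path_edges_append[OF xs(2), of "[v]"] xs(4) by simp
  then have "gcycle (xs @ [v])"
    unfolding gcycle_def using xs(1-3,5) len vV nu nw unfolding gpath_def by auto
  moreover have "closing (xs @ [v]) = {v, u}" using xs(2,3) by simp
  ultimately show ?thesis using that xs(5,6) by blast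
qed

text \<open>The witness differs from \<open>v\<close> because \<open>v\<close> itself counts as the
  first vertex of large degree.\<close>

definition good_face :: "'a \<Rightarrow> complex set \<Rightarrow> bool" where
  "good_face v F \<longleftrightarrow> (\<exists>w\<in>V. w \<noteq> v \<and> p w \<in> frontier F \<and> card (nbrs E w) \<ge> 5)"

text \<open>As the edge is no bridge, some cycle passes through it and has a bordering face on each
  side; these two faces are different and cannot both be bad.\<close>

lemma good_bordering_face:
  assumes u: "u \<in> nbrs E v" and deg: "card (nbrs E v) \<le> 5"
  obtains F where "borders F {v, u}" "good_face v F"
proof -
  obtain w where w: "w \<in> nbrs E v" "w \<noteq> u" "linked v u w" using linked_nbr_exists[OF u] .
  obtain xs where xs: "gcycle (xs @ [v])" "closing (xs @ [v]) = {v, u}"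
    using link_cycle[OF u w] by metis
  define A B where "A = inside (cycle_image (xs @ [v]))" and "B = outside (cycle_image (xs @ [v]))"
  have s: "sides (xs @ [v]) A B" unfolding sides_def A_def B_def by simp
  obtain F1 where F1: "borders F1 {v, u}" "F1 \<subseteq> A" using side_has_bordering_face[OF xs(1) s] unfolding xs(2) .
  obtain F2 where F2: "borders F2 {v, u}" "F2 \<subseteq> B"
    using side_has_bordering_face[OF xs(1) sides_sym[OF s]] unfolding xs(2) .
  have "F1 \<noteq> {}" using F1(1) face_facts(5) unfolding borders_def by blast
  then have ne: "F1 \<noteq> F2" using F1(2) F2(2) sides_facts(3)[OF xs(1) s] by blast
  have uv: "{v, u} = {u, v}" by (simp add: insert_commute)
  have "good_face v F1 \<or> good_face v F2"
  proof (rule ccontr)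
    assume neg: "\<not> ?thesis"
    show False
    proof (rule no_two_bad_faces[OF F1(1)[unfolded uv] F2(1)[unfolded uv] ne _ deg])
      fix F x assume "F = F1 \<or> F = F2" "x \<in> V" "x \<noteq> v" "p x \<in> frontier F"
      then have "\<not> 5 \<le> card (nbrs E x)" using neg unfolding good_face_def by blast
      then show "card (nbrs E x) \<le> 4" by simp
    qed
  qed
  then show ?thesis using that F1(1) F2(1) by blast
qed

lemma three_linked_edges:
  assumes u: "u1 \<in> nbrs E v" "u2 \<in> nbrs E v" "u3 \<in> nbrs E v" and d: "u1 \<noteq> u2" "u3 \<noteq> u1" "u3 \<noteq> u2"
    and l: "linked v u1 u2" "linked v u3 u1" and F: "borders F {v, u1}" "borders F {v, u2}" "borders F {v, u3}"
  shows False
proof -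
  obtain xs where xs: "gpath xs" "xs \<noteq> []" "hd xs = u1" "last xs = u2" "v \<notin> set xs"
    using link_path[OF nbr_facts(1)[OF u(1)] l(1)] by metis
  have "u1 \<in> set xs" using xs(2,3) by auto
  then obtain ys where ys: "ys \<noteq> []" "hd ys = u3" "last ys \<in> set xs" "set ys \<inter> set xs = {last ys}" "distinct ys"
    "set ys \<subseteq> V - {v}" "path_edges ys \<subseteq> E"
    using path_to_set[OF l(2) nbr_facts(1)[OF u(3)]] by metis
  have "gpath ys" unfolding gpath_def using ys by blast
  moreover have "v \<notin> set ys" using ys(6) by blast
  ultimately show False
    using face_borders_two_edges[OF xs(1,5) _ _ ys(1,3,4), of F] d F xs(3,4) ys(2) by simp
qed

text \<open>Double counting: every edge from \<open>v\<close> to \<open>U\<close> has a good face,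
  and by \<open>three_linked_edges\<close> no face takes more than two of these edges.\<close>

lemma many_good_faces:
  assumes U: "U \<subseteq> nbrs E v" "\<And>a b. a \<in> U \<Longrightarrow> b \<in> U \<Longrightarrow> linked v a b" and deg: "card (nbrs E v) \<le> 5"
  obtains S where "finite S" "card U \<le> 2 * card S" "\<And>F. F \<in> S \<Longrightarrow> good_face v F \<and> (\<exists>u\<in>U. borders F {v, u})"
proof -
  have "\<exists>F. borders F {v, u} \<and> good_face v F" if "u \<in> U" for u
    using good_bordering_face[of u v] U(1) that deg by blast
  then obtain g where g: "\<And>u. u \<in> U \<Longrightarrow> borders (g u) {v, u} \<and> good_face v (g u)" by metis
  have finU: "finite U" using U(1) nbrs_facts(2)[OF graph] finite_subset by blast
  define B where "B F = {u \<in> U. borders F {v, u}}" for F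
  have two: "card (B F) \<le> 2" for F
  proof (rule ccontr)
    assume "\<not> card (B F) \<le> 2"
    then obtain T where T: "T \<subseteq> B F" "card T = 3" using obtain_subset_with_card_n[of 3 "B F"] by auto
    then obtain a b c where "T = {a, b, c}" "a \<noteq> b" "b \<noteq> c" "a \<noteq> c" by (auto simp: card_3_iff)
    then have "a \<in> B F" "b \<in> B F" "c \<in> B F" "a \<noteq> b" "c \<noteq> a" "c \<noteq> b" using T(1) by auto
    then show False using three_linked_edges[of a v b c F] U unfolding B_def by blast
  qed
  have "U \<subseteq> (\<Union>F\<in>g ` U. B F)" using g unfolding B_def by blast
  then have "card U \<le> card (\<Union>F\<in>g ` U. B F)" using finU by (intro card_mono) (auto simp: B_def)
  also have "\<dots> \<le> (\<Sum>F\<in>g ` U. card (B F))" by (rule card_UN_le) (use finU in simp)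
  also have "\<dots> \<le> (\<Sum>F\<in>g ` U. 2)" by (rule sum_mono) (rule two)
  finally have "card U \<le> 2 * card (g ` U)" by simp
  then show ?thesis using that[of "g ` U"] finU g by blast
qed

text \<open>The face is taken on the side, away from \<open>Z\<close>, of a cycle through
  \<open>{v, y1}\<close> inside the component of \<open>y1\<close> and \<open>v\<close>; so it
  differs from all faces found at \<open>Z\<close>. Were it bad, its boundary path would contain
  \<open>y1\<close> and \<open>y2\<close> and hence cut the rest of their component off from
  \<open>v\<close>, and \<open>reducible_separator\<close> would apply at \<open>y1\<close>.\<close>

lemma good_face_of_small_class:
  assumes deg: "card (nbrs E v) \<le> 5"
    and y: "y1 \<in> nbrs E v" "y2 \<in> nbrs E v" "y1 \<noteq> y2" "linked v y1 y2"
    and cls: "\<And>w. w \<in> nbrs E v \<Longrightarrow> linked v y1 w \<Longrightarrow> w = y1 \<or> w = y2"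
    and Z: "z0 \<in> Z" "Z \<subseteq> nbrs E v" "\<And>z. z \<in> Z \<Longrightarrow> linked v z0 z" "\<not> linked v y1 z0"
  obtains F where "borders F {v, y1}" "good_face v F" "\<And>z. z \<in> Z \<Longrightarrow> \<not> borders F {v, z}"
proof -
  note n1 = nbr_facts[OF y(1)]
  have z0: "z0 \<in> nbrs E v" using Z by blast
  note nz = nbr_facts[OF z0]
  obtain xs where xs: "gcycle (xs @ [v])" "closing (xs @ [v]) = {v, y1}" "v \<notin> set xs" "\<And>x. x \<in> set xs \<Longrightarrow> linked v y1 x"
    by (rule link_cycle[OF y(1,2) y(3)[symmetric] y(4)]) (rule that)
  have unl: "\<not> linked v y1 x" if "linked v z0 x" for x
  proof
    assume "linked v y1 x"
    then have "linked v y1 z0" using adj_rtrancl_sym[OF that] by (rule rtrancl_trans)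
    then show False using Z(4) by blast
  qed
  have offcycle: "{v, z} \<notin> insert (closing (xs @ [v])) (path_edges (xs @ [v]))" if "linked v z0 z" "z \<noteq> v" for z
  proof
    assume a: "{v, z} \<in> insert (closing (xs @ [v])) (path_edges (xs @ [v]))"
    have "\<forall>e\<in>insert (closing (xs @ [v])) (path_edges (xs @ [v])). e \<subseteq> set (xs @ [v])"
      using gcycle_subgraph[OF xs(1)] unfolding subgraph_def by (elim conjE)
    then have "{v, z} \<subseteq> set (xs @ [v])" using a by (rule bspec)
    then have "z \<in> set xs" using that(2) by simp
    then show False using xs(4) unl[OF that(1)] by blast
  qed
  have "open_edge {v, z0} \<inter> cycle_image (xs @ [v]) = {}"
    unfolding cycle_image_def
    by (rule open_edge_drawing[OF gcycle_subgraph[OF xs(1)] nz(2) offcycle]) (use nz(1) in auto)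
  then obtain A B where s: "sides (xs @ [v]) A B" "open_edge {v, z0} \<subseteq> A"
    using sides_obtain[OF xs(1) closure_open_edge(1)[OF nz(2)]] by blast
  have zA: "open_edge {v, z} \<subseteq> A" if z: "z \<in> Z" for z
  proof -
    obtain ws where ws: "gpath ws" "ws \<noteq> []" "hd ws = z0" "last ws = z" "v \<notin> set ws" "\<And>x. x \<in> set ws \<Longrightarrow> linked v z0 x"
      by (rule link_path[OF nz(1) Z(3)[OF z]]) (rule that)
    have dis: "set (xs @ [v]) \<inter> set ws = {}" using ws(5,6) xs(4) unl by auto
    have zv: "{z, v} \<in> E" using nbr_facts(3)[of z v] Z(2) z by blast
    have "open_edge {last ws, v} \<subseteq> A"
      by (rule edges_to_path_same_side[OF xs(1) ws(1,2) dis _ _ s(1)]) (use ws(3,4) nz(2) zv s(2) in simp_all)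
    then show ?thesis unfolding ws(4) by (simp add: insert_commute)
  qed
  obtain F where F: "borders F {v, y1}" "F \<subseteq> B"
    using side_has_bordering_face[OF xs(1) sides_sym[OF s(1)]] unfolding xs(2) .
  obtain F' where F': "borders F' {v, y1}" "F' \<subseteq> A"
    using side_has_bordering_face[OF xs(1) s(1)] unfolding xs(2) .
  have "F \<noteq> {}" using F(1) face_facts(5) unfolding borders_def by blast
  then have ne: "F \<noteq> F'" using F(2) F'(2) sides_facts(3)[OF xs(1) s(1)] by blast
  have nob: "\<not> borders F {v, z}" if z: "z \<in> Z" for z
  proof
    assume b: "borders F {v, z}"
    have zn: "z \<in> nbrs E v" using Z(2) z by blast
    have "z \<noteq> v" using nbr_facts(1)[OF zn] by blast
    then have "open_edge {v, z} \<subseteq> B"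
      using bordered_edge_side[OF xs(1) sides_sym[OF s(1)] b F(2) offcycle[OF Z(3)[OF z]]] by blast
    then show False
      using zA[OF z] sides_facts(3)[OF xs(1) s(1)] open_edge_nonempty[OF nbr_facts(2)[OF zn]] by blast
  qed
  have "good_face v F"
  proof (rule ccontr)
    assume neg: "\<not> good_face v F"
    have d4: "card (nbrs E x) \<le> 4" if "x \<in> V" "x \<noteq> v" "p x \<in> frontier F" for x
    proof -
      have "\<not> 5 \<le> card (nbrs E x)" using neg that unfolding good_face_def by blast
      then show ?thesis by simp
    qed
    have uv: "{v, y1} = {y1, v}" by (simp add: insert_commute)
    obtain as where cas: "chordless y1 as v" and as3: "\<And>x. x \<in> set as \<Longrightarrow> x \<in> V \<and> p x \<in> frontier F"
      by (rule boundary_path[OF F(1)[unfolded uv] F'(1)[unfolded uv] ne]) (rule that)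
    note as = chordlessD(1,2)[OF cas] as3 chordlessD(3)[OF cas]
    define D where "D = set (y1 # as)"
    have pD: "path_edges (y1 # as) \<subseteq> E" using path_edges_butlast[of y1 as v] as(4) by blast
    have DV: "D \<subseteq> V - {v}" unfolding D_def using as(2,3) n1(1) by auto
    have linkD: "linked v y1 x" if "x \<in> D" for x
      using path_adj_rtrancl[OF pD DV[unfolded D_def]] that unfolding D_def by blast
    \<comment> \<open>The last inner vertex of the boundary path is a neighbour of \<open>v\<close>
      in the component of \<open>y1\<close>, but not \<open>y1\<close> itself.\<close>
    have "y2 \<in> D"
    proof -
      have "{last as, v} \<in> E"
        using as(4) path_edges_append[of "y1 # as" "[v]"] as(1) by auto
      then have "last as \<in> nbrs E v" unfolding nbrs_def by (simp add: insert_commute)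
      moreover have "last as \<in> D" unfolding D_def using as(1) by simp
      ultimately have "last as = y1 \<or> last as = y2" using cls linkD by blast
      moreover have "last as \<noteq> y1" using as(1,2) last_in_set[OF as(1)] by auto
      ultimately show ?thesis using \<open>last as \<in> D\<close> by blast
    qed
    have y1D: "y1 \<in> D" unfolding D_def by simp
    have degD: "card (nbrs E x) \<le> 4" if x: "x \<in> D" for x
    proof -
      have "p x \<in> frontier F" using x as(3) borders_vertex[OF F(1), of y1] unfolding D_def by auto
      then show ?thesis using d4 x DV by blast
    qed
    \<comment> \<open>What remains of the component when the path is removed. Both neighbours of
      \<open>v\<close> in the component lie on the path, so no edge leads from \<open>I\<close> to
      \<open>v\<close>.\<close>
    define I where "I = {x. linked v y1 x} - D"
    define W where "W = V - D - I"
    have IV: "I \<subseteq> V - {v}" unfolding I_def using linked_in[OF _ n1(1)] by blast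
    have vV: "v \<in> V" using edge_subset[OF n1(2)] by simp
    have vW: "v \<in> W" unfolding W_def using vV DV IV by blast
    have "\<exists>r. r \<in> nbrs E y1 \<and> r \<notin> D \<union> {v}"
    proof (rule ccontr)
      assume neg: "\<not> ?thesis"
      have "nbrs E y1 \<subseteq> {v, hd as}"
      proof
        fix x assume x: "x \<in> nbrs E y1"
        have "x \<noteq> y1" using x nbrs_facts(3)[OF graph, of y1] by blast
        then have "x = v \<or> x \<in> set as" using neg x unfolding D_def by auto
        then show "x \<in> {v, hd as}" using nbrs_on_chordless_path[OF cas x] by blast
      qed
      then have "card (nbrs E y1) \<le> card {v, hd as}" by (intro card_mono) auto
      also have "\<dots> \<le> 2" by (simp add: card_insert_if)
      finally show False using crit.min_degree[of y1] n1(1) by simp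
    qed
    then obtain r where r: "r \<in> nbrs E y1" "r \<notin> D" "r \<noteq> v" by blast
    have rE: "{y1, r} \<in> E" using r unfolding nbrs_def by simp
    have rI: "r \<in> I" unfolding I_def using link_edge[OF _ n1(1) rE r(3)] r(2) by blast
    show False
    proof (rule crit.reducible_separator[OF _ y1D _ degD _ _ _ rI rE vW n1(3)])
      show "D \<subseteq> V" using DV by blast
      show "(y1, x) \<in> (adj D E)\<^sup>*" if "x \<in> D" for x
        using path_adj_rtrancl[OF pD, of D x] that unfolding D_def by blast
      show "V - D = I \<union> W" "I \<inter> W = {}" unfolding W_def using IV unfolding I_def by blast+
      show "{a, c} \<notin> E" if ac: "a \<in> I" "c \<in> W" for a c
      proof
        assume e: "{a, c} \<in> E"
        have la: "linked v y1 a" "a \<notin> D" using ac(1) unfolding I_def by auto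
        show False
        proof (cases "c = v")
          case True
          then have "a \<in> nbrs E v" using e unfolding nbrs_def by (simp add: insert_commute)
          then show False using cls[OF _ la(1)] la(2) y1D \<open>y2 \<in> D\<close> by blast
        next
          case False
          then have "linked v y1 c" using link_edge[OF la(1) n1(1) e] by blast
          then show False using ac(2) unfolding W_def I_def by blast
        qed
      qed
    qed
  qed
  then show ?thesis using that F(1) nob by blast
qed

text \<open>No class of linked neighbours is a singleton, so five neighbours form one class or split
  into two and three; the rounding in \<open>many_good_faces\<close> completes the count.\<close>

lemma three_good_faces:
  assumes deg: "card (nbrs E v) = 5"
  obtains S where "card S = 3" "\<And>F. F \<in> S \<Longrightarrow> good_face v F \<and> (\<exists>u\<in>nbrs E v. borders F {v, u})"
proof -
  define N where "N = nbrs E v"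
  have finN: "finite N" unfolding N_def by (rule nbrs_facts(2)[OF graph])
  have deg5: "card (nbrs E v) \<le> 5" using deg by simp
  have "\<exists>S. finite S \<and> card S \<ge> 3 \<and> (\<forall>F\<in>S. good_face v F \<and> (\<exists>u\<in>N. borders F {v, u}))"
  proof (cases "\<forall>a\<in>N. \<forall>b\<in>N. linked v a b")
    case True
    obtain S where S: "finite S" "card N \<le> 2 * card S" "\<And>F. F \<in> S \<Longrightarrow> good_face v F \<and> (\<exists>u\<in>N. borders F {v, u})"
      by (rule many_good_faces[of N v]) (use True deg5 in \<open>auto simp: N_def\<close>)
    then have "card S \<ge> 3" using deg unfolding N_def by simp
    then show ?thesis using S by blast
  next
    case False
    define cls where "cls u = {w \<in> N. linked v u w}" for u
    have clsN: "cls u \<subseteq> N" "finite (cls u)" for u unfolding cls_def using finN by auto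
    have cls2: "card (cls u) \<ge> 2" if uN: "u \<in> N" for u
    proof -
      obtain w where w: "w \<in> N" "w \<noteq> u" "linked v u w"
        using linked_nbr_exists[OF uN[unfolded N_def]] unfolding N_def .
      then have "{u, w} \<subseteq> cls u" using uN unfolding cls_def by auto
      then have "card {u, w} \<le> card (cls u)" using clsN by (intro card_mono) auto
      then show ?thesis using w by simp
    qed
    have clsd: "cls a \<inter> cls b = {}" if "\<not> linked v a b" for a b
    proof -
      have "linked v a b" if "linked v a x" "linked v b x" for x
        using rtrancl_trans[OF that(1) adj_rtrancl_sym[OF that(2)]] .
      then show ?thesis using that unfolding cls_def by blast
    qed
    obtain a b where ab: "a \<in> N" "b \<in> N" "\<not> linked v a b" using False by blast
    have "card (cls a) + card (cls b) = card (cls a \<union> cls b)"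
      using card_Un_disjoint[OF clsN(2) clsN(2) clsd[OF ab(3)]] by simp
    also have "\<dots> \<le> card N" using clsN finN by (intro card_mono) auto
    finally have "card (cls a) + card (cls b) \<le> 5" using deg unfolding N_def by simp
    \<comment> \<open>Two classes of at least two members share at most five neighbours.\<close>
    then have "card (cls a) = 2 \<or> card (cls b) = 2" using cls2[OF ab(1)] cls2[OF ab(2)] by linarith
    then obtain y1 where y1: "y1 \<in> N" "card (cls y1) = 2" using ab by blast
    obtain y2 where y2: "y2 \<in> N" "y2 \<noteq> y1" "linked v y1 y2"
      using linked_nbr_exists[OF y1(1)[unfolded N_def]] unfolding N_def .
    have "cls y1 = {y1, y2}"
    proof -
      have "{y1, y2} \<subseteq> cls y1" using y1 y2 unfolding cls_def by auto
      then show ?thesis using card_subset_eq[OF clsN(2)] y1(2) y2(2) by (metis card_2_iff)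
    qed
    define Z where "Z = N - cls y1"
    have "card Z = 3" unfolding Z_def using card_Diff_subset[OF clsN(2) clsN(1)] y1(2) deg unfolding N_def by simp
    have Zcls: "cls z \<subseteq> Z" if "z \<in> Z" for z
    proof -
      have "\<not> linked v y1 z" using that unfolding Z_def cls_def by blast
      then show ?thesis using clsd[of y1 z] clsN(1) unfolding Z_def by blast
    qed
    \<comment> \<open>Two different classes inside \<open>Z\<close> would need four members, but
      only three neighbours are left.\<close>
    have Zlinked: "linked v z z'" if z: "z \<in> Z" "z' \<in> Z" for z z'
    proof (rule ccontr)
      assume n: "\<not> linked v z z'"
      have finZ: "finite Z" unfolding Z_def using finN by simp
      have "card (cls z) + card (cls z') = card (cls z \<union> cls z')"
        using card_Un_disjoint[OF clsN(2) clsN(2) clsd[OF n]] by simp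
      also have "\<dots> \<le> card Z" using Zcls z finZ by (intro card_mono) auto
      finally show False using cls2[of z] cls2[of z'] z \<open>card Z = 3\<close> unfolding Z_def by simp
    qed
    have ZN: "Z \<subseteq> nbrs E v" unfolding Z_def N_def by blast
    obtain S where S: "finite S" "card Z \<le> 2 * card S" "\<And>F. F \<in> S \<Longrightarrow> good_face v F \<and> (\<exists>u\<in>Z. borders F {v, u})"
      by (rule many_good_faces[OF ZN Zlinked deg5]) (assumption+, rule that)
    obtain z0 where z0: "z0 \<in> Z" using \<open>card Z = 3\<close> by (metis card.empty equals0I zero_neq_numeral)
    have yN: "y1 \<in> nbrs E v" "y2 \<in> nbrs E v" using y1 y2 unfolding N_def by auto
    have ycls: "w = y1 \<or> w = y2" if "w \<in> nbrs E v" "linked v y1 w" for w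
      using that \<open>cls y1 = {y1, y2}\<close> unfolding cls_def N_def by blast
    have z0l: "linked v z0 z" if "z \<in> Z" for z using Zlinked[OF z0 that] .
    have z0n: "\<not> linked v y1 z0" using z0 unfolding Z_def cls_def by blast
    obtain F where F: "borders F {v, y1}" "good_face v F" "\<And>z. z \<in> Z \<Longrightarrow> \<not> borders F {v, z}"
      by (rule good_face_of_small_class[OF deg5 yN y2(2)[symmetric] y2(3) ycls z0 ZN z0l z0n]) (assumption+, rule that)
    have "F \<notin> S" using S(3) F(3) by blast
    then have "card (insert F S) = Suc (card S)" using S(1) by simp
    moreover have "card S \<ge> 2" using S(2) \<open>card Z = 3\<close> by simp
    ultimately have "card (insert F S) \<ge> 3" by simp
    moreover have "good_face v G \<and> (\<exists>u\<in>N. borders G {v, u})" if "G \<in> insert F S" for G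
      using that S(3) F(1,2) y1(1) unfolding Z_def by blast
    ultimately show ?thesis using S(1) by blast
  qed
  then obtain S where S: "finite S" "card S \<ge> 3" "\<forall>F\<in>S. good_face v F \<and> (\<exists>u\<in>N. borders F {v, u})" by blast
  obtain T where "T \<subseteq> S" "card T = 3" using obtain_subset_with_card_n[OF S(2)] by blast
  then show ?thesis using that[of T] S(3) unfolding N_def by blast
qed

end

theorem theorem2:
  fixes V :: "'a set" and E :: "'a set set"
    and p :: "'a \<Rightarrow> complex" and \<gamma> :: "'a set \<Rightarrow> real \<Rightarrow> complex" and v :: 'a
  assumes "minimal_non_4_choosable_planar V E"
    and "plane_embedding V E p \<gamma>"
    and "v \<in> V" and "vertex_degree E v = 5"
  shows "\<exists>S \<subseteq> faces V E p \<gamma>. card S = 3 \<and>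
           (\<forall>F\<in>S. incident p F v \<and> card {w \<in> V. incident p F w \<and> vertex_degree E w \<ge> 5} \<ge> 2)"
proof -
  have g: "simple_graph V E" and nc: "\<not> choosable 4 V E"
    using assms(1) unfolding minimal_non_4_choosable_planar_def by auto
  obtain L :: "'a \<Rightarrow> nat set" where L: "\<forall>x\<in>V. finite (L x) \<and> card (L x) = 4"
      "\<not> (\<exists>c. (\<forall>x\<in>V. c x \<in> L x) \<and> (\<forall>u w. {u, w} \<in> E \<longrightarrow> c u \<noteq> c w))"
    using nc unfolding choosable_def by blast
  interpret bad_plane_graph V E p \<gamma> L
    by unfold_locales (use g assms(1,2) L in \<open>auto simp: proper_def\<close>)
  note dn = degree_nbrs[OF g]
  obtain S where S: "card S = 3" "\<And>F. F \<in> S \<Longrightarrow> good_face v F \<and> (\<exists>u\<in>nbrs E v. borders F {v, u})"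
    using three_good_faces[of v] assms(4) unfolding dn by metis
  have "F \<in> faces V E p \<gamma> \<and> incident p F v \<and> card {w \<in> V. incident p F w \<and> vertex_degree E w \<ge> 5} \<ge> 2"
    if F: "F \<in> S" for F
  proof -
    obtain u where u: "borders F {v, u}" using S(2)[OF F] by blast
    obtain w where w: "w \<in> V" "w \<noteq> v" "p w \<in> frontier F" "card (nbrs E w) \<ge> 5"
      using S(2)[OF F] unfolding good_face_def by blast
    have inc: "incident p F v" unfolding incident_def using borders_vertex[OF u] by simp
    have "{v, w} \<subseteq> {w \<in> V. incident p F w \<and> vertex_degree E w \<ge> 5}"
      using assms(3,4) inc w unfolding dn incident_def by auto
    then have "card {v, w} \<le> card {w \<in> V. incident p F w \<and> vertex_degree E w \<ge> 5}"
      by (intro card_mono) (use finite_V in auto)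
    then show ?thesis using u inc w(2) unfolding borders_def by simp
  qed
  then show ?thesis using S(1) by blast
qed

end
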